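(* Let $p$ be a prime, let $G$ and $H$ be finite $p$-groups and let $k$ be a field of characteristic $p$. If $kG\cong kH$ as $k$-algebras, then $\mathrm{Ab}(G)\cong \mathrm{Ab}(H)$.
   Context: For a group $\Gamma$, $k\Gamma$ denotes the group algebra of $\Gamma$ over $k$. For a finite $p$-group $G$, consider internal direct product decompositions $G=\mathrm{Ab}(G)\oplus \mathrm{NAb}(G)$ where $\mathrm{Ab}(G)$ and $\mathrm{NAb}(G)$ are subgroups of $G$ such that $\mathrm{Ab}(G)$ is abelian and maximal such that a decomposition like that exists. By the Krull–Remak–Schmidt theorem the isomorphism type of $\mathrm{Ab}(G)$ does not depend on the chosen decomposition; equivalently, $\mathrm{Ab}(G)$ is the product of the abelian factors in a decomposition of $G$ as a direct product of indecomposable groups. *)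

theory Defs
  imports "HOL-Algebra.Algebra"
begin

definition finite_p_group :: "nat \<Rightarrow> ('g, 'm) monoid_scheme \<Rightarrow> bool"
  where "finite_p_group p G \<longleftrightarrow> group G \<and> finite (carrier G) \<and> (\<exists>n. order G = p ^ n)"

(* Record counterpart of the type-class constant CHAR; it is 0 if no positive multiple
   of the unit vanishes. *)
definition characteristic :: "('k, 'm) ring_scheme \<Rightarrow> nat"
  where "characteristic K = Gcd {n::nat. [n] \<cdot>\<^bsub>K\<^esub> \<one>\<^bsub>K\<^esub> = \<zero>\<^bsub>K\<^esub>}"

(* A formal linear combination of group elements is represented by its coefficient function,
   extensional and of finite support. The product is convolution: the coefficient of x is the
   sum of f y * g z over all y, z with y * z = x. It is summed over the support of f
   because finsum is only meaningful on finite index sets. *)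
definition group_algebra ::
    "('k, 'm) ring_scheme \<Rightarrow> ('g, 'n) monoid_scheme \<Rightarrow> ('k, 'g \<Rightarrow> 'k) module"
  where "group_algebra K G = \<lparr>
    carrier = {f \<in> carrier G \<rightarrow>\<^sub>E carrier K. finite {x \<in> carrier G. f x \<noteq> \<zero>\<^bsub>K\<^esub>}},
    monoid.mult = (\<lambda>f g. \<lambda>x\<in>carrier G.
      \<Oplus>\<^bsub>K\<^esub>y\<in>{y \<in> carrier G. f y \<noteq> \<zero>\<^bsub>K\<^esub>}. f y \<otimes>\<^bsub>K\<^esub> g (inv\<^bsub>G\<^esub> y \<otimes>\<^bsub>G\<^esub> x)),
    monoid.one = (\<lambda>x\<in>carrier G. if x = \<one>\<^bsub>G\<^esub> then \<one>\<^bsub>K\<^esub> else \<zero>\<^bsub>K\<^esub>),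
    ring.zero = (\<lambda>x\<in>carrier G. \<zero>\<^bsub>K\<^esub>),
    ring.add = (\<lambda>f g. \<lambda>x\<in>carrier G. f x \<oplus>\<^bsub>K\<^esub> g x),
    smult = (\<lambda>c f. \<lambda>x\<in>carrier G. c \<otimes>\<^bsub>K\<^esub> f x)\<rparr>"

(* The library locale algebra covers only commutative algebras. *)
definition algebra_iso ::
    "('k, 'm) ring_scheme \<Rightarrow> ('k, 'a, 'n) module_scheme \<Rightarrow> ('k, 'b, 'o) module_scheme \<Rightarrow> ('a \<Rightarrow> 'b) set"
  where "algebra_iso K A B = {h \<in> ring_iso A B.
    \<forall>c\<in>carrier K. \<forall>x\<in>carrier A. h (c \<odot>\<^bsub>A\<^esub> x) = c \<odot>\<^bsub>B\<^esub> h x}"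

definition algebra_isomorphic ::
    "('k, 'm) ring_scheme \<Rightarrow> ('k, 'a, 'n) module_scheme \<Rightarrow> ('k, 'b, 'o) module_scheme \<Rightarrow> bool"
  where "algebra_isomorphic K A B \<longleftrightarrow> algebra_iso K A B \<noteq> {}"

definition internal_direct_product :: "('g, 'm) monoid_scheme \<Rightarrow> 'g set \<Rightarrow> 'g set \<Rightarrow> bool"
  where "internal_direct_product G A N \<longleftrightarrow>
    A \<lhd> G \<and> N \<lhd> G \<and> A \<inter> N = {\<one>\<^bsub>G\<^esub>} \<and> A <#>\<^bsub>G\<^esub> N = carrier G"

definition abelian_decomposition :: "('g, 'm) monoid_scheme \<Rightarrow> 'g set \<Rightarrow> 'g set \<Rightarrow> bool"
  where "abelian_decomposition G A N \<longleftrightarrow>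
    internal_direct_product G A N \<and> comm_group (G\<lparr>carrier := A\<rparr>)"

(* is_Ab_NAb G A N: A and N are a possible choice of Ab(G) and NAb(G). These subgroups are not
   unique; maximality is with respect to inclusion. *)
definition is_Ab_NAb :: "('g, 'm) monoid_scheme \<Rightarrow> 'g set \<Rightarrow> 'g set \<Rightarrow> bool"
  where "is_Ab_NAb G A N \<longleftrightarrow> abelian_decomposition G A N \<and>
    (\<forall>A' N'. abelian_decomposition G A' N' \<and> A \<subseteq> A' \<longrightarrow> A' = A)"

lemma abelian_decomposition_trivial:
  assumes "group G"
  shows "abelian_decomposition G {\<one>\<^bsub>G\<^esub>} (carrier G)"
proof -
  interpret group G by fact
  have "comm_group (G\<lparr>carrier := {\<one>\<^bsub>G\<^esub>}\<rparr>)"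
    by (rule group.group_comm_groupI)
      (auto intro!: subgroup.subgroup_is_group triv_subgroup group_axioms)
  then show ?thesis
    using one_is_normal normal_self
    by (auto simp: abelian_decomposition_def internal_direct_product_def set_mult_def)
qed

lemma is_Ab_NAb_exists:
  assumes "group G" "finite (carrier G)"
  shows "\<exists>A N. is_Ab_NAb G A N"
proof -
  define S where "S = {A. \<exists>N. abelian_decomposition G A N}"
  have sub: "S \<subseteq> Pow (carrier G)"
    by (auto simp: S_def abelian_decomposition_def internal_direct_product_def
        dest: normal_imp_subgroup[THEN subgroup.subset])
  then have "finite S" using assms(2) by (meson finite_Pow_iff finite_subset)
  moreover have "S \<noteq> {}" using abelian_decomposition_trivial[OF assms(1)] by (auto simp: S_def)
  ultimately obtain A where "A \<in> S" "\<And>A'. A' \<in> S \<Longrightarrow> A \<subseteq> A' \<Longrightarrow> A = A'"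
    using finite_has_maximal by metis
  then show ?thesis by (auto simp: S_def is_Ab_NAb_def)
qed

end

theory Submission
  imports Defs "HOL-Number_Theory.Cong"
begin

text \<open>
  A finite abelian \<open>p\<close>-group is determined by the numbers of cyclic factors of order \<open>p^(l+1)\<close>,
  \<open>l \<ge> 0\<close>, in a decomposition into cyclic groups. So fix \<open>l\<close>, put \<open>q = p^l\<close>, and let \<open>r(G)\<close> be this
  number for \<open>Ab(G)\<close>. The claim is that \<open>r(G)\<close> can be read off from the algebra \<open>KG\<close>: it is the rank
  of a pairing. On one side of the pairing are the central units \<open>x\<close> with \<open>x^(pq) = 1\<close>. On the other
  side are the linear functionals \<open>\<lambda>\<close> on \<open>KG\<close> with \<open>\<lambda>(xyz) = \<lambda>(yxz)\<close> and
  \<open>\<lambda>((xy)^q) = \<lambda>(x^q) + \<lambda>(y^q)\<close> for all units \<open>x, y\<close> of \<open>p\<close>-power order. The value of the pairing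
  is \<open>\<lambda>(x^q)\<close>.

  The rank is at least \<open>r(G)\<close>: a generator \<open>a\<^sub>i\<close> of a cyclic factor of order \<open>p^(l+1)\<close> is a central
  unit, and the coordinate of \<open>G\<close> along \<open>a\<^sub>i\<close> provides a functional with value \<open>1\<close> at \<open>a\<^sub>i^q\<close>
  and \<open>0\<close> at the other \<open>a\<^sub>k^q\<close> (\<open>coordinate_frobenius_trace\<close>).

  The rank is at most \<open>r(G)\<close>: if \<open>\<lambda>\<close> kills all these \<open>a\<^sub>i^q\<close>, then it kills every \<open>x^q\<close>
  (\<open>frobenius_trace_vanishes\<close>). Indeed a trace in characteristic \<open>p\<close> satisfies
  \<open>\<lambda>(x^q) = \<Sum>\<^sub>g x(g)^q \<lambda>(g^q)\<close> (\<open>trace_frobenius\<close>), because the words of length \<open>q\<close> in the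
  expansion of \<open>x^q\<close> that are not constant cancel under rotation. As \<open>x\<close> is central, its coefficients are
  constant on conjugacy classes, and a noncentral class has size divisible by \<open>p\<close>; only the sum over the centre
  \<open>Z\<close> remains. The condition \<open>x^(pq) = 1\<close> says that the coefficients of \<open>x\<close> add up to zero over
  each set of all \<open>z \<in> Z\<close> with a given \<open>z^(pq) \<noteq> 1\<close>. It remains to see that \<open>\<lambda>(z^q) = 0\<close> if
  \<open>z^(pq) = 1\<close>. The component of \<open>z\<close> in \<open>Ab(G)\<close> is handled by coordinates. For its
  component \<open>n\<close> in \<open>NAb(G)\<close>, the element \<open>n^q\<close> lies in \<open>G' G^(pq)\<close>, where \<open>\<lambda>\<close> vanishes; otherwise \<open>n\<close>
  would generate a direct factor and \<open>Ab(G)\<close> would not be maximal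
  (\<open>maximal_abelian_factor_no_split\<close>).

  An isomorphism of algebras respects the pairing, and comparing the two bounds by linear algebra gives
  \<open>r(G) \<le> r(H)\<close> (\<open>card_coordinates_le\<close>); the reverse inequality follows by symmetry.
\<close>

section \<open>Sums over orbits of a p-group in characteristic p\<close>

lemma (in abelian_monoid) finsum_swap:
  assumes "finite A" "finite B" "\<And>a b. a \<in> A \<Longrightarrow> b \<in> B \<Longrightarrow> f a b \<in> carrier G"
  shows "(\<Oplus>a\<in>A. \<Oplus>b\<in>B. f a b) = (\<Oplus>b\<in>B. \<Oplus>a\<in>A. f a b)"
  using assms(1,3)
proof (induction A rule: finite_induct)
  case empty
  then show ?case by (simp add: finsum_zero)
next
  case (insert a A)
  have "(\<Oplus>x\<in>insert a A. \<Oplus>b\<in>B. f x b) = (\<Oplus>b\<in>B. f a b) \<oplus> (\<Oplus>b\<in>B. \<Oplus>x\<in>A. f x b)"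
    using insert by (subst finsum_insert) (auto intro!: finsum_closed)
  also have "\<dots> = (\<Oplus>b\<in>B. f a b \<oplus> (\<Oplus>x\<in>A. f x b))"
    using insert by (subst finsum_addf) (auto intro!: finsum_closed)
  also have "\<dots> = (\<Oplus>b\<in>B. \<Oplus>x\<in>insert a A. f x b)"
    using insert by (intro finsum_cong') (auto intro!: finsum_closed simp: finsum_insert Pi_iff)
  finally show ?case .
qed

lemma (in abelian_monoid) finsum_fibres:
  assumes "finite A" "\<And>a. a \<in> A \<Longrightarrow> f a \<in> carrier G"
  shows "(\<Oplus>a\<in>A. f a) = (\<Oplus>w\<in>h ` A. \<Oplus>a\<in>{a \<in> A. h a = w}. f a)"
proof -
  have "(\<Oplus>w\<in>h ` A. \<Oplus>a\<in>{a \<in> A. h a = w}. f a) = (\<Oplus>a\<in>(\<Union>w\<in>h ` A. {a \<in> A. h a = w}). f a)"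
    by (subst add.finprod_UN_disjoint) (use assms in \<open>auto simp: pairwise_def disjnt_def\<close>)
  moreover have "(\<Union>w\<in>h ` A. {a \<in> A. h a = w}) = A" by auto
  ultimately show ?thesis by simp
qed

locale char_p_field = field K for K (structure) +
  fixes p :: nat
  assumes prime_p: "Factorial_Ring.prime p"
    and char_p: "add_pow K p \<one> = \<zero>"
begin

lemma add_pow_p_multiple:
  assumes "x \<in> carrier K" "p dvd n"
  shows "add_pow K n x = \<zero>"
proof -
  obtain k where n: "n = p * k" using assms(2) by blast
  have "add_pow K p x = (add_pow K p \<one>) \<otimes> x"
    using add_pow_ldistr[of \<one> x p] assms(1) by simp
  then have "add_pow K p x = \<zero>" using assms(1) char_p by simp
  then have "add_pow K (p * k) x = \<zero>"
    using add.nat_pow_pow[OF assms(1), of k p] by (simp add: add.nat_pow_one)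
  then show ?thesis using n by simp
qed

lemma add_pow_one_cong:
  assumes "[a = b] (mod p)"
  shows "add_pow K a \<one> = add_pow K b \<one>"
proof -
  have red: "add_pow K c \<one> = add_pow K (c mod p) \<one>" for c
  proof -
    have "add_pow K c \<one> = add_pow K (p * (c div p)) \<one> \<oplus> add_pow K (c mod p) \<one>"
      using add.nat_pow_mult[of \<one> "p * (c div p)" "c mod p"] by simp
    then show ?thesis using add_pow_p_multiple[of \<one>] by simp
  qed
  show ?thesis using red[of a] red[of b] assms by (simp add: cong_def)
qed

text \<open>
  The other orbits have a size divisible by \<open>p\<close>, by the orbit-stabilizer theorem, and \<open>F\<close> is
  constant on each of them. Both conjugation on a group and rotation of words are used as actions.
\<close>

theorem finsum_fixed_points:
  assumes act: "group_action \<Gamma> E \<phi>" and ord: "order \<Gamma> = p ^ m"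
    and E: "finite E"
    and F: "\<And>x. x \<in> E \<Longrightarrow> F x \<in> carrier K"
    and inv: "\<And>g x. g \<in> carrier \<Gamma> \<Longrightarrow> x \<in> E \<Longrightarrow> F (\<phi> g x) = F x"
  shows "(\<Oplus>x\<in>E. F x) = (\<Oplus>x\<in>{x \<in> E. \<forall>g\<in>carrier \<Gamma>. \<phi> g x = x}. F x)"
proof -
  interpret group_action \<Gamma> E \<phi> by fact
  interpret \<Gamma>: group \<Gamma> using group_hom group_hom.axioms(1) by auto
  define Fix where "Fix = {x \<in> E. \<forall>g\<in>carrier \<Gamma>. \<phi> g x = x}"
  define Orbs where "Orbs = orbit \<Gamma> \<phi> ` (E - Fix)"
  have orb_sub: "orbit \<Gamma> \<phi> x \<subseteq> E" if "x \<in> E" for x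
    using element_image that by (auto simp: orbit_def)
  have un: "\<Union>Orbs = E - Fix"
  proof
    show "E - Fix \<subseteq> \<Union>Orbs" using orbit_refl by (auto simp: Orbs_def)
    show "\<Union>Orbs \<subseteq> E - Fix"
    proof
      fix y assume "y \<in> \<Union>Orbs"
      then obtain x where x: "x \<in> E" "x \<notin> Fix" "y \<in> orbit \<Gamma> \<phi> x" by (auto simp: Orbs_def)
      then have y: "y \<in> E" using orb_sub by blast
      then have "x \<in> orbit \<Gamma> \<phi> y" using orbit_sym x by blast
      then have "y \<in> Fix \<Longrightarrow> x = y" by (auto simp: orbit_def Fix_def)
      then show "y \<in> E - Fix" using x y by auto
    qed
  qed
  have zero: "(\<Oplus>y\<in>B. F y) = \<zero>" if B_orb: "B \<in> Orbs" for B
  proof -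
    obtain x where x: "x \<in> E" "x \<notin> Fix" and B: "B = orbit \<Gamma> \<phi> x" using B_orb by (auto simp: Orbs_def)
    have "card B * card (stabilizer \<Gamma> \<phi> x) = p ^ m"
      using orbit_stabilizer_theorem[OF x(1)] B ord by simp
    then obtain j where j: "card B = p ^ j"
      using divides_primepow_nat[OF prime_p] by (metis dvd_triv_left)
    obtain g where g: "g \<in> carrier \<Gamma>" "\<phi> g x \<noteq> x" using x by (auto simp: Fix_def)
    have "{x, \<phi> g x} \<subseteq> B" using B x orbit_refl g by (auto simp: orbit_def)
    moreover have "finite B" using orb_sub[OF x(1)] B E finite_subset by blast
    ultimately have "card {x, \<phi> g x} \<le> card B" by (intro card_mono)
    then have "j \<noteq> 0" using j g by (cases j) auto
    then have "p dvd card B" using j by simp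
    have "(\<Oplus>y\<in>B. F y) = (\<Oplus>y\<in>B. F x)"
      using B x F inv by (intro finsum_cong') (auto simp: orbit_def)
    also have "\<dots> = add_pow K (card B) (F x)" using x F by (intro add.finprod_const) auto
    finally show ?thesis using add_pow_p_multiple[OF F[OF x(1)] \<open>p dvd card B\<close>] by simp
  qed
  have "(\<Oplus>x\<in>E - Fix. F x) = (\<Oplus>B\<in>Orbs. \<Oplus>x\<in>B. F x)"
    unfolding un[symmetric]
  proof (rule add.finprod_Union_disjoint)
    show "finite Orbs" using E by (simp add: Orbs_def)
    show "finite B \<and> (\<forall>x\<in>B. F x \<in> carrier K)" if B_orb: "B \<in> Orbs" for B
    proof -
      have "B \<subseteq> E" using B_orb orb_sub by (auto simp: Orbs_def)
      then show ?thesis using E F finite_subset by blast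
    qed
    show "pairwise disjnt Orbs"
    proof (rule pairwiseI)
      fix B C assume BC: "B \<in> Orbs" "C \<in> Orbs" "B \<noteq> C"
      then have "B \<in> orbits \<Gamma> E \<phi>" "C \<in> orbits \<Gamma> E \<phi>" by (auto simp: Orbs_def orbits_def)
      then show "disjnt B C" using disjoint_union BC(3) by (auto simp: disjnt_def)
    qed
  qed
  also have "\<dots> = (\<Oplus>B\<in>Orbs. \<zero>)" using zero by (intro finsum_cong') auto
  finally have nonfix: "(\<Oplus>x\<in>E - Fix. F x) = \<zero>" by (simp add: finsum_zero)
  have "E = Fix \<union> (E - Fix)" by (auto simp: Fix_def)
  then have "(\<Oplus>x\<in>E. F x) = (\<Oplus>x\<in>Fix \<union> (E - Fix). F x)" by simp
  also have "\<dots> = (\<Oplus>x\<in>Fix. F x) \<oplus> (\<Oplus>x\<in>E - Fix. F x)"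
    using E F by (intro finsum_Un_disjoint) (auto simp: Fix_def)
  also have "\<dots> = (\<Oplus>x\<in>Fix. F x)"
    unfolding nonfix using F by (intro r_zero finsum_closed) (auto simp: Fix_def)
  finally show ?thesis unfolding Fix_def .
qed

end

lemma group_actionI:
  assumes "group \<Gamma>"
    and closed: "\<And>g x. g \<in> carrier \<Gamma> \<Longrightarrow> x \<in> E \<Longrightarrow> act g x \<in> E"
    and one: "\<And>x. x \<in> E \<Longrightarrow> act \<one>\<^bsub>\<Gamma>\<^esub> x = x"
    and comp: "\<And>g h x. g \<in> carrier \<Gamma> \<Longrightarrow> h \<in> carrier \<Gamma> \<Longrightarrow> x \<in> E \<Longrightarrow>
      act (g \<otimes>\<^bsub>\<Gamma>\<^esub> h) x = act g (act h x)"
  shows "group_action \<Gamma> E (\<lambda>g. \<lambda>x\<in>E. act g x)"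
proof -
  interpret group \<Gamma> by fact
  have bij: "bij_betw (act g) E E" if "g \<in> carrier \<Gamma>" for g
    by (rule bij_betwI[where g = "act (inv\<^bsub>\<Gamma>\<^esub> g)"])
      (use that closed one comp[symmetric] in auto)
  have Bij: "(\<lambda>x\<in>E. act g x) \<in> Bij E" if "g \<in> carrier \<Gamma>" for g
    using bij[OF that] by (auto simp: Bij_def cong: bij_betw_cong)
  have "(\<lambda>g. \<lambda>x\<in>E. act g x) \<in> hom \<Gamma> (BijGroup E)"
    using Bij closed comp by (auto simp: hom_def BijGroup_def compose_def fun_eq_iff)
  then show ?thesis
    by (simp add: group_action_def group_hom_def group_hom_axioms_def group_BijGroup is_group)
qed

definition words :: "'a set \<Rightarrow> nat \<Rightarrow> 'a list set"
  where "words A n = {w. set w \<subseteq> A \<and> length w = n}"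

lemma finite_words: "finite A \<Longrightarrow> finite (words A n)"
  by (simp add: words_def finite_lists_length_eq)

context char_p_field
begin

text \<open>
  The cyclic group of order \<open>p ^ m\<close> acts on the words of this length by rotation; its fixed points
  are the constant words.
\<close>

lemma finsum_words_rotation:
  assumes A: "finite A"
    and F: "\<And>w. w \<in> words A (p ^ m) \<Longrightarrow> F w \<in> carrier K"
    and rot: "\<And>w. w \<in> words A (p ^ m) \<Longrightarrow> F (rotate1 w) = F w"
  shows "(\<Oplus>w\<in>words A (p ^ m). F w) = (\<Oplus>a\<in>A. F (replicate (p ^ m) a))"
proof -
  let ?W = "words A (p ^ m)" and ?C = "integer_mod_group (p ^ m)"
  have pos: "p ^ m > 0" using prime_p prime_gt_0_nat by simp
  have closed: "rotate k w \<in> ?W" if "w \<in> ?W" for k w using that by (auto simp: words_def)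
  have Frot: "F (rotate k w) = F w" if "w \<in> ?W" for k w
    using that by (induction k) (auto simp: rot closed)
  have act: "group_action ?C ?W (\<lambda>k. \<lambda>w\<in>?W. rotate (nat k) w)"
  proof (rule group_actionI)
    fix g h w assume gh: "g \<in> carrier ?C" "h \<in> carrier ?C" and w: "w \<in> ?W"
    have "nat (int (p ^ m)) = length w" using w unfolding nat_int by (simp add: words_def)
    then have "nat (g \<otimes>\<^bsub>?C\<^esub> h) = (nat g + nat h) mod length w"
      using gh pos unfolding carrier_integer_mod_group mult_integer_mod_group
      by (subst nat_mod_distrib) (auto simp del: of_nat_power simp: nat_add_distrib)
    then show "rotate (nat (g \<otimes>\<^bsub>?C\<^esub> h)) w = rotate (nat g) (rotate (nat h) w)"
      by (simp add: rotate_rotate rotate_conv_mod[symmetric])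
  qed (auto simp: closed)
  have ord: "order ?C = p ^ m" using pos by (simp add: order_def carrier_integer_mod_group nat_power_eq)
  have fixed: "{w \<in> ?W. \<forall>k\<in>carrier ?C. (\<lambda>w\<in>?W. rotate (nat k) w) w = w} = replicate (p ^ m) ` A"
  proof (intro equalityI subsetI)
    fix w assume "w \<in> {w \<in> ?W. \<forall>k\<in>carrier ?C. (\<lambda>w\<in>?W. rotate (nat k) w) w = w}"
    then have w: "w \<in> ?W" and fx: "\<And>k. k \<in> carrier ?C \<Longrightarrow> rotate (nat k) w = w" by auto
    have len: "length w = p ^ m" using w by (simp add: words_def)
    have "w ! k = w ! 0" if "k < p ^ m" for k
    proof -
      have "int k \<in> carrier ?C" using that pos by (simp add: carrier_integer_mod_group flip: of_nat_power)
      then have "rotate k w = w" using fx by fastforce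
      then show ?thesis using nth_rotate[of 0 w k] that pos len by simp
    qed
    then have "w = replicate (p ^ m) (w ! 0)" using len by (intro nth_equalityI) auto
    moreover have "w ! 0 \<in> A" using w len pos by (auto simp: words_def subset_iff)
    ultimately show "w \<in> replicate (p ^ m) ` A" by blast
  next
    fix w assume "w \<in> replicate (p ^ m) ` A"
    then obtain a where a: "a \<in> A" "w = replicate (p ^ m) a" by blast
    have "rotate1 w = w" using pos
      by (metis a(2) One_nat_def Suc_pred replicate_Suc replicate_append_same rotate1.simps(2))
    then have "rotate k w = w" for k by (induction k) auto
    then show "w \<in> {w \<in> ?W. \<forall>k\<in>carrier ?C. (\<lambda>w\<in>?W. rotate (nat k) w) w = w}"
      using a by (auto simp: words_def)
  qed
  have "(\<Oplus>w\<in>?W. F w) = (\<Oplus>w\<in>replicate (p ^ m) ` A. F w)"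
    using finsum_fixed_points[OF act ord finite_words[OF A], where F = F] F Frot fixed by simp
  also have "\<dots> = (\<Oplus>a\<in>A. F (replicate (p ^ m) a))"
    using pos by (intro finsum_reindex) (auto intro!: F simp: words_def inj_on_def)
  finally show ?thesis .
qed

end

text \<open>Reversed order: the recursion then matches that of powers in a monoid.\<close>
primrec word_prod :: "('a, 'm) monoid_scheme \<Rightarrow> 'a list \<Rightarrow> 'a"
  where "word_prod G [] = \<one>\<^bsub>G\<^esub>"
  | "word_prod G (g # w) = word_prod G w \<otimes>\<^bsub>G\<^esub> g"

lemma (in monoid) word_prod_closed:
  "set w \<subseteq> carrier G \<Longrightarrow> word_prod G w \<in> carrier G"
  by (induction w) auto

lemma (in monoid) word_prod_append:
  "set v \<subseteq> carrier G \<Longrightarrow> set w \<subseteq> carrier G \<Longrightarrow>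
    word_prod G (v @ w) = word_prod G w \<otimes> word_prod G v"
  by (induction v) (auto simp: word_prod_closed m_assoc)

lemma (in monoid) word_prod_replicate:
  "word_prod G (replicate n g) = g [^] n"
  by (induction n) auto

lemma (in comm_monoid) word_prod_rotate1:
  "set w \<subseteq> carrier G \<Longrightarrow> word_prod G (rotate1 w) = word_prod G w"
  by (cases w) (auto simp: word_prod_append word_prod_closed m_comm)

lemma words_0: "words A 0 = {[]}"
  by (auto simp: words_def)

lemma (in abelian_monoid) finsum_words_Suc:
  assumes A: "finite A" and F: "\<And>w. w \<in> words A (Suc n) \<Longrightarrow> F w \<in> carrier G"
  shows "(\<Oplus>w\<in>words A (Suc n). F w) = (\<Oplus>a\<in>A. \<Oplus>w\<in>words A n. F (a # w))"
proof -
  have eq: "words A (Suc n) = (\<Union>a\<in>A. (#) a ` words A n)"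
    by (auto simp: words_def length_Suc_conv)
  have "(\<Oplus>w\<in>words A (Suc n). F w) = (\<Oplus>a\<in>A. \<Oplus>w\<in>(#) a ` words A n. F w)"
    unfolding eq by (subst add.finprod_UN_disjoint)
      (use A F in \<open>auto simp: finite_words pairwise_def disjnt_def words_def finite_lists_length_eq\<close>)
  also have "\<dots> = (\<Oplus>a\<in>A. \<Oplus>w\<in>words A n. F (a # w))"
    using F by (intro finsum_cong' finsum_reindex) (auto simp: words_def intro!: finsum_closed)
  finally show ?thesis .
qed

context char_p_field
begin

lemma finsum_power_words:
  assumes "finite A" "\<And>a. a \<in> A \<Longrightarrow> f a \<in> carrier K"
  shows "(\<Oplus>a\<in>A. f a) [^] (n::nat) = (\<Oplus>w\<in>words A n. word_prod K (map f w))"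
proof (induction n)
  case 0
  then show ?case by (simp add: words_0 finsum_insert)
next
  case (Suc n)
  have cl: "word_prod K (map f w) \<in> carrier K" if "set w \<subseteq> A" for w
    using that assms by (intro word_prod_closed) auto
  have "(\<Oplus>a\<in>A. f a) [^] Suc n = (\<Oplus>w\<in>words A n. word_prod K (map f w)) \<otimes> (\<Oplus>a\<in>A. f a)"
    using Suc by simp
  also have "\<dots> = (\<Oplus>a\<in>A. (\<Oplus>w\<in>words A n. word_prod K (map f w)) \<otimes> f a)"
    using assms cl by (intro finsum_rdistr) (auto intro!: finsum_closed simp: words_def)
  also have "\<dots> = (\<Oplus>a\<in>A. \<Oplus>w\<in>words A n. word_prod K (map f w) \<otimes> f a)"
    using assms cl by (intro finsum_cong' finsum_ldistr) (auto intro!: finsum_closed simp: words_def finite_lists_length_eq)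
  also have "\<dots> = (\<Oplus>w\<in>words A (Suc n). word_prod K (map f w))"
    using assms cl by (subst finsum_words_Suc) (auto simp: words_def)
  finally show ?case .
qed

text \<open>
  Expand the power into a sum over words and cancel the words that are not constant.
\<close>

lemma finsum_frobenius:
  assumes "finite A" "\<And>a. a \<in> A \<Longrightarrow> f a \<in> carrier K"
  shows "(\<Oplus>a\<in>A. f a) [^] (p ^ m) = (\<Oplus>a\<in>A. f a [^] (p ^ m))"
proof -
  have cl: "word_prod K (map f w) \<in> carrier K" if "set w \<subseteq> A" for w
    using that assms by (intro word_prod_closed) auto
  have "(\<Oplus>w\<in>words A (p ^ m). word_prod K (map f w)) =
      (\<Oplus>a\<in>A. word_prod K (map f (replicate (p ^ m) a)))"
    using assms by (intro finsum_words_rotation cl)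
      (auto simp: words_def rotate1_map[symmetric] subset_iff intro!: cl word_prod_rotate1)
  then show ?thesis using finsum_power_words[OF assms] by (simp add: word_prod_replicate)
qed

lemma nat_pow_eq_zero_imp:
  assumes "t \<in> carrier K" "t [^] (n::nat) = \<zero>"
  shows "t = \<zero>"
  using assms(2)
proof (induction n)
  case (Suc n)
  then show ?case using assms(1) integral by fastforce
qed simp

text \<open>
  Write \<open>x = \<one> \<oplus> t\<close>; the power is \<open>\<one> \<oplus> t [^] (p ^ m)\<close>, and a field has no nilpotent elements.
\<close>

lemma frobenius_one:
  assumes x: "x \<in> carrier K" and "x [^] (p ^ m) = \<one>"
  shows "x = \<one>"
proof -
  define t where "t = x \<ominus> \<one>"
  have t: "t \<in> carrier K" and xt: "x = \<one> \<oplus> t" using x by (simp_all add: t_def a_minus_def a_lcomm[of \<one> x "\<ominus> \<one>"] r_neg)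
  let ?f = "\<lambda>i::bool. if i then \<one> else t"
  have "(\<Oplus>i\<in>{True, False}. ?f i) = x" using t xt by (simp add: finsum_insert)
  moreover have "(\<Oplus>i\<in>{True, False}. ?f i [^] (p ^ m)) = \<one> \<oplus> t [^] (p ^ m)"
    using t by (simp add: finsum_insert)
  ultimately have "\<one> = \<one> \<oplus> t [^] (p ^ m)"
    using finsum_frobenius[of "{True, False}" ?f m] t assms(2) by simp
  then have "t [^] (p ^ m) = \<zero>" using t add.l_cancel[of \<one> "t [^] (p ^ m)" \<zero>] by simp
  then have "t = \<zero>"
    using t nat_pow_eq_zero_imp by blast
  then show ?thesis using xt by simp
qed

end

section \<open>Central cyclic direct factors\<close>

definition (in monoid) centre :: "'a set"
  where "centre = {z \<in> carrier G. \<forall>g\<in>carrier G. g \<otimes> z = z \<otimes> g}"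

context group
begin

lemma centre_pow_commute:
  assumes "z \<in> centre" "g \<in> carrier G"
  shows "g \<otimes> z [^] (k::nat) = z [^] k \<otimes> g"
proof (induction k)
  case (Suc k)
  have z: "z \<in> carrier G" "g \<otimes> z = z \<otimes> g" using assms by (auto simp: centre_def)
  have "g \<otimes> z [^] Suc k = (g \<otimes> z [^] k) \<otimes> z" using assms(2) z by (simp add: m_assoc)
  also have "\<dots> = z [^] k \<otimes> (g \<otimes> z)" using assms(2) z Suc by (simp add: m_assoc)
  also have "\<dots> = z [^] Suc k \<otimes> g" using assms(2) z by (simp add: m_assoc)
  finally show ?case .
qed (use assms in simp)

lemma subgroup_nat_pow:
  "subgroup M G \<Longrightarrow> x \<in> M \<Longrightarrow> x [^] (k::nat) \<in> M"
  by (induction k) (auto simp: subgroup.one_closed subgroup.m_closed)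

lemma finite_submonoid_subgroup:
  assumes "finite (carrier G)" "M \<subseteq> carrier G" "\<one> \<in> M"
    and "\<And>x y. x \<in> M \<Longrightarrow> y \<in> M \<Longrightarrow> x \<otimes> y \<in> M"
  shows "subgroup M G"
proof (rule subgroupI)
  fix x assume x: "x \<in> M"
  have pow: "x [^] (k::nat) \<in> M" for k using x assms by (induction k) auto
  have xc: "x \<in> carrier G" using x assms by auto
  have "order G > 0" using assms(1) by (simp add: order_gt_0_iff_finite)
  then have "x [^] (order G - 1) \<otimes> x = \<one>"
    using pow_order_eq_1[OF xc] by (metis Suc_diff_1 nat_pow_Suc)
  then have "inv x = x [^] (order G - 1)" using xc by (intro inv_equality) auto
  then show "inv x \<in> M" using pow by simp
qed (use assms in auto)

lemma subgroup_pow_gcd: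
  assumes M: "subgroup M G" and x: "x \<in> carrier G" and "x [^] (a::nat) \<in> M" "x [^] (b::nat) \<in> M"
  shows "x [^] gcd a b \<in> M"
proof (cases "a = 0")
  case False
  then obtain u v where uv: "a * u = b * v + gcd a b" using bezout_nat by blast
  have "x [^] (b * v) \<otimes> x [^] gcd a b = x [^] (a * u)" using x uv by (simp add: nat_pow_mult)
  moreover have "x [^] (a * u) \<in> M" "x [^] (b * v) \<in> M"
    using assms subgroup_nat_pow[OF M] by (simp_all add: nat_pow_pow[symmetric])
  ultimately have "x [^] gcd a b = inv (x [^] (b * v)) \<otimes> x [^] (a * u)"
    using x by (metis inv_solve_left nat_pow_closed)
  then show ?thesis using M \<open>x [^] (a * u) \<in> M\<close> \<open>x [^] (b * v) \<in> M\<close>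
    by (simp add: subgroup.m_closed subgroup.m_inv_closed)
qed (use assms in simp)

text \<open>
  A subgroup that meets the cyclic group generated by \<open>z\<close> nontrivially contains its unique
  subgroup of order \<open>p\<close>, which is generated by \<open>z [^] (p ^ l)\<close>. So a single element witnesses that the
  intersection is trivial.
\<close>

lemma prime_power_dvd_if_pow_mem:
  assumes p: "Factorial_Ring.prime (p::nat)" and M: "subgroup M G" and z: "z \<in> carrier G"
    and mem: "z [^] (p ^ Suc l) \<in> M" and not_mem: "z [^] (p ^ l) \<notin> M"
    and k: "z [^] (k::nat) \<in> M"
  shows "p ^ Suc l dvd k"
proof -
  obtain j where j: "j \<le> Suc l" "gcd k (p ^ Suc l) = p ^ j"
    using divides_primepow_nat[OF p] by (metis gcd_dvd2)
  have g: "z [^] (p ^ j) \<in> M" using subgroup_pow_gcd[OF M z k mem] j by simp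
  have "\<not> j \<le> l"
  proof
    assume "j \<le> l"
    then have "p ^ l = p ^ j * p ^ (l - j)" by (simp flip: power_add)
    then have "z [^] (p ^ l) = (z [^] (p ^ j)) [^] (p ^ (l - j))" using z by (simp add: nat_pow_pow)
    then show False using not_mem subgroup_nat_pow[OF M g] by simp
  qed
  then have "j = Suc l" using j by simp
  then show ?thesis using j by (metis gcd_dvd1)
qed

text \<open>
  This is the classical fact that an element of maximal order generates a direct summand, made relative to
  a subgroup \<open>S\<close> with abelian quotient of exponent dividing \<open>p ^ Suc l\<close>: a cyclic central
  subgroup of order \<open>p ^ Suc l\<close> that meets \<open>S\<close> trivially has a normal complement. The complement is
  chosen maximal among the subgroups that contain \<open>S\<close> and avoid \<open>z [^] (p ^ l)\<close>.
\<close>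

theorem central_cyclic_complement:
  assumes fin: "finite (carrier G)" and p: "Factorial_Ring.prime p"
    and z_centre: "z \<in> centre" and z_ord: "z [^] (p ^ Suc l) = \<one>"
    and S: "subgroup S G"
    and comm: "\<And>x y. x \<in> carrier G \<Longrightarrow> y \<in> carrier G \<Longrightarrow> x \<otimes> y \<otimes> inv x \<otimes> inv y \<in> S"
    and pw: "\<And>x. x \<in> carrier G \<Longrightarrow> x [^] (p ^ Suc l) \<in> S"
    and z_not: "z [^] (p ^ l) \<notin> S"
  obtains M where "M \<lhd> G" "\<And>k::nat. z [^] k \<in> M \<Longrightarrow> p ^ Suc l dvd k"
    "\<And>x. x \<in> carrier G \<Longrightarrow> \<exists>k::nat. \<exists>m\<in>M. x = z [^] k \<otimes> m"
proof -
  define \<S> where "\<S> = {M. subgroup M G \<and> S \<subseteq> M \<and> z [^] (p ^ l) \<notin> M}"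
  have "\<S> \<subseteq> Pow (carrier G)" using subgroup.subset by (auto simp: \<S>_def)
  then have "finite \<S>" using fin by (meson finite_Pow_iff finite_subset)
  moreover have "S \<in> \<S>" using S z_not by (simp add: \<S>_def)
  ultimately obtain M where "M \<in> \<S>" and M_max: "\<And>M'. M' \<in> \<S> \<Longrightarrow> M \<subseteq> M' \<Longrightarrow> M = M'"
    using finite_has_maximal[of \<S>] by blast
  then have M: "subgroup M G" "S \<subseteq> M" "z [^] (p ^ l) \<notin> M" by (auto simp: \<S>_def)
  interpret M: subgroup M G by fact
  have zc: "z \<in> carrier G"
    using z_centre by (auto simp: centre_def)
  note z_pow = centre_pow_commute[OF z_centre]
  have dvd: "p ^ Suc l dvd k" if "z [^] k \<in> M" for k :: nat
    using prime_power_dvd_if_pow_mem[OF p M(1) zc _ M(3) that] z_ord by simp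
  have normal: "M \<lhd> G"
  proof (rule normal_invI[OF M(1)])
    fix x m assume x: "x \<in> carrier G" and m: "m \<in> M"
    then have eq: "x \<otimes> m \<otimes> inv x = (x \<otimes> m \<otimes> inv x \<otimes> inv m) \<otimes> m" by (simp add: m_assoc)
    have "x \<otimes> m \<otimes> inv x \<otimes> inv m \<in> M" using comm[OF x M.mem_carrier[OF m]] M(2) by blast
    then show "x \<otimes> m \<otimes> inv x \<in> M" by (subst eq) (rule M.m_closed[OF _ m])
  qed
  define L where "L = {z [^] k \<otimes> m |(k::nat) m. m \<in> M}"
  have L_sub: "subgroup L G"
  proof (rule finite_submonoid_subgroup[OF fin])
    show "L \<subseteq> carrier G" using zc by (auto simp: L_def)
    have "z [^] (0::nat) \<otimes> \<one> \<in> L" unfolding L_def using M.one_closed by blast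
    then show "\<one> \<in> L" by simp
    fix x y assume "x \<in> L" "y \<in> L"
    then obtain i j :: nat and m n where x: "x = z [^] i \<otimes> m" "m \<in> M" and y: "y = z [^] j \<otimes> n" "n \<in> M"
      by (auto simp: L_def)
    have "x \<otimes> y = z [^] i \<otimes> (m \<otimes> z [^] j) \<otimes> n" using x y zc by (simp add: m_assoc)
    also have "\<dots> = z [^] i \<otimes> (z [^] j \<otimes> m) \<otimes> n" using x z_pow[of m j] by simp
    also have "\<dots> = z [^] (i + j) \<otimes> (m \<otimes> n)" using x y zc by (simp add: m_assoc flip: nat_pow_mult)
    finally show "x \<otimes> y \<in> L" unfolding L_def using x y by blast
  qed
  interpret L: subgroup L G by fact
  have M_le_L: "M \<subseteq> L"
  proof
    fix m assume "m \<in> M"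
    then have "z [^] (0::nat) \<otimes> m \<in> L" unfolding L_def using M.one_closed by blast
    then show "m \<in> L" using \<open>m \<in> M\<close> by simp
  qed
  have zL: "z [^] (k::nat) \<in> L" for k
  proof -
    have "z [^] k \<otimes> \<one> \<in> L" unfolding L_def using M.one_closed by blast
    then show ?thesis using zc by simp
  qed
  have "x \<in> L" if x: "x \<in> carrier G" for x
  proof (rule ccontr)
    assume "x \<notin> L"
    define j where "j = (LEAST j. x [^] (p ^ j) \<in> L)"
    have ex: "x [^] (p ^ Suc l) \<in> L" using pw[OF x] M M_le_L by auto
    then have jL: "x [^] (p ^ j) \<in> L" unfolding j_def by (rule LeastI)
    then have "j \<noteq> 0" using \<open>x \<notin> L\<close> x by (intro notI) simp
    then obtain i where i: "j = Suc i" by (cases j) auto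
    define y where "y = x [^] (p ^ i)"
    have y: "y \<in> carrier G" using x by (simp add: y_def)
    have "y \<notin> L" unfolding y_def using not_less_Least[of i "\<lambda>j. x [^] (p ^ j) \<in> L"] i j_def by auto
    have "y [^] p \<in> L" using jL x i by (simp add: y_def nat_pow_pow mult.commute)
    then obtain k :: nat and m where km: "y [^] p = z [^] k \<otimes> m" "m \<in> M" by (auto simp: L_def)
    have "y [^] (p ^ Suc l) = (y [^] p) [^] (p ^ l)" using y by (simp add: nat_pow_pow)
    also have "\<dots> = z [^] (k * p ^ l) \<otimes> m [^] (p ^ l)"
      unfolding km(1) using km zc
      by (subst pow_mult_distrib[OF z_pow[of m k, symmetric]]) (auto simp: nat_pow_pow)
    finally have "z [^] (k * p ^ l) = y [^] (p ^ Suc l) \<otimes> inv (m [^] (p ^ l))"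
      using km zc y by (metis M.mem_carrier inv_solve_right nat_pow_closed)
    moreover have "y [^] (p ^ Suc l) \<in> M" using pw[OF y] M by auto
    moreover have "m [^] (p ^ l) \<in> M" using subgroup_nat_pow[OF M(1) km(2)] .
    ultimately have "z [^] (k * p ^ l) \<in> M" by simp
    then have "p ^ Suc l dvd k * p ^ l" by (rule dvd)
    then have "p dvd k" using p by (simp add: prime_gt_0_nat)
    then obtain k' where k': "k = p * k'" by blast
    define P where "P = p ^ Suc l"
    have P: "P > 0" "z [^] P = \<one>" using p z_ord by (simp_all add: P_def prime_gt_0_nat)
    have zP: "z [^] (a * P) = \<one>" for a
      using zc P(2) by (metis mult.commute nat_pow_one nat_pow_pow)
    \<comment> \<open>The exponent stands for \<open>-k'\<close>, so that \<open>w\<close> differs from \<open>y\<close> by a power of \<open>z\<close> and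
      its \<open>p\<close>-th power lies in \<open>M\<close>.\<close>
    define w where "w = y \<otimes> z [^] (k' * (P - 1))"
    have w: "w \<in> carrier G" using y zc by (simp add: w_def)
    have "w [^] p = y [^] p \<otimes> z [^] (k * (P - 1))"
      unfolding w_def using y zc
      by (subst pow_mult_distrib[OF z_pow[OF y]]) (auto simp: nat_pow_pow k' mult_ac)
    also have "\<dots> = m \<otimes> z [^] (k + k * (P - 1))"
      using km zc by (simp add: z_pow[of m k, symmetric] m_assoc flip: nat_pow_mult)
    also have "k + k * (P - 1) = k * P" using P(1) by (cases P) auto
    finally have wp: "w [^] p = m" using km zP by simp
    have "w \<notin> L"
    proof
      assume "w \<in> L"
      then have "w \<otimes> z [^] k' \<in> L" using zL by simp
      moreover have "w \<otimes> z [^] k' = y \<otimes> z [^] (k' * (P - 1) + k')"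
        using y zc by (simp add: w_def m_assoc nat_pow_mult)
      moreover have "k' * (P - 1) + k' = k' * P" using P(1) by (cases P) auto
      ultimately show False using \<open>y \<notin> L\<close> zP y by simp
    qed
    \<comment> \<open>By maximality of \<open>M\<close> the larger subgroup \<open>M'\<close> contains \<open>z [^] (p ^ l)\<close>; this leads to
      \<open>z [^] (p ^ l) \<in> M\<close> or to \<open>w \<in> L\<close>.\<close>
    define M' where "M' = {n \<otimes> w [^] k |(k::nat) n. n \<in> M}"
    have M'_sub: "subgroup M' G"
    proof (rule finite_submonoid_subgroup[OF fin])
      show "M' \<subseteq> carrier G" using w by (auto simp: M'_def)
      have "\<one> \<otimes> w [^] (0::nat) \<in> M'" unfolding M'_def using M.one_closed by blast
      then show "\<one> \<in> M'" by simp
      fix u v assume "u \<in> M'" "v \<in> M'"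
      then obtain i j :: nat and n n' where u: "u = n \<otimes> w [^] i" "n \<in> M" and v: "v = n' \<otimes> w [^] j" "n' \<in> M"
        by (auto simp: M'_def)
      have "inv (w [^] i) \<otimes> (w [^] i \<otimes> w [^] j) = w [^] j" using w by (simp add: m_assoc[symmetric])
      then have "u \<otimes> v = (n \<otimes> (w [^] i \<otimes> n' \<otimes> inv (w [^] i))) \<otimes> w [^] (i + j)"
        using u v w by (simp add: m_assoc flip: nat_pow_mult)
      moreover have "w [^] i \<otimes> n' \<otimes> inv (w [^] i) \<in> M"
        using normal.inv_op_closed2[OF normal _ v(2)] w by simp
      ultimately show "u \<otimes> v \<in> M'" unfolding M'_def using u by blast
    qed
    have "M \<subseteq> M'"
    proof
      fix n assume "n \<in> M"
      then have "n \<otimes> w [^] (0::nat) \<in> M'" unfolding M'_def by blast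
      then show "n \<in> M'" using \<open>n \<in> M\<close> by simp
    qed
    moreover have "w \<in> M'"
    proof -
      have "\<one> \<otimes> w [^] (1::nat) \<in> M'" unfolding M'_def using M.one_closed by blast
      then show ?thesis using w by simp
    qed
    moreover have "w \<notin> M" using \<open>w \<notin> L\<close> M_le_L by blast
    ultimately have "M' \<notin> \<S>" using M_max by blast
    then have "z [^] (p ^ l) \<in> M'" using M'_sub \<open>M \<subseteq> M'\<close> M(2) by (auto simp: \<S>_def)
    then obtain i :: nat and n where in': "z [^] (p ^ l) = n \<otimes> w [^] i" "n \<in> M" by (auto simp: M'_def)
    show False
    proof (cases "p dvd i")
      case True
      then obtain i' where "i = p * i'" by blast
      then have "w [^] i = m [^] i'" using w wp by (simp flip: nat_pow_pow)
      then have "z [^] (p ^ l) \<in> M" using in' km subgroup_nat_pow[OF M(1)] by simp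
      then show False using M(3) by simp
    next
      case False
      have "w [^] i = inv n \<otimes> z [^] (p ^ l)" using in' w zc by (simp add: inv_solve_left)
      then have "w [^] i \<in> L" using in'(2) M_le_L zL[of "p ^ l"]
        by (metis L.m_closed L.m_inv_closed subsetD)
      moreover have "w [^] p \<in> L" using wp km M_le_L by auto
      ultimately have "w [^] gcd i p \<in> L" using subgroup_pow_gcd[OF L_sub w] by blast
      moreover have "gcd i p = 1" using False p by (meson coprime_iff_gcd_eq_1 coprime_commute prime_imp_coprime)
      ultimately show False using \<open>w \<notin> L\<close> w by simp
    qed
  qed
  then have gen: "\<exists>k::nat. \<exists>m\<in>M. x = z [^] k \<otimes> m" if "x \<in> carrier G" for x
    using that unfolding L_def by blast
  show ?thesis by (rule that[OF normal dvd gen])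
qed

text \<open>
  The preimage in \<open>G\<close> of the subgroup of \<open>m\<close>-th powers of the abelianization.
\<close>

definition derived_powers :: "nat \<Rightarrow> 'a set"
  where "derived_powers m = {c \<otimes> v [^] m |c v. c \<in> derived G (carrier G) \<and> v \<in> carrier G}"

text \<open>
  Modulo the derived subgroup the power map is a homomorphism.
\<close>

lemma subgroup_derived_powers:
  assumes fin: "finite (carrier G)"
  shows "subgroup (derived_powers m) G"
proof -
  let ?D = "derived G (carrier G)"
  interpret D: normal ?D G by (rule derived_self_is_normal)
  interpret Q: comm_group "G Mod ?D" by (rule derived_quot_is_comm_group)
  interpret hom: group_hom G "G Mod ?D" "\<lambda>a. ?D #> a"
    by (simp add: group_hom_def group_hom_axioms_def is_group Q.is_group D.r_coset_hom_Mod)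
  have mem: "x \<in> derived_powers m \<longleftrightarrow> (\<exists>v\<in>carrier G. ?D #> x = ?D #> v [^] m)" if x: "x \<in> carrier G" for x
  proof -
    have "(\<exists>c\<in>?D. x = c \<otimes> v [^] m) \<longleftrightarrow> ?D #> x = ?D #> v [^] m" if "v \<in> carrier G" for v
    proof -
      have "(\<exists>c\<in>?D. x = c \<otimes> v [^] m) \<longleftrightarrow> x \<in> ?D #> v [^] m" by (auto simp: r_coset_def)
      also have "\<dots> \<longleftrightarrow> ?D #> x = ?D #> v [^] m"
        using x that rcos_self[OF x D.subgroup_axioms] repr_independence[OF _ _ D.subgroup_axioms]
        by (metis nat_pow_closed)
      finally show ?thesis .
    qed
    then have "(\<exists>v\<in>carrier G. \<exists>c\<in>?D. x = c \<otimes> v [^] m) \<longleftrightarrow> (\<exists>v\<in>carrier G. ?D #> x = ?D #> v [^] m)"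
      by (rule bex_cong[OF refl])
    then show ?thesis unfolding derived_powers_def by blast
  qed
  have sub: "derived_powers m \<subseteq> carrier G" using D.subset by (auto simp: derived_powers_def)
  show ?thesis
  proof (rule finite_submonoid_subgroup[OF fin sub])
    show "\<one> \<in> derived_powers m" by (subst mem) (auto intro!: bexI[of _ \<one>])
    fix x y assume xy: "x \<in> derived_powers m" "y \<in> derived_powers m"
    then have c: "x \<in> carrier G" "y \<in> carrier G" using sub by auto
    obtain v where v: "v \<in> carrier G" "?D #> x = ?D #> v [^] m" using mem[OF c(1)] xy(1) by auto
    obtain w where w: "w \<in> carrier G" "?D #> y = ?D #> w [^] m" using mem[OF c(2)] xy(2) by auto
    have "?D #> (x \<otimes> y) = (?D #> v [^] m) \<otimes>\<^bsub>G Mod ?D\<^esub> (?D #> w [^] m)" using v w c by simp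
    also have "\<dots> = ((?D #> v) [^]\<^bsub>G Mod ?D\<^esub> m) \<otimes>\<^bsub>G Mod ?D\<^esub> ((?D #> w) [^]\<^bsub>G Mod ?D\<^esub> m)"
      using v w by (simp only: hom.hom_nat_pow)
    also have "\<dots> = ((?D #> v) \<otimes>\<^bsub>G Mod ?D\<^esub> (?D #> w)) [^]\<^bsub>G Mod ?D\<^esub> m"
      by (rule Q.nat_pow_distrib[symmetric]) (use v w hom.hom_closed in blast)+
    also have "\<dots> = ?D #> (v \<otimes> w) [^] m"
      using v w by (simp only: hom.hom_nat_pow hom.hom_mult m_closed)
    finally show "x \<otimes> y \<in> derived_powers m" using c v w by (subst mem) auto
  qed
qed

lemma commutator_in_derived:
  "x \<in> carrier G \<Longrightarrow> y \<in> carrier G \<Longrightarrow> x \<otimes> y \<otimes> inv x \<otimes> inv y \<in> derived G (carrier G)"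
  unfolding derived_def by (rule generate.incl) blast

lemma commutator_in_derived_powers:
  assumes "x \<in> carrier G" "y \<in> carrier G"
  shows "x \<otimes> y \<otimes> inv x \<otimes> inv y \<in> derived_powers m"
proof -
  have "(x \<otimes> y \<otimes> inv x \<otimes> inv y) \<otimes> \<one> [^] m \<in> derived_powers m"
    unfolding derived_powers_def using commutator_in_derived[OF assms] by blast
  then show ?thesis using assms by simp
qed

lemma power_in_derived_powers:
  assumes "x \<in> carrier G"
  shows "x [^] m \<in> derived_powers m"
proof -
  have "\<one> \<otimes> x [^] m \<in> derived_powers m"
    unfolding derived_powers_def derived_def using generate.one assms by blast
  then show ?thesis using assms by simp
qed

text \<open>
  The commutator of \<open>a\<close> and \<open>n\<close> lies in both normal subgroups.
\<close>

lemma internal_direct_product_commute: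
  assumes "internal_direct_product G A N" "a \<in> A" "n \<in> N"
  shows "a \<otimes> n = n \<otimes> a"
proof -
  have A: "A \<lhd> G" and N: "N \<lhd> G" and int: "A \<inter> N = {\<one>}"
    using assms by (auto simp: internal_direct_product_def)
  interpret A: normal A G by fact
  interpret N: normal N G by fact
  have c: "a \<in> carrier G" "n \<in> carrier G" using assms by auto
  have "a \<otimes> n \<otimes> inv a \<otimes> inv n \<in> N" using N.inv_op_closed2[OF c(1) assms(3)] assms by simp
  moreover have "a \<otimes> (n \<otimes> inv a \<otimes> inv n) \<in> A" using A.inv_op_closed2[OF c(2), of "inv a"] assms by simp
  ultimately have "a \<otimes> n \<otimes> inv a \<otimes> inv n = \<one>" using int c by (auto simp: m_assoc)
  then show ?thesis using c by (metis inv_closed inv_solve_right l_one m_closed)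
qed

lemma internal_direct_product_projections:
  assumes idp: "internal_direct_product G A N"
  obtains \<pi> \<nu> where "\<pi> \<in> hom G (G\<lparr>carrier := A\<rparr>)" "\<nu> \<in> carrier G \<rightarrow> N"
    "\<And>x. x \<in> carrier G \<Longrightarrow> x = \<pi> x \<otimes> \<nu> x" "\<And>a. a \<in> A \<Longrightarrow> \<pi> a = a"
proof -
  have A: "A \<lhd> G" and N: "N \<lhd> G" and int: "A \<inter> N = {\<one>}" and prod: "A <#> N = carrier G"
    using idp by (auto simp: internal_direct_product_def)
  interpret A: normal A G by fact
  interpret N: normal N G by fact
  have uniq: "a = a'" if "a \<in> A" "a' \<in> A" "n \<in> N" "n' \<in> N" "a \<otimes> n = a' \<otimes> n'" for a a' n n'
  proof -
    have c: "a \<in> carrier G" "a' \<in> carrier G" "n \<in> carrier G" "n' \<in> carrier G" using that by auto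
    have "inv a' \<otimes> a \<otimes> n = n'" using c that(5) by (simp add: m_assoc inv_solve_left')
    then have eq: "inv a' \<otimes> a = n' \<otimes> inv n" using c by (metis inv_solve_right inv_closed m_closed)
    have "inv a' \<otimes> a \<in> A" using that by simp
    moreover have "inv a' \<otimes> a \<in> N" unfolding eq using that by simp
    ultimately have "inv a' \<otimes> a = \<one>" using int by blast
    then have "a' \<otimes> (inv a' \<otimes> a) = a'" using c by simp
    then show ?thesis using c by (simp add: m_assoc[symmetric])
  qed
  have "\<exists>q. fst q \<in> A \<and> snd q \<in> N \<and> x = fst q \<otimes> snd q" if "x \<in> carrier G" for x
    using that unfolding prod[symmetric] by (auto simp: set_mult_def)
  then have "\<exists>q. \<forall>x\<in>carrier G. fst (q x) \<in> A \<and> snd (q x) \<in> N \<and> x = fst (q x) \<otimes> snd (q x)"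
    by (intro bchoice) blast
  then obtain q where q: "\<And>x. x \<in> carrier G \<Longrightarrow> fst (q x) \<in> A \<and> snd (q x) \<in> N \<and> x = fst (q x) \<otimes> snd (q x)"
    by blast
  define \<pi> \<nu> where "\<pi> x = fst (q x)" and "\<nu> x = snd (q x)" for x
  have \<pi>: "\<pi> x \<in> A" "\<nu> x \<in> N" "x = \<pi> x \<otimes> \<nu> x" if "x \<in> carrier G" for x
    using q[OF that] by (simp_all add: \<pi>_def \<nu>_def)
  have \<pi>_eq: "\<pi> (a \<otimes> n) = a" if "a \<in> A" "n \<in> N" for a n
    using uniq[of "\<pi> (a \<otimes> n)" a "\<nu> (a \<otimes> n)" n] \<pi>[of "a \<otimes> n"] that by auto
  show ?thesis
  proof
    show "\<pi> \<in> hom G (G\<lparr>carrier := A\<rparr>)"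
    proof (rule homI)
      fix x y assume x: "x \<in> carrier G" and y: "y \<in> carrier G"
      have c: "\<pi> x \<in> carrier G" "\<nu> x \<in> carrier G" "\<pi> y \<in> carrier G" "\<nu> y \<in> carrier G"
        using \<pi>[OF x] \<pi>[OF y] by auto
      have "x \<otimes> y = (\<pi> x \<otimes> \<nu> x) \<otimes> (\<pi> y \<otimes> \<nu> y)" using \<pi>(3)[OF x] \<pi>(3)[OF y] by simp
      also have "\<dots> = \<pi> x \<otimes> (\<nu> x \<otimes> \<pi> y) \<otimes> \<nu> y" using c by (simp add: m_assoc)
      also have "\<nu> x \<otimes> \<pi> y = \<pi> y \<otimes> \<nu> x"
        using internal_direct_product_commute[OF idp, of "\<pi> y" "\<nu> x"] \<pi>[OF x] \<pi>[OF y] by simp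
      also have "\<pi> x \<otimes> (\<pi> y \<otimes> \<nu> x) \<otimes> \<nu> y = (\<pi> x \<otimes> \<pi> y) \<otimes> (\<nu> x \<otimes> \<nu> y)" using c by (simp add: m_assoc)
      finally have "\<pi> (x \<otimes> y) = \<pi> x \<otimes> \<pi> y" using \<pi>[OF x] \<pi>[OF y] by (simp add: \<pi>_eq)
      then show "\<pi> (x \<otimes> y) = \<pi> x \<otimes>\<^bsub>G\<lparr>carrier := A\<rparr>\<^esub> \<pi> y" by simp
    qed (simp add: \<pi>)
    show "\<pi> a = a" if "a \<in> A" for a using \<pi>_eq[OF that N.one_closed] that by simp
  qed (use \<pi> in auto)
qed

lemma abelian_factor_central:
  assumes "abelian_decomposition G A N"
  shows "A \<subseteq> centre"
proof
  fix a assume a: "a \<in> A"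
  have idp: "internal_direct_product G A N" and ab: "comm_group (G\<lparr>carrier := A\<rparr>)"
    using assms by (auto simp: abelian_decomposition_def)
  then have A: "A \<lhd> G" and N: "N \<lhd> G" and prod: "A <#> N = carrier G"
    by (auto simp: internal_direct_product_def)
  interpret A: normal A G by fact
  interpret N: normal N G by fact
  have "g \<otimes> a = a \<otimes> g" if g: "g \<in> carrier G" for g
  proof -
    obtain b n where bn: "b \<in> A" "n \<in> N" "g = b \<otimes> n"
      using g unfolding prod[symmetric] by (auto simp: set_mult_def)
    have "b \<otimes> a = a \<otimes> b" using comm_monoid.m_comm[OF comm_group.axioms(1)[OF ab], of b a] a bn by simp
    moreover have "a \<otimes> n = n \<otimes> a" using internal_direct_product_commute[OF idp a bn(2)] .
    ultimately show ?thesis using a bn by (metis A.mem_carrier N.mem_carrier m_assoc)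
  qed
  then show "a \<in> centre" using a by (auto simp: centre_def)
qed

text \<open>
  Otherwise \<open>z\<close> generates a direct factor of \<open>G\<close> with complement \<open>M\<close>. By the modular law
  \<open>N\<close> is the product of this factor and \<open>N \<inter> M\<close>, so that \<open>A\<close> can be enlarged by \<open>z\<close>, with
  \<open>N \<inter> M\<close> as the new complement.
\<close>

theorem maximal_abelian_factor_no_split:
  assumes fin: "finite (carrier G)" and p: "Factorial_Ring.prime p"
    and max: "is_Ab_NAb G A N"
    and zN: "z \<in> N" and z_centre: "z \<in> centre" and z_ord: "z [^] (p ^ Suc l) = \<one>"
  shows "z [^] (p ^ l) \<in> derived_powers (p ^ Suc l)"
proof (rule ccontr)
  assume not_mem: "z [^] (p ^ l) \<notin> derived_powers (p ^ Suc l)"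
  obtain M where M: "M \<lhd> G" and dvd: "\<And>k::nat. z [^] k \<in> M \<Longrightarrow> p ^ Suc l dvd k"
    and M_gen: "\<And>x. x \<in> carrier G \<Longrightarrow> \<exists>k::nat. \<exists>m\<in>M. x = z [^] k \<otimes> m"
  proof (rule central_cyclic_complement[OF fin p z_centre z_ord subgroup_derived_powers[OF fin]])
    show "z [^] (p ^ l) \<notin> derived_powers (p ^ Suc l)" by (rule not_mem)
  qed (blast intro: commutator_in_derived_powers power_in_derived_powers)+
  have dec: "abelian_decomposition G A N" using max by (simp add: is_Ab_NAb_def)
  then have idp: "internal_direct_product G A N" by (simp add: abelian_decomposition_def)
  then have A: "A \<lhd> G" and N: "N \<lhd> G" and int: "A \<inter> N = {\<one>}" and prod: "A <#> N = carrier G"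
    by (auto simp: internal_direct_product_def)
  interpret A: normal A G by fact
  interpret N: normal N G by fact
  interpret M: normal M G by fact
  have Acen: "A \<subseteq> centre" using abelian_factor_central[OF dec] .
  have zc: "z \<in> carrier G"
    using z_centre by (auto simp: centre_def)
  note z_pow = centre_pow_commute[OF z_centre]
  have z_one: "z [^] k = \<one>" if "p ^ Suc l dvd k" for k :: nat
    using that z_ord zc by (metis dvdE nat_pow_one nat_pow_pow)
  have zkN: "z [^] (k::nat) \<in> N" for k using subgroup_nat_pow[OF N.subgroup_axioms zN] .
  define B where "B = {a \<otimes> z [^] k |a (k::nat). a \<in> A}"
  have Bcen: "B \<subseteq> centre"
  proof
    fix b assume "b \<in> B"
    then obtain a and k :: nat where b: "b = a \<otimes> z [^] k" "a \<in> A" by (auto simp: B_def)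
    have "g \<otimes> b = b \<otimes> g" if g: "g \<in> carrier G" for g
    proof -
      have ac: "a \<in> carrier G" "g \<otimes> a = a \<otimes> g" using Acen b g by (auto simp: centre_def)
      have "g \<otimes> b = (g \<otimes> a) \<otimes> z [^] k" using b ac(1) g zc by (simp add: m_assoc)
      also have "\<dots> = a \<otimes> (g \<otimes> z [^] k)" unfolding ac(2) using ac(1) g zc by (simp add: m_assoc)
      also have "\<dots> = b \<otimes> g" using ac g zc b by (simp add: z_pow[of g k] m_assoc)
      finally show ?thesis .
    qed
    then show "b \<in> centre" using b zc by (auto simp: centre_def)
  qed
  then have B_car: "B \<subseteq> carrier G" by (auto simp: centre_def)
  have B_comm: "b \<otimes> g = g \<otimes> b" if "b \<in> B" "g \<in> carrier G" for b g
    using Bcen that by (auto simp: centre_def)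
  have AB: "A \<subseteq> B"
  proof
    fix a assume "a \<in> A"
    then have "a \<otimes> z [^] (0::nat) \<in> B" unfolding B_def by blast
    then show "a \<in> B" using \<open>a \<in> A\<close> by simp
  qed
  have B_sub: "subgroup B G"
  proof (rule finite_submonoid_subgroup[OF fin B_car])
    show "\<one> \<in> B" using AB by auto
    fix x y assume x: "x \<in> B" and y: "y \<in> B"
    then obtain a b and i j :: nat where ab: "x = a \<otimes> z [^] i" "y = b \<otimes> z [^] j" "a \<in> A" "b \<in> A"
      by (auto simp: B_def)
    have "x \<otimes> y = a \<otimes> (z [^] i \<otimes> b) \<otimes> z [^] j" using ab zc by (simp add: m_assoc)
    also have "\<dots> = a \<otimes> (b \<otimes> z [^] i) \<otimes> z [^] j" using ab z_pow[of b i] by simp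
    also have "\<dots> = (a \<otimes> b) \<otimes> z [^] (i + j)" using ab zc by (simp add: m_assoc flip: nat_pow_mult)
    finally show "x \<otimes> y \<in> B" unfolding B_def using ab by blast
  qed
  have B_normal: "B \<lhd> G"
  proof (rule normal_invI[OF B_sub])
    fix x h assume x: "x \<in> carrier G" and "h \<in> B"
    then have h: "h \<in> carrier G" "x \<otimes> h = h \<otimes> x" using B_comm[of h x] B_car by auto
    then have "x \<otimes> h \<otimes> inv x = h" unfolding h(2) using x by (simp add: m_assoc)
    then show "x \<otimes> h \<otimes> inv x \<in> B" using \<open>h \<in> B\<close> by simp
  qed
  have NM_normal: "N \<inter> M \<lhd> G"
  proof (rule normal_invI)
    show "subgroup (N \<inter> M) G" using N.subgroup_axioms M.subgroup_axioms by (rule subgroups_Inter_pair)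
  qed (auto intro: N.inv_op_closed2 M.inv_op_closed2)
  have int': "B \<inter> (N \<inter> M) = {\<one>}"
  proof -
    have "x = \<one>" if "x \<in> B" "x \<in> N" "x \<in> M" for x
    proof -
      obtain a and k :: nat where x: "x = a \<otimes> z [^] k" "a \<in> A" using \<open>x \<in> B\<close> by (auto simp: B_def)
      have "a = x \<otimes> inv (z [^] k)" using x zc by (simp add: m_assoc)
      then have "a \<in> N" using that zkN by simp
      then have a: "a = \<one>" using int x by blast
      then have "z [^] k \<in> M" using x that zc by simp
      then have "z [^] k = \<one>" by (intro z_one dvd)
      then show ?thesis using x a by simp
    qed
    then have "B \<inter> (N \<inter> M) \<subseteq> {\<one>}" by blast
    then show ?thesis using subgroup.one_closed[OF B_sub] N.one_closed M.one_closed by blast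
  qed
  have prod': "B <#> (N \<inter> M) = carrier G"
  proof
    show "B <#> (N \<inter> M) \<subseteq> carrier G" using B_car by (auto simp: set_mult_def)
    show "carrier G \<subseteq> B <#> (N \<inter> M)"
    proof
      fix x assume "x \<in> carrier G"
      then obtain a n where an: "a \<in> A" "n \<in> N" "x = a \<otimes> n"
        unfolding prod[symmetric] by (auto simp: set_mult_def)
      obtain k :: nat and m where km: "m \<in> M" "n = z [^] k \<otimes> m" using M_gen[of n] an by auto
      have "m = inv (z [^] k) \<otimes> n" using km zc by (simp add: m_assoc[symmetric])
      then have "m \<in> N" using an zkN by simp
      moreover have "x = (a \<otimes> z [^] k) \<otimes> m" using an km zc by (simp add: m_assoc)
      moreover have "a \<otimes> z [^] k \<in> B" unfolding B_def using an by blast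
      ultimately show "x \<in> B <#> (N \<inter> M)" using km by (auto simp: set_mult_def)
    qed
  qed
  have "comm_group (G\<lparr>carrier := B\<rparr>)"
    using subgroup.subgroup_is_group[OF B_sub is_group] B_comm B_car
    by (intro group.group_comm_groupI) auto
  then have "abelian_decomposition G B (N \<inter> M)"
    using B_normal NM_normal int' prod' by (simp add: abelian_decomposition_def internal_direct_product_def)
  then have "B = A" using max AB by (auto simp: is_Ab_NAb_def)
  moreover have "z \<in> B"
  proof -
    have "\<one> \<otimes> z [^] (1::nat) \<in> B" unfolding B_def using A.one_closed by blast
    then show ?thesis using zc by simp
  qed
  ultimately have "z = \<one>" using int zN by blast
  then have "z [^] (1::nat) \<in> M" by simp
  then have "p ^ Suc l dvd 1" by (rule dvd)
  then show False using prime_gt_1_nat[OF p] by simp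
qed

end

section \<open>Coordinates on a finite abelian p-group\<close>

text \<open>
  A decomposition of \<open>G\<close> into cyclic groups, given by generators and coordinate functions. The
  generator \<open>a i\<close> has order \<open>p ^ Suc (e i)\<close>; writing the exponent as a successor excludes trivial
  factors and names \<open>p ^ e i\<close>, the exponent of the last nontrivial \<open>p\<close>-power of \<open>a i\<close>. Only the residue
  of \<open>c i x\<close> modulo the order of \<open>a i\<close> is meaningful.
\<close>

locale coordinates = comm_group G for G (structure) +
  fixes p t :: nat and a :: "nat \<Rightarrow> 'a" and e :: "nat \<Rightarrow> nat" and c :: "nat \<Rightarrow> 'a \<Rightarrow> nat"
  assumes gen_closed: "i < t \<Longrightarrow> a i \<in> carrier G"
    and gen_order: "i < t \<Longrightarrow> a i [^] (p ^ Suc (e i)) = \<one>"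
    and coord_mult: "i < t \<Longrightarrow> x \<in> carrier G \<Longrightarrow> y \<in> carrier G \<Longrightarrow>
      [c i (x \<otimes> y) = c i x + c i y] (mod p ^ Suc (e i))"
    and coord_gen: "i < t \<Longrightarrow> j < t \<Longrightarrow> [c i (a j) = (if i = j then 1 else 0)] (mod p ^ Suc (e i))"
    and coord_inj: "x \<in> carrier G \<Longrightarrow> (\<And>i. i < t \<Longrightarrow> p ^ Suc (e i) dvd c i x) \<Longrightarrow> x = \<one>"
begin

lemma coord_one:
  assumes "i < t"
  shows "[c i \<one> = 0] (mod p ^ Suc (e i))"
proof -
  have "[c i \<one> + 0 = c i \<one> + c i \<one>] (mod p ^ Suc (e i))" using coord_mult[OF assms, of \<one> \<one>] by simp
  then show ?thesis using cong_add_lcancel_nat cong_sym by blast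
qed

lemma coord_pow:
  assumes "i < t" "x \<in> carrier G"
  shows "[c i (x [^] k) = k * c i x] (mod p ^ Suc (e i))"
proof (induction k)
  case 0
  then show ?case using coord_one assms by simp
next
  case (Suc k)
  have "[c i (x [^] Suc k) = c i (x [^] k) + c i x] (mod p ^ Suc (e i))"
    using coord_mult[OF assms(1), of "x [^] k" x] assms(2) by simp
  also have "[c i (x [^] k) + c i x = k * c i x + c i x] (mod p ^ Suc (e i))"
    using Suc by (rule cong_add[OF _ cong_refl])
  also have "k * c i x + c i x = Suc k * c i x" by simp
  finally show ?case .
qed

lemma coord_finprod:
  assumes "i < t" "finite J" "f \<in> J \<rightarrow> carrier G"
  shows "[c i (finprod G f J) = (\<Sum>j\<in>J. c i (f j))] (mod p ^ Suc (e i))"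
  using assms(2,3)
proof (induction J rule: finite_induct)
  case empty
  then show ?case using coord_one assms by simp
next
  case (insert j J)
  have "[c i (finprod G f (insert j J)) = c i (f j) + c i (finprod G f J)] (mod p ^ Suc (e i))"
    using coord_mult[OF assms(1), of "f j" "finprod G f J"] insert by (simp add: Pi_iff)
  also have "[c i (f j) + c i (finprod G f J) = c i (f j) + (\<Sum>j\<in>J. c i (f j))] (mod p ^ Suc (e i))"
    using insert by (intro cong_add[OF cong_refl]) auto
  finally show ?case using insert by simp
qed

lemma coord_eqI:
  assumes x: "x \<in> carrier G" and y: "y \<in> carrier G"
    and eq: "\<And>i. i < t \<Longrightarrow> [c i x = c i y] (mod p ^ Suc (e i))"
  shows "x = y"
proof -
  have "x \<otimes> inv y = \<one>"
  proof (rule coord_inj)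
    fix i assume i: "i < t"
    have "[c i (x \<otimes> inv y \<otimes> y) = c i (x \<otimes> inv y) + c i y] (mod p ^ Suc (e i))"
      using coord_mult[OF i, of "x \<otimes> inv y" y] x y by simp
    then have "[c i x = c i (x \<otimes> inv y) + c i y] (mod p ^ Suc (e i))" using x y by (simp add: m_assoc)
    then have "[c i (x \<otimes> inv y) + c i y = 0 + c i y] (mod p ^ Suc (e i))"
      using eq[OF i] by (metis add_0 cong_sym cong_trans)
    then have "[c i (x \<otimes> inv y) = 0] (mod p ^ Suc (e i))" by (simp only: cong_add_rcancel_nat)
    then show "p ^ Suc (e i) dvd c i (x \<otimes> inv y)" by (simp add: cong_0_iff)
  qed (use x y in simp)
  then show ?thesis using x y by (metis inv_closed inv_equality inv_inv)
qed

text \<open>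
  Both sides have the same coordinates.
\<close>

lemma coord_expansion:
  assumes x: "x \<in> carrier G"
  shows "x = (\<Otimes>j\<in>{..<t}. a j [^] c j x)"
proof (rule coord_eqI)
  fix i assume i: "i < t"
  have "[c i (\<Otimes>j\<in>{..<t}. a j [^] c j x) = (\<Sum>j<t. c i (a j [^] c j x))] (mod p ^ Suc (e i))"
    using i gen_closed by (intro coord_finprod) auto
  also have "[(\<Sum>j<t. c i (a j [^] c j x)) = (\<Sum>j<t. c j x * (if i = j then 1 else 0))] (mod p ^ Suc (e i))"
  proof (rule cong_sum)
    fix j assume j: "j \<in> {..<t}"
    then have "[c i (a j [^] c j x) = c j x * c i (a j)] (mod p ^ Suc (e i))"
      using coord_pow[OF i] gen_closed by simp
    also have "[c j x * c i (a j) = c j x * (if i = j then 1 else 0)] (mod p ^ Suc (e i))"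
      using coord_gen[OF i] j by (intro cong_scalar_left) auto
    finally show "[c i (a j [^] c j x) = c j x * (if i = j then 1 else 0)] (mod p ^ Suc (e i))" .
  qed
  also have "(\<Sum>j<t. c j x * (if i = j then 1 else 0)) = c i x"
    using i by (simp add: if_distrib cong: if_cong)
  finally show "[c i x = c i (\<Otimes>j\<in>{..<t}. a j [^] c j x)] (mod p ^ Suc (e i))" by (rule cong_sym)
qed (use x gen_closed in auto)

lemma gen_pow_cong:
  assumes "i < t" "[k = l] (mod p ^ Suc (e i))"
  shows "a i [^] k = a i [^] l"
proof -
  have red: "a i [^] n = a i [^] (n mod p ^ Suc (e i))" for n
  proof -
    have "a i [^] n = a i [^] (p ^ Suc (e i) * (n div p ^ Suc (e i)) + n mod p ^ Suc (e i))" by simp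
    also have "\<dots> = (a i [^] (p ^ Suc (e i))) [^] (n div p ^ Suc (e i)) \<otimes> a i [^] (n mod p ^ Suc (e i))"
      using gen_closed[OF assms(1)] by (simp only: nat_pow_mult[symmetric] nat_pow_pow nat_pow_closed)
    finally show ?thesis using gen_closed[OF assms(1)] gen_order[OF assms(1)] by simp
  qed
  show ?thesis using red[of k] red[of l] assms(2) by (simp add: cong_def)
qed

end

text \<open>
  The induction step of the structure theorem: an element \<open>z\<close> whose order is the exponent of the group
  generates a direct factor. Every \<open>x\<close> is then of the form \<open>z [^] \<kappa> x \<otimes> \<mu> x\<close> with \<open>\<mu> x\<close> in the complement
  \<open>M\<close>, and \<open>\<kappa>\<close> is the new coordinate.
\<close>

lemma (in comm_group) coordinates_split_off:
  assumes p: "Factorial_Ring.prime p" and fin: "finite (carrier G)" and ord: "order G = p ^ m"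
    and nontriv: "carrier G \<noteq> {\<one>}"
  obtains M where "subgroup M G" "M \<subset> carrier G"
    "\<And>t a e c. coordinates (G\<lparr>carrier := M\<rparr>) p t a e c \<Longrightarrow> \<exists>a' e' c'. coordinates G p (Suc t) a' e' c'"
proof -
  define n where "n = (LEAST n. \<forall>x\<in>carrier G. x [^] (p ^ n) = \<one>)"
  have "\<forall>x\<in>carrier G. x [^] (p ^ m) = \<one>" using pow_order_eq_1 ord by metis
  then have n: "\<forall>x\<in>carrier G. x [^] (p ^ n) = \<one>" unfolding n_def by (rule LeastI)
  have "n \<noteq> 0" using n nontriv by (intro notI) auto
  then obtain l where Suc: "n = Suc l" by (cases n) auto
  have "\<not> (\<forall>x\<in>carrier G. x [^] (p ^ l) = \<one>)"
    using not_less_Least[of l "\<lambda>n. \<forall>x\<in>carrier G. x [^] (p ^ n) = \<one>"] Suc n_def by auto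
  then obtain z where z: "z \<in> carrier G" "z [^] (p ^ l) \<noteq> \<one>" by blast
  define P where "P = p ^ Suc l"
  have exp: "x [^] P = \<one>" if "x \<in> carrier G" for x using n Suc that by (simp add: P_def)
  obtain M where M: "M \<lhd> G" and dvd: "\<And>k::nat. z [^] k \<in> M \<Longrightarrow> p ^ Suc l dvd k"
    and gen: "\<And>x. x \<in> carrier G \<Longrightarrow> \<exists>k::nat. \<exists>m\<in>M. x = z [^] k \<otimes> m"
  proof (rule central_cyclic_complement[OF fin p _ _ triv_subgroup, of z l])
    show "z \<in> centre" using z by (simp add: centre_def m_comm)
    show "x \<otimes> y \<otimes> inv x \<otimes> inv y \<in> {\<one>}" if "x \<in> carrier G" "y \<in> carrier G" for x y
    proof -
      have "x \<otimes> y \<otimes> inv x \<otimes> inv y = (x \<otimes> inv x) \<otimes> (y \<otimes> inv y)"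
        using that by (simp only: m_ac inv_closed m_closed)
      then show ?thesis using that by simp
    qed
  qed (use z exp in \<open>auto simp: P_def\<close>)
  interpret M: normal M G by fact
  have M_sub: "subgroup M G" by (rule M.subgroup_axioms)
  let ?M = "G\<lparr>carrier := M\<rparr>"
  have "z \<notin> M"
  proof
    assume "z \<in> M"
    then have "p ^ Suc l dvd 1" using dvd[of 1] z by simp
    then show False using prime_gt_1_nat[OF p] by simp
  qed
  then have M_proper: "M \<subset> carrier G" using M.subset z by blast
  have uniq_le: "[i = j] (mod P) \<and> m = m'"
    if "m \<in> M" "m' \<in> M" "z [^] i \<otimes> m = z [^] j \<otimes> m'" "i \<le> j" for i j :: nat and m m'
  proof -
    have c: "m \<in> carrier G" "m' \<in> carrier G" using that by auto
    have "z [^] j = z [^] i \<otimes> z [^] (j - i)" using z that(4) by (simp add: nat_pow_mult)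
    then have "z [^] i \<otimes> m = z [^] i \<otimes> (z [^] (j - i) \<otimes> m')" using that(3) z c by (simp add: m_assoc)
    then have m: "m = z [^] (j - i) \<otimes> m'" using z c by simp
    then have "z [^] (j - i) = m \<otimes> inv m'" using z c by (simp add: m_assoc)
    then have "z [^] (j - i) \<in> M" using that by simp
    then have d: "P dvd j - i" using dvd by (simp add: P_def)
    then obtain q where "j - i = P * q" by blast
    then have "z [^] (j - i) = \<one>" using z exp by (simp add: nat_pow_pow[symmetric])
    then have "m = m'" using m c by simp
    moreover have "[i = j] (mod P)" using d that(4) by (metis cong_altdef_nat cong_sym)
    ultimately show ?thesis by blast
  qed
  have uniq: "[i = j] (mod P)" "m = m'"
    if "m \<in> M" "m' \<in> M" "z [^] i \<otimes> m = z [^] j \<otimes> m'" for i j :: nat and m m'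
    using uniq_le[OF that(1,2,3)] uniq_le[OF that(2,1) that(3)[symmetric]] cong_sym
    by (metis nat_le_linear)+
  have "\<forall>x\<in>carrier G. \<exists>q. snd q \<in> M \<and> x = z [^] (fst q :: nat) \<otimes> snd q" using gen by fastforce
  then obtain q where q: "\<forall>x\<in>carrier G. snd (q x) \<in> M \<and> x = z [^] (fst (q x) :: nat) \<otimes> snd (q x)"
    by (rule bchoice[THEN exE])
  define \<kappa> \<mu> where "\<kappa> x = fst (q x)" and "\<mu> x = snd (q x)" for x
  have q': "\<mu> x \<in> M" "x = z [^] \<kappa> x \<otimes> \<mu> x" if "x \<in> carrier G" for x
    using q that by (auto simp: \<kappa>_def \<mu>_def)
  have val: "[\<kappa> x = k] (mod P)" "\<mu> x = m" if "x = z [^] k \<otimes> m" "m \<in> M" for x m and k :: nat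
  proof -
    have x: "x \<in> carrier G" using that z by simp
    have eq: "z [^] \<kappa> x \<otimes> \<mu> x = z [^] k \<otimes> m" using q'(2)[OF x] that(1) by simp
    show "[\<kappa> x = k] (mod P)" "\<mu> x = m" using uniq[OF q'(1)[OF x] that(2) eq] by auto
  qed
  have mult: "[\<kappa> (x \<otimes> y) = \<kappa> x + \<kappa> y] (mod P)" "\<mu> (x \<otimes> y) = \<mu> x \<otimes> \<mu> y"
    if x: "x \<in> carrier G" and y: "y \<in> carrier G" for x y
  proof -
    have c: "\<mu> x \<in> carrier G" "\<mu> y \<in> carrier G" using q'(1) x y by auto
    have "x \<otimes> y = (z [^] \<kappa> x \<otimes> \<mu> x) \<otimes> (z [^] \<kappa> y \<otimes> \<mu> y)" using q'(2)[OF x] q'(2)[OF y] by simp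
    also have "\<dots> = (z [^] \<kappa> x \<otimes> z [^] \<kappa> y) \<otimes> (\<mu> x \<otimes> \<mu> y)" using c z by (simp add: m_ac)
    also have "\<dots> = z [^] (\<kappa> x + \<kappa> y) \<otimes> (\<mu> x \<otimes> \<mu> y)" using z by (simp add: nat_pow_mult)
    finally have eq: "x \<otimes> y = z [^] (\<kappa> x + \<kappa> y) \<otimes> (\<mu> x \<otimes> \<mu> y)" .
    show "[\<kappa> (x \<otimes> y) = \<kappa> x + \<kappa> y] (mod P)" "\<mu> (x \<otimes> y) = \<mu> x \<otimes> \<mu> y"
      using val[OF eq] q'(1) x y by auto
  qed
  have on_M: "[\<kappa> x = 0] (mod P)" "\<mu> x = x" if "x \<in> M" for x
    using val[of x 0 x] that M.mem_carrier by auto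
  have on_z: "[\<kappa> z = 1] (mod P)" "\<mu> z = \<one>" using val[of z 1 \<one>] z by auto
  have "\<exists>a' e' c'. coordinates G p (Suc t) a' e' c'" if coords: "coordinates ?M p t a e c" for t a e c
  proof -
    interpret C: coordinates ?M p t a e c by fact
    define a' e' c' where "a' = a(t := z)" and "e' = e(t := l)"
      and "c' i x = (if i = t then \<kappa> x else c i (\<mu> x))" for i x
    have "coordinates G p (Suc t) a' e' c'"
    proof unfold_locales
      fix i assume i: "i < Suc t"
      show "a' i \<in> carrier G" using C.gen_closed[of i] i z by (auto simp: a'_def)
      show "a' i [^] (p ^ Suc (e' i)) = \<one>"
        using C.gen_order[of i] i z exp[OF z(1)]
        by (auto simp: a'_def e'_def P_def nat_pow_consistent[symmetric])
      show "[c' i (x \<otimes> y) = c' i x + c' i y] (mod p ^ Suc (e' i))"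
        if "x \<in> carrier G" "y \<in> carrier G" for x y
        using C.coord_mult[of i "\<mu> x" "\<mu> y"] i mult[OF that] q'(1)[OF that(1)] q'(1)[OF that(2)]
        by (auto simp: c'_def e'_def P_def)
      show "[c' i (a' j) = (if i = j then 1 else 0)] (mod p ^ Suc (e' i))" if j: "j < Suc t" for j
        using C.coord_gen[of i j] C.coord_one[of i] C.gen_closed[of j] on_M[of "a j"] on_z i j
        by (auto simp: c'_def e'_def a'_def P_def less_Suc_eq)
    next
      fix x assume x: "x \<in> carrier G" and dv: "\<And>i. i < Suc t \<Longrightarrow> p ^ Suc (e' i) dvd c' i x"
      have "P dvd \<kappa> x" using dv[of t] by (simp add: c'_def e'_def P_def)
      then obtain r where "\<kappa> x = P * r" by blast
      then have "z [^] \<kappa> x = \<one>" using z exp by (simp add: nat_pow_pow[symmetric])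
      then have "x = \<mu> x" using q'[OF x] by auto
      moreover have "\<mu> x = \<one>\<^bsub>?M\<^esub>"
      proof (rule C.coord_inj)
        show "p ^ Suc (e i) dvd c i (\<mu> x)" if "i < t" for i
          using dv[of i] that by (simp add: c'_def e'_def)
      qed (use q'[OF x] in simp)
      ultimately show "x = \<one>" by simp
    qed
    then show ?thesis by blast
  qed
  with M_sub M_proper show ?thesis by (rule that)
qed

theorem finite_abelian_p_group_coordinates:
  fixes G :: "('a, 'm) monoid_scheme"
  assumes p: "Factorial_Ring.prime p" and "comm_group G" "finite (carrier G)" "order G = p ^ m"
  shows "\<exists>t a e c. coordinates G p t a e c"
  using assms(2-)
proof (induction "card (carrier G)" arbitrary: G m rule: less_induct)
  case less
  interpret comm_group G by fact
  show ?case
  proof (cases "carrier G = {\<one>\<^bsub>G\<^esub>}")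
    case True
    then have "coordinates G p 0 (\<lambda>_. \<one>\<^bsub>G\<^esub>) (\<lambda>_. 0) (\<lambda>_ _. 0)" by unfold_locales auto
    then show ?thesis by blast
  next
    case False
    then obtain M where M: "subgroup M G" "M \<subset> carrier G"
      and ext: "\<And>t a e c. coordinates (G\<lparr>carrier := M\<rparr>) p t a e c \<Longrightarrow> \<exists>a' e' c'. coordinates G p (Suc t) a' e' c'"
      using coordinates_split_off[OF p less.prems(2,3)] by metis
    let ?M = "G\<lparr>carrier := M\<rparr>"
    have M_group: "comm_group ?M"
      using subgroup.subgroup_is_group[OF M(1) is_group]
      by (rule group.group_comm_groupI) (use M(2) in \<open>auto intro: m_comm\<close>)
    have card: "card (carrier ?M) < card (carrier G)" using M(2) less.prems(2) by (auto intro!: psubset_card_mono)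
    have "card M dvd p ^ m" using lagrange[OF M(1)] less.prems(3) by (metis dvd_triv_right)
    then obtain m' where ord: "order ?M = p ^ m'" using divides_primepow_nat[OF p] by (auto simp: order_def)
    have "finite (carrier ?M)" using M(2) less.prems(2) finite_subset by auto
    then show ?thesis using less.hyps[OF card M_group _ ord] ext by blast
  qed
qed

text \<open>
  Match each generator of \<open>G\<close> with a generator of \<open>H\<close> of the same order, injectively, and map an element
  to the element of \<open>H\<close> with the corresponding coordinates.
\<close>

theorem coordinates_embedding:
  assumes "coordinates G p t a e c" and "coordinates H p u b f d"
    and le: "\<And>n. card {i. i < t \<and> e i = n} \<le> card {j. j < u \<and> f j = n}"
  shows "mon G H \<noteq> {}"
proof -
  interpret G: coordinates G p t a e c by fact
  interpret H: coordinates H p u b f d by fact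
  have "\<exists>\<sigma>. \<sigma> ` {i. i < t \<and> e i = n} \<subseteq> {j. j < u \<and> f j = n} \<and> inj_on \<sigma> {i. i < t \<and> e i = n}" for n
    by (intro card_le_inj le) auto
  then have "\<exists>\<sigma>. \<forall>n. \<sigma> n ` {i. i < t \<and> e i = n} \<subseteq> {j. j < u \<and> f j = n} \<and> inj_on (\<sigma> n) {i. i < t \<and> e i = n}"
    by (intro choice allI)
  then obtain \<sigma> where \<sigma>: "\<And>n. \<sigma> n ` {i. i < t \<and> e i = n} \<subseteq> {j. j < u \<and> f j = n}"
    "\<And>n. inj_on (\<sigma> n) {i. i < t \<and> e i = n}" by blast
  define s where "s i = \<sigma> (e i) i" for i
  have s: "s i < u" "f (s i) = e i" if "i < t" for i using \<sigma>(1)[of "e i"] that by (auto simp: s_def)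
  have s_inj: "s i = s j \<longleftrightarrow> i = j" if "i < t" "j < t" for i j
  proof
    assume eq: "s i = s j"
    then have "e i = e j" using s(2)[OF that(1)] s(2)[OF that(2)] by simp
    then show "i = j" using inj_onD[OF \<sigma>(2)[of "e i"], of i j] eq that by (simp add: s_def)
  qed simp
  define h where "h x = finprod H (\<lambda>i. b (s i) [^]\<^bsub>H\<^esub> c i x) {..<t}" for x
  have closed: "b (s i) \<in> carrier H" if "i < t" for i using H.gen_closed s(1)[OF that] .
  have "h \<in> hom G H"
  proof (rule homI)
    show "h x \<in> carrier H" for x using closed by (auto simp: h_def)
    fix x y assume xy: "x \<in> carrier G" "y \<in> carrier G"
    have "h (x \<otimes>\<^bsub>G\<^esub> y) = finprod H (\<lambda>i. b (s i) [^]\<^bsub>H\<^esub> c i x \<otimes>\<^bsub>H\<^esub> b (s i) [^]\<^bsub>H\<^esub> c i y) {..<t}"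
      unfolding h_def
    proof (rule H.finprod_cong')
      fix i assume "i \<in> {..<t}"
      then have i: "i < t" by simp
      have "b (s i) [^]\<^bsub>H\<^esub> c i (x \<otimes>\<^bsub>G\<^esub> y) = b (s i) [^]\<^bsub>H\<^esub> (c i x + c i y)"
        using G.coord_mult[OF i xy] s[OF i] by (intro H.gen_pow_cong) simp_all
      then show "b (s i) [^]\<^bsub>H\<^esub> c i (x \<otimes>\<^bsub>G\<^esub> y) = b (s i) [^]\<^bsub>H\<^esub> c i x \<otimes>\<^bsub>H\<^esub> b (s i) [^]\<^bsub>H\<^esub> c i y"
        using closed[OF i] by (simp add: H.nat_pow_mult)
    qed (use closed in auto)
    also have "\<dots> = h x \<otimes>\<^bsub>H\<^esub> h y" unfolding h_def using closed by (intro H.finprod_multf) auto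
    finally show "h (x \<otimes>\<^bsub>G\<^esub> y) = h x \<otimes>\<^bsub>H\<^esub> h y" .
  qed
  moreover have "inj_on h (carrier G)"
  proof (rule inj_onI)
    fix x y assume x: "x \<in> carrier G" and y: "y \<in> carrier G" and eq: "h x = h y"
    have coord: "[d (s i) (h x) = c i x] (mod p ^ Suc (e i))" if i: "i < t" for i x
    proof -
      have "[d (s i) (h x) = (\<Sum>j<t. d (s i) (b (s j) [^]\<^bsub>H\<^esub> c j x))] (mod p ^ Suc (e i))"
        using H.coord_finprod[of "s i" "{..<t}" "\<lambda>j. b (s j) [^]\<^bsub>H\<^esub> c j x"] s[OF i] closed
        by (auto simp: h_def)
      also have "[(\<Sum>j<t. d (s i) (b (s j) [^]\<^bsub>H\<^esub> c j x)) = (\<Sum>j<t. c j x * (if i = j then 1 else 0))] (mod p ^ Suc (e i))"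
      proof (rule cong_sum)
        fix j assume "j \<in> {..<t}"
        then have j: "j < t" by simp
        have "[d (s i) (b (s j) [^]\<^bsub>H\<^esub> c j x) = c j x * d (s i) (b (s j))] (mod p ^ Suc (e i))"
          using H.coord_pow[of "s i" "b (s j)" "c j x"] s[OF i] closed[OF j] by simp
        also have "[c j x * d (s i) (b (s j)) = c j x * (if i = j then 1 else 0)] (mod p ^ Suc (e i))"
          using H.coord_gen[of "s i" "s j"] s[OF i] s[OF j] s_inj[OF i j] by (intro cong_scalar_left) auto
        finally show "[d (s i) (b (s j) [^]\<^bsub>H\<^esub> c j x) = c j x * (if i = j then 1 else 0)] (mod p ^ Suc (e i))" .
      qed
      also have "(\<Sum>j<t. c j x * (if i = j then 1 else 0)) = c i x"
    using i by (simp add: if_distrib cong: if_cong)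
      finally show ?thesis .
    qed
    show "x = y" using coord[of _ x] coord[of _ y] eq by (intro G.coord_eqI[OF x y]) (metis cong_sym cong_trans)
  qed
  ultimately show ?thesis by (auto simp: mon_def)
qed

lemma iso_if_mutual_embeddings:
  assumes "mon G H \<noteq> {}" "mon H G \<noteq> {}" "finite (carrier G)" "finite (carrier H)"
  shows "G \<cong> H"
proof -
  obtain g h where g: "g \<in> hom G H" "inj_on g (carrier G)" and h: "h \<in> hom H G" "inj_on h (carrier H)"
    using assms(1,2) by (auto simp: mon_def)
  have "g ` carrier G \<subseteq> carrier H" "h ` carrier H \<subseteq> carrier G" using g h by (auto simp: hom_def)
  then have "card (carrier G) = card (carrier H)"
    using card_inj_on_le g h assms(3,4) by (metis le_antisym)
  then have "g ` carrier G = carrier H"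
    using g assms(4) \<open>g ` carrier G \<subseteq> carrier H\<close> by (metis card_image card_subset_eq)
  then have "g \<in> iso G H" using g by (auto simp: iso_def bij_betw_def)
  then show ?thesis by (auto simp: is_iso_def)
qed

section \<open>The group algebra and its linear functionals\<close>

lemma pow_record_simps:
  "x [^]\<^bsub>A\<^esub> (0::nat) = \<one>\<^bsub>A\<^esub>" "x [^]\<^bsub>A\<^esub> Suc n = x [^]\<^bsub>A\<^esub> n \<otimes>\<^bsub>A\<^esub> x"
  by (simp_all add: nat_pow_def)

text \<open>
  Elements of the group algebra are studied through the bilinear pairing \<open>pair\<close> with
  arbitrary functions on the group: functions are the coordinates of linear functionals
  (\<open>linear_functional_eq_pair\<close>), and by \<open>pair_mult\<close> the convolution product turns into composition of
  pairings, so that identities for products need no manipulation of convolution sums.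
\<close>

locale modular_group_algebra = char_p_field K p + G: group G
  for K :: "('k, 'r) ring_scheme" (structure) and p and G :: "('g, 'm) monoid_scheme" +
  assumes finite_G: "finite (carrier G)"
    and order_G: "\<exists>m. order G = p ^ m"
begin

abbreviation "A \<equiv> group_algebra K G"

definition pair :: "('g \<Rightarrow> 'k) \<Rightarrow> ('g \<Rightarrow> 'k) \<Rightarrow> 'k"
  where "pair f \<psi> = (\<Oplus>g\<in>carrier G. f g \<otimes> \<psi> g)"

definition \<delta> :: "'g \<Rightarrow> 'g \<Rightarrow> 'k"
  where "\<delta> g = (\<lambda>x\<in>carrier G. if x = g then \<one> else \<zero>)"

lemma carrier_A: "carrier A = carrier G \<rightarrow>\<^sub>E carrier K"
  using finite_G by (auto simp: group_algebra_def)

lemma coeff_closed [simp]: "f \<in> carrier A \<Longrightarrow> g \<in> carrier G \<Longrightarrow> f g \<in> carrier K"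
  by (auto simp: carrier_A)

lemma delta_closed [simp]: "\<delta> g \<in> carrier A"
  by (auto simp: carrier_A \<delta>_def)

lemma one_A: "\<one>\<^bsub>A\<^esub> = \<delta> \<one>\<^bsub>G\<^esub>"
  by (simp add: group_algebra_def \<delta>_def)

lemma one_A_closed [simp]: "\<one>\<^bsub>A\<^esub> \<in> carrier A"
  by (simp add: one_A)

lemma mult_A_apply:
  assumes "f \<in> carrier A" "h \<in> carrier A" "x \<in> carrier G"
  shows "(f \<otimes>\<^bsub>A\<^esub> h) x = (\<Oplus>y\<in>carrier G. f y \<otimes> h (inv\<^bsub>G\<^esub> y \<otimes>\<^bsub>G\<^esub> x))"
proof -
  have "(f \<otimes>\<^bsub>A\<^esub> h) x = (\<Oplus>y\<in>{y \<in> carrier G. f y \<noteq> \<zero>}. f y \<otimes> h (inv\<^bsub>G\<^esub> y \<otimes>\<^bsub>G\<^esub> x))"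
    using assms(3) by (simp add: group_algebra_def)
  also have "\<dots> = (\<Oplus>y\<in>carrier G. f y \<otimes> h (inv\<^bsub>G\<^esub> y \<otimes>\<^bsub>G\<^esub> x))"
    using assms finite_G by (intro add.finprod_mono_neutral_cong_left) auto
  finally show ?thesis .
qed

lemma mult_A_closed [simp]:
  assumes "f \<in> carrier A" "h \<in> carrier A"
  shows "f \<otimes>\<^bsub>A\<^esub> h \<in> carrier A"
proof -
  have "(f \<otimes>\<^bsub>A\<^esub> h) x \<in> carrier K" if "x \<in> carrier G" for x
    using assms that by (auto simp: mult_A_apply intro!: finsum_closed)
  moreover have "(f \<otimes>\<^bsub>A\<^esub> h) x = undefined" if "x \<notin> carrier G" for x
    using that by (simp add: group_algebra_def)
  ultimately show ?thesis by (auto simp: carrier_A)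
qed

lemma pow_A_closed [simp]: "f \<in> carrier A \<Longrightarrow> f [^]\<^bsub>A\<^esub> (n::nat) \<in> carrier A"
  by (induction n) (simp_all add: pow_record_simps)

lemma pair_closed [simp]:
  "f \<in> carrier A \<Longrightarrow> \<psi> \<in> carrier G \<rightarrow> carrier K \<Longrightarrow> pair f \<psi> \<in> carrier K"
  by (auto simp: pair_def intro!: finsum_closed)

lemma pair_cong:
  assumes "f \<in> carrier A" "\<psi> \<in> carrier G \<rightarrow> carrier K" "\<And>g. g \<in> carrier G \<Longrightarrow> \<psi>' g = \<psi> g"
  shows "pair f \<psi>' = pair f \<psi>"
  unfolding pair_def using assms by (intro finsum_cong') (auto simp: Pi_iff)

lemma pair_delta:
  assumes "g \<in> carrier G" "\<psi> \<in> carrier G \<rightarrow> carrier K"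
  shows "pair (\<delta> g) \<psi> = \<psi> g"
proof -
  have "pair (\<delta> g) \<psi> = (\<Oplus>x\<in>carrier G. if g = x then \<psi> x else \<zero>)"
    unfolding pair_def using assms by (intro finsum_cong') (auto simp: \<delta>_def Pi_iff)
  also have "\<dots> = \<psi> g"
    using assms finite_G by (intro finsum_singleton) auto
  finally show ?thesis .
qed

lemma pair_apply_delta:
  assumes "x \<in> carrier G" "f \<in> carrier A"
  shows "pair f (\<delta> x) = f x"
proof -
  have "pair f (\<delta> x) = pair (\<delta> x) f"
    unfolding pair_def using assms by (intro finsum_cong') (auto simp: m_comm)
  then show ?thesis using assms pair_delta[of x f] by (auto simp: Pi_iff)
qed

lemma algebra_eqI:
  assumes "f \<in> carrier A" "h \<in> carrier A"
    and "\<And>\<psi>. \<psi> \<in> carrier G \<rightarrow> carrier K \<Longrightarrow> pair f \<psi> = pair h \<psi>"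
  shows "f = h"
proof (rule PiE_ext)
  show "f \<in> carrier G \<rightarrow>\<^sub>E carrier K" "h \<in> carrier G \<rightarrow>\<^sub>E carrier K" using assms by (auto simp: carrier_A)
  fix x assume x: "x \<in> carrier G"
  have "\<delta> x \<in> carrier G \<rightarrow> carrier K" by (auto simp: \<delta>_def)
  then show "f x = h x" using assms x pair_apply_delta by metis
qed

lemma pair_mult:
  assumes f: "f \<in> carrier A" and h: "h \<in> carrier A" and \<psi>: "\<psi> \<in> carrier G \<rightarrow> carrier K"
  shows "pair (f \<otimes>\<^bsub>A\<^esub> h) \<psi> = pair f (\<lambda>a. pair h (\<lambda>b. \<psi> (a \<otimes>\<^bsub>G\<^esub> b)))"
proof -
  have \<psi>': "\<psi> x \<in> carrier K" if "x \<in> carrier G" for x using \<psi> that by auto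
  have "pair (f \<otimes>\<^bsub>A\<^esub> h) \<psi> =
      (\<Oplus>x\<in>carrier G. \<Oplus>y\<in>carrier G. f y \<otimes> h (inv\<^bsub>G\<^esub> y \<otimes>\<^bsub>G\<^esub> x) \<otimes> \<psi> x)"
    unfolding pair_def
  proof (rule finsum_cong')
    fix x assume x: "x \<in> carrier G"
    show "(f \<otimes>\<^bsub>A\<^esub> h) x \<otimes> \<psi> x = (\<Oplus>y\<in>carrier G. f y \<otimes> h (inv\<^bsub>G\<^esub> y \<otimes>\<^bsub>G\<^esub> x) \<otimes> \<psi> x)"
      unfolding mult_A_apply[OF f h x]
      using f h x \<psi>' finite_G by (intro finsum_ldistr) auto
  qed (use f h \<psi>' in \<open>auto intro!: finsum_closed\<close>)
  also have "\<dots> = (\<Oplus>y\<in>carrier G. \<Oplus>x\<in>carrier G. f y \<otimes> h (inv\<^bsub>G\<^esub> y \<otimes>\<^bsub>G\<^esub> x) \<otimes> \<psi> x)"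
    using f h \<psi>' finite_G by (intro finsum_swap) auto
  also have "\<dots> = pair f (\<lambda>a. pair h (\<lambda>b. \<psi> (a \<otimes>\<^bsub>G\<^esub> b)))"
    unfolding pair_def
  proof (rule finsum_cong')
    fix y assume y: "y \<in> carrier G"
    have "(\<Oplus>x\<in>carrier G. f y \<otimes> h (inv\<^bsub>G\<^esub> y \<otimes>\<^bsub>G\<^esub> x) \<otimes> \<psi> x) =
        (\<Oplus>x\<in>(\<otimes>\<^bsub>G\<^esub>) y ` carrier G. f y \<otimes> h (inv\<^bsub>G\<^esub> y \<otimes>\<^bsub>G\<^esub> x) \<otimes> \<psi> x)"
      using G.surj_const_mult[OF y] by simp
    also have "\<dots> = (\<Oplus>b\<in>carrier G. f y \<otimes> h (inv\<^bsub>G\<^esub> y \<otimes>\<^bsub>G\<^esub> (y \<otimes>\<^bsub>G\<^esub> b)) \<otimes> \<psi> (y \<otimes>\<^bsub>G\<^esub> b))"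
      using f h \<psi>' y by (intro finsum_reindex) (auto simp: G.inj_on_cmult)
    also have "\<dots> = (\<Oplus>b\<in>carrier G. f y \<otimes> (h b \<otimes> \<psi> (y \<otimes>\<^bsub>G\<^esub> b)))"
      using f h \<psi>' y by (intro finsum_cong') (auto simp: m_assoc G.m_assoc[symmetric])
    also have "\<dots> = f y \<otimes> (\<Oplus>b\<in>carrier G. h b \<otimes> \<psi> (y \<otimes>\<^bsub>G\<^esub> b))"
      using f h \<psi>' y finite_G by (intro finsum_rdistr[symmetric]) auto
    finally show "(\<Oplus>x\<in>carrier G. f y \<otimes> h (inv\<^bsub>G\<^esub> y \<otimes>\<^bsub>G\<^esub> x) \<otimes> \<psi> x) =
        f y \<otimes> (\<Oplus>b\<in>carrier G. h b \<otimes> \<psi> (y \<otimes>\<^bsub>G\<^esub> b))" .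
  qed (use f h \<psi>' in \<open>auto intro!: finsum_closed\<close>)
  finally show ?thesis .
qed

lemma delta_mult:
  assumes "a \<in> carrier G" "b \<in> carrier G"
  shows "\<delta> a \<otimes>\<^bsub>A\<^esub> \<delta> b = \<delta> (a \<otimes>\<^bsub>G\<^esub> b)"
proof (rule algebra_eqI)
  fix \<psi> assume \<psi>: "\<psi> \<in> carrier G \<rightarrow> carrier K"
  then have "(\<lambda>b. \<psi> (x \<otimes>\<^bsub>G\<^esub> b)) \<in> carrier G \<rightarrow> carrier K" if "x \<in> carrier G" for x
    using that by auto
  then show "pair (\<delta> a \<otimes>\<^bsub>A\<^esub> \<delta> b) \<psi> = pair (\<delta> (a \<otimes>\<^bsub>G\<^esub> b)) \<psi>"
    using assms \<psi> by (simp add: pair_mult pair_delta Pi_iff)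
qed auto

lemma delta_pow:
  "a \<in> carrier G \<Longrightarrow> \<delta> a [^]\<^bsub>A\<^esub> (n::nat) = \<delta> (a [^]\<^bsub>G\<^esub> n)"
  by (induction n) (simp_all add: pow_record_simps one_A delta_mult)

lemma linear_functional_eq_pair:
  assumes \<mu>: "\<mu> \<in> carrier A \<rightarrow> carrier K"
    and add: "\<And>f h. f \<in> carrier A \<Longrightarrow> h \<in> carrier A \<Longrightarrow> \<mu> (f \<oplus>\<^bsub>A\<^esub> h) = \<mu> f \<oplus> \<mu> h"
    and smult: "\<And>c f. c \<in> carrier K \<Longrightarrow> f \<in> carrier A \<Longrightarrow> \<mu> (c \<odot>\<^bsub>A\<^esub> f) = c \<otimes> \<mu> f"
    and f: "f \<in> carrier A"
  shows "\<mu> f = pair f (\<lambda>g. \<mu> (\<delta> g))"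
proof -
  define cut where "cut S = (\<lambda>x\<in>carrier G. if x \<in> S then f x else \<zero>)" for S
  have cut: "cut S \<in> carrier A" for S using f by (auto simp: cut_def carrier_A)
  have sm: "c \<odot>\<^bsub>A\<^esub> h \<in> carrier A" if "c \<in> carrier K" "h \<in> carrier A" for c h
    using that by (auto simp: carrier_A) (auto simp: group_algebra_def)
  have \<mu>': "\<mu> h \<in> carrier K" if "h \<in> carrier A" for h using \<mu> that by auto
  have "\<mu> (cut S) = (\<Oplus>g\<in>S. f g \<otimes> \<mu> (\<delta> g))" if "finite S" "S \<subseteq> carrier G" for S
    using that
  proof (induction S rule: finite_induct)
    case empty
    have "cut {} = \<zero> \<odot>\<^bsub>A\<^esub> f" using f by (auto simp: cut_def group_algebra_def fun_eq_iff)
    then show ?case using smult[of \<zero> f] f \<mu>' by (simp add: finsum_empty)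
  next
    case (insert g S)
    have "cut (insert g S) = f g \<odot>\<^bsub>A\<^esub> \<delta> g \<oplus>\<^bsub>A\<^esub> cut S"
      using insert f by (auto simp: cut_def group_algebra_def fun_eq_iff \<delta>_def)
    then have "\<mu> (cut (insert g S)) = f g \<otimes> \<mu> (\<delta> g) \<oplus> \<mu> (cut S)"
      using add smult sm cut f insert by simp
    also have "\<dots> = (\<Oplus>g\<in>insert g S. f g \<otimes> \<mu> (\<delta> g))"
      using insert f \<mu>' by (subst finsum_insert) (auto simp: subset_iff)
    finally show ?case .
  qed
  from this[of "carrier G"] have "\<mu> (cut (carrier G)) = pair f (\<lambda>g. \<mu> (\<delta> g))"
    using finite_G by (simp add: pair_def)
  moreover have "cut (carrier G) = f" using f by (auto simp: cut_def carrier_A fun_eq_iff PiE_def extensional_def)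
  ultimately show ?thesis by simp
qed

lemma pair_add:
  assumes "f \<in> carrier A" "h \<in> carrier A" "\<psi> \<in> carrier G \<rightarrow> carrier K"
  shows "pair (f \<oplus>\<^bsub>A\<^esub> h) \<psi> = pair f \<psi> \<oplus> pair h \<psi>"
proof -
  have "pair (f \<oplus>\<^bsub>A\<^esub> h) \<psi> = (\<Oplus>g\<in>carrier G. f g \<otimes> \<psi> g \<oplus> h g \<otimes> \<psi> g)"
    unfolding pair_def using assms by (intro finsum_cong') (auto simp: group_algebra_def l_distr Pi_iff)
  then show ?thesis unfolding pair_def using assms by (simp add: finsum_addf Pi_iff)
qed

lemma pair_smult:
  assumes "c \<in> carrier K" "f \<in> carrier A" "\<psi> \<in> carrier G \<rightarrow> carrier K"
  shows "pair (c \<odot>\<^bsub>A\<^esub> f) \<psi> = c \<otimes> pair f \<psi>"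
proof -
  have "pair (c \<odot>\<^bsub>A\<^esub> f) \<psi> = (\<Oplus>g\<in>carrier G. c \<otimes> (f g \<otimes> \<psi> g))"
    unfolding pair_def using assms by (intro finsum_cong') (auto simp: group_algebra_def m_assoc Pi_iff)
  then show ?thesis unfolding pair_def using assms finite_G by (simp add: finsum_rdistr Pi_iff)
qed

lemma pair_power_words:
  assumes x: "x \<in> carrier A" and "\<psi> \<in> carrier G \<rightarrow> carrier K"
  shows "pair (x [^]\<^bsub>A\<^esub> n) \<psi> =
    (\<Oplus>w\<in>words (carrier G) n. word_prod K (map x w) \<otimes> \<psi> (word_prod G w))"
  using assms(2)
proof (induction n arbitrary: \<psi>)
  case 0
  then show ?case by (simp add: pow_record_simps one_A pair_delta words_0 finsum_insert Pi_iff)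
next
  case (Suc n)
  have xw: "word_prod K (map x w) \<in> carrier K" "word_prod G w \<in> carrier G" if "set w \<subseteq> carrier G" for w
    using that x by (auto simp: subset_iff intro!: word_prod_closed G.word_prod_closed)
  have \<psi>': "\<psi> a \<in> carrier K" if "a \<in> carrier G" for a using Suc.prems that by auto
  have fw: "finite (words (carrier G) n)" using finite_G by (rule finite_words)
  have "pair (x [^]\<^bsub>A\<^esub> Suc n) \<psi> = pair (x [^]\<^bsub>A\<^esub> n) (\<lambda>a. pair x (\<lambda>b. \<psi> (a \<otimes>\<^bsub>G\<^esub> b)))"
    using x Suc.prems by (simp add: pow_record_simps pair_mult)
  also have "\<dots> = (\<Oplus>w\<in>words (carrier G) n. word_prod K (map x w) \<otimes> pair x (\<lambda>b. \<psi> (word_prod G w \<otimes>\<^bsub>G\<^esub> b)))"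
    using x \<psi>' by (intro Suc.IH) auto
  also have "\<dots> = (\<Oplus>w\<in>words (carrier G) n. \<Oplus>b\<in>carrier G.
      word_prod K (map x w) \<otimes> (x b \<otimes> \<psi> (word_prod G w \<otimes>\<^bsub>G\<^esub> b)))"
    unfolding pair_def using x \<psi>' finite_G
    by (intro finsum_cong' finsum_rdistr) (auto intro!: finsum_closed simp: words_def xw)
  also have "\<dots> = (\<Oplus>b\<in>carrier G. \<Oplus>w\<in>words (carrier G) n.
      word_prod K (map x w) \<otimes> (x b \<otimes> \<psi> (word_prod G w \<otimes>\<^bsub>G\<^esub> b)))"
    using x \<psi>' finite_G fw by (intro finsum_swap) (auto simp: words_def xw)
  also have "\<dots> = (\<Oplus>b\<in>carrier G. \<Oplus>w\<in>words (carrier G) n.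
      word_prod K (map x (b # w)) \<otimes> \<psi> (word_prod G (b # w)))"
    using x \<psi>' by (intro finsum_cong') (auto simp: words_def xw m_assoc intro!: finsum_closed)
  also have "\<dots> = (\<Oplus>w\<in>words (carrier G) (Suc n). word_prod K (map x w) \<otimes> \<psi> (word_prod G w))"
    using x \<psi>' finite_G by (intro finsum_words_Suc[symmetric]) (auto simp: words_def xw)
  finally show ?case .
qed

text \<open>
  The general form of \<open>(x + y)^p = x^p + y^p\<close> modulo commutators. Both the coefficient of a word and
  the value of \<open>\<psi>\<close> on its product are invariant under rotation, so only constant words contribute.
\<close>

theorem trace_frobenius:
  assumes x: "x \<in> carrier A" and \<psi>: "\<psi> \<in> carrier G \<rightarrow> carrier K"
    and trace: "\<And>a b. a \<in> carrier G \<Longrightarrow> b \<in> carrier G \<Longrightarrow> \<psi> (a \<otimes>\<^bsub>G\<^esub> b) = \<psi> (b \<otimes>\<^bsub>G\<^esub> a)"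
  shows "pair (x [^]\<^bsub>A\<^esub> (p ^ m)) \<psi> = (\<Oplus>g\<in>carrier G. x g [^] (p ^ m) \<otimes> \<psi> (g [^]\<^bsub>G\<^esub> (p ^ m)))"
proof -
  have xw: "word_prod K (map x w) \<in> carrier K" "word_prod G w \<in> carrier G" if "set w \<subseteq> carrier G" for w
    using that x by (auto simp: subset_iff intro!: word_prod_closed G.word_prod_closed)
  let ?F = "\<lambda>w. word_prod K (map x w) \<otimes> \<psi> (word_prod G w)"
  have "pair (x [^]\<^bsub>A\<^esub> (p ^ m)) \<psi> = (\<Oplus>w\<in>words (carrier G) (p ^ m). ?F w)"
    using x \<psi> by (rule pair_power_words)
  also have "\<dots> = (\<Oplus>g\<in>carrier G. ?F (replicate (p ^ m) g))"
  proof (rule finsum_words_rotation[OF finite_G])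
    fix w assume "w \<in> words (carrier G) (p ^ m)"
    then have w: "set w \<subseteq> carrier G" by (simp add: words_def)
    then show "?F w \<in> carrier K" using \<psi> xw[OF w] by (auto simp: Pi_iff)
    have "word_prod K (map x (rotate1 w)) = word_prod K (map x w)"
      using w x by (subst rotate1_map[symmetric], intro word_prod_rotate1) auto
    moreover have "\<psi> (word_prod G (rotate1 w)) = \<psi> (word_prod G w)"
      using w by (cases w) (auto simp: G.word_prod_append G.word_prod_closed trace)
    ultimately show "?F (rotate1 w) = ?F w" by simp
  qed
  also have "\<dots> = (\<Oplus>g\<in>carrier G. x g [^] (p ^ m) \<otimes> \<psi> (g [^]\<^bsub>G\<^esub> (p ^ m)))"
    by (simp add: word_prod_replicate G.word_prod_replicate)
  finally show ?thesis .
qed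

text \<open>
  The fixed points of conjugation are the central elements.
\<close>

lemma finsum_class_function:
  assumes F: "\<And>g. g \<in> carrier G \<Longrightarrow> F g \<in> carrier K"
    and cls: "\<And>g x. g \<in> carrier G \<Longrightarrow> x \<in> carrier G \<Longrightarrow> F (g \<otimes>\<^bsub>G\<^esub> x \<otimes>\<^bsub>G\<^esub> inv\<^bsub>G\<^esub> g) = F x"
  shows "(\<Oplus>g\<in>carrier G. F g) = (\<Oplus>z\<in>G.centre. F z)"
proof -
  obtain m where m: "order G = p ^ m" using order_G by blast
  let ?act = "\<lambda>g. \<lambda>x\<in>carrier G. g \<otimes>\<^bsub>G\<^esub> x \<otimes>\<^bsub>G\<^esub> inv\<^bsub>G\<^esub> g"
  have act: "group_action G (carrier G) ?act"
    by (rule group_actionI) (auto simp: G.m_assoc G.inv_mult_group)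
  have "{x \<in> carrier G. \<forall>g\<in>carrier G. ?act g x = x} = G.centre"
  proof -
    have "g \<otimes>\<^bsub>G\<^esub> x \<otimes>\<^bsub>G\<^esub> inv\<^bsub>G\<^esub> g = x \<longleftrightarrow> g \<otimes>\<^bsub>G\<^esub> x = x \<otimes>\<^bsub>G\<^esub> g"
      if "g \<in> carrier G" "x \<in> carrier G" for g x
      using that G.inv_solve_right[of "g \<otimes>\<^bsub>G\<^esub> x" x g] by (metis G.inv_solve_right' G.m_closed)
    then show ?thesis by (auto simp: G.centre_def)
  qed
  then show ?thesis
    using finsum_fixed_points[OF act m finite_G, where F = F] F cls by simp
qed

lemma central_coeff_conj:
  assumes x: "x \<in> carrier A"
    and central: "\<And>h. h \<in> carrier G \<Longrightarrow> \<delta> h \<otimes>\<^bsub>A\<^esub> x = x \<otimes>\<^bsub>A\<^esub> \<delta> h"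
    and h: "h \<in> carrier G" and g: "g \<in> carrier G"
  shows "x (h \<otimes>\<^bsub>G\<^esub> g \<otimes>\<^bsub>G\<^esub> inv\<^bsub>G\<^esub> h) = x g"
proof -
  define k where "k = h \<otimes>\<^bsub>G\<^esub> g"
  have k: "k \<in> carrier G" using h g by (simp add: k_def)
  have \<psi>: "\<delta> k \<in> carrier G \<rightarrow> carrier K" by (auto simp: \<delta>_def)
  then have \<psi>': "\<delta> k y \<in> carrier K" if "y \<in> carrier G" for y using that by auto
  have "pair (\<delta> h \<otimes>\<^bsub>A\<^esub> x) (\<delta> k) = pair x (\<lambda>b. \<delta> k (h \<otimes>\<^bsub>G\<^esub> b))"
    using h x \<psi>' \<psi> by (subst pair_mult) (auto intro!: pair_delta)
  also have "\<dots> = pair x (\<delta> g)"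
    using h g x by (intro pair_cong) (auto simp: \<delta>_def k_def)
  finally have l: "pair (\<delta> h \<otimes>\<^bsub>A\<^esub> x) (\<delta> k) = x g" using g x by (simp add: pair_apply_delta)
  have "pair (x \<otimes>\<^bsub>A\<^esub> \<delta> h) (\<delta> k) = pair x (\<lambda>a. pair (\<delta> h) (\<lambda>b. \<delta> k (a \<otimes>\<^bsub>G\<^esub> b)))"
    using h x \<psi> by (subst pair_mult) auto
  also have "\<dots> = pair x (\<delta> (k \<otimes>\<^bsub>G\<^esub> inv\<^bsub>G\<^esub> h))"
  proof (rule pair_cong)
    fix a assume a: "a \<in> carrier G"
    have "pair (\<delta> h) (\<lambda>b. \<delta> k (a \<otimes>\<^bsub>G\<^esub> b)) = \<delta> k (a \<otimes>\<^bsub>G\<^esub> h)"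
      using a h \<psi>' by (intro pair_delta) auto
    also have "\<dots> = \<delta> (k \<otimes>\<^bsub>G\<^esub> inv\<^bsub>G\<^esub> h) a"
      using a h k G.inv_solve_right[of a k h] by (auto simp: \<delta>_def G.m_assoc)
    finally show "pair (\<delta> h) (\<lambda>b. \<delta> k (a \<otimes>\<^bsub>G\<^esub> b)) = \<delta> (k \<otimes>\<^bsub>G\<^esub> inv\<^bsub>G\<^esub> h) a" .
  qed (use x in \<open>auto simp: \<delta>_def\<close>)
  finally have r: "pair (x \<otimes>\<^bsub>A\<^esub> \<delta> h) (\<delta> k) = x (k \<otimes>\<^bsub>G\<^esub> inv\<^bsub>G\<^esub> h)" using h k x by (simp add: pair_apply_delta)
  show ?thesis using l r central[OF h] by (simp add: k_def)
qed

end

section \<open>Traces that are additive on \<open>p^l\<close>-th powers\<close>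

context modular_group_algebra
begin

text \<open>
  A function on the group whose linear extension factors through the abelianization of the group algebra and
  for which \<open>g \<mapsto> \<phi> (g [^] (p ^ l))\<close> is a homomorphism to the additive group of the field. Both
  conditions pass to the units of \<open>p\<close>-power order in the group algebra (\<open>ft_pair_swap\<close>,
  \<open>ft_pair_add\<close>), which makes the notion invariant under isomorphisms of group algebras.
\<close>

definition frobenius_trace :: "nat \<Rightarrow> ('g \<Rightarrow> 'k) \<Rightarrow> bool"
  where "frobenius_trace l \<phi> \<longleftrightarrow> \<phi> \<in> carrier G \<rightarrow> carrier K \<and>
    (\<forall>a\<in>carrier G. \<forall>b\<in>carrier G. \<forall>w\<in>carrier G. \<phi> (a \<otimes>\<^bsub>G\<^esub> b \<otimes>\<^bsub>G\<^esub> w) = \<phi> (b \<otimes>\<^bsub>G\<^esub> a \<otimes>\<^bsub>G\<^esub> w)) \<and>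
    (\<forall>a\<in>carrier G. \<forall>b\<in>carrier G.
      \<phi> ((a \<otimes>\<^bsub>G\<^esub> b) [^]\<^bsub>G\<^esub> (p ^ l)) = \<phi> (a [^]\<^bsub>G\<^esub> (p ^ l)) \<oplus> \<phi> (b [^]\<^bsub>G\<^esub> (p ^ l)))"

lemma pair_swap:
  assumes x: "x \<in> carrier A" and y: "y \<in> carrier A"
    and F: "\<And>a b. a \<in> carrier G \<Longrightarrow> b \<in> carrier G \<Longrightarrow> F a b \<in> carrier K"
  shows "pair x (\<lambda>a. pair y (\<lambda>b. F a b)) = pair y (\<lambda>b. pair x (\<lambda>a. F a b))"
proof -
  have push: "pair x' (\<lambda>a. pair y' (\<lambda>b. F' a b)) = (\<Oplus>a\<in>carrier G. \<Oplus>b\<in>carrier G. x' a \<otimes> (y' b \<otimes> F' a b))"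
    if "x' \<in> carrier A" "y' \<in> carrier A" "\<And>a b. a \<in> carrier G \<Longrightarrow> b \<in> carrier G \<Longrightarrow> F' a b \<in> carrier K"
    for x' y' F'
    unfolding pair_def using that finite_G
    by (intro finsum_cong' finsum_rdistr) (auto intro!: finsum_closed)
  have "pair x (\<lambda>a. pair y (\<lambda>b. F a b)) = (\<Oplus>a\<in>carrier G. \<Oplus>b\<in>carrier G. x a \<otimes> (y b \<otimes> F a b))"
    using x y F by (rule push)
  also have "\<dots> = (\<Oplus>b\<in>carrier G. \<Oplus>a\<in>carrier G. x a \<otimes> (y b \<otimes> F a b))"
    using x y F finite_G by (intro finsum_swap) auto
  also have "\<dots> = (\<Oplus>b\<in>carrier G. \<Oplus>a\<in>carrier G. y b \<otimes> (x a \<otimes> F a b))"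
    using x y F by (intro finsum_cong') (auto intro!: finsum_closed m_lcomm)
  also have "\<dots> = pair y (\<lambda>b. pair x (\<lambda>a. F a b))"
    using x y F by (intro push[symmetric]) auto
  finally show ?thesis .
qed

context
  fixes l \<phi>
  assumes \<phi>: "frobenius_trace l \<phi>"
begin

lemma ft_closed: "g \<in> carrier G \<Longrightarrow> \<phi> g \<in> carrier K"
  using \<phi> by (auto simp: frobenius_trace_def)

lemma ft_swap:
  "a \<in> carrier G \<Longrightarrow> b \<in> carrier G \<Longrightarrow> w \<in> carrier G \<Longrightarrow>
    \<phi> (a \<otimes>\<^bsub>G\<^esub> b \<otimes>\<^bsub>G\<^esub> w) = \<phi> (b \<otimes>\<^bsub>G\<^esub> a \<otimes>\<^bsub>G\<^esub> w)"
  using \<phi> by (auto simp: frobenius_trace_def)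

lemma ft_trace:
  "a \<in> carrier G \<Longrightarrow> b \<in> carrier G \<Longrightarrow> \<phi> (a \<otimes>\<^bsub>G\<^esub> b) = \<phi> (b \<otimes>\<^bsub>G\<^esub> a)"
  using ft_swap[of a b "\<one>\<^bsub>G\<^esub>"] by simp

lemma ft_add:
  "a \<in> carrier G \<Longrightarrow> b \<in> carrier G \<Longrightarrow>
    \<phi> ((a \<otimes>\<^bsub>G\<^esub> b) [^]\<^bsub>G\<^esub> (p ^ l)) = \<phi> (a [^]\<^bsub>G\<^esub> (p ^ l)) \<oplus> \<phi> (b [^]\<^bsub>G\<^esub> (p ^ l))"
  using \<phi> by (auto simp: frobenius_trace_def)

lemma ft_one: "\<phi> \<one>\<^bsub>G\<^esub> = \<zero>"
proof -
  have "\<phi> \<one>\<^bsub>G\<^esub> = \<phi> \<one>\<^bsub>G\<^esub> \<oplus> \<phi> \<one>\<^bsub>G\<^esub>" using ft_add[of "\<one>\<^bsub>G\<^esub>" "\<one>\<^bsub>G\<^esub>"] by simp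
  then show ?thesis using add.l_cancel[of "\<phi> \<one>\<^bsub>G\<^esub>" \<zero> "\<phi> \<one>\<^bsub>G\<^esub>"] ft_closed[of "\<one>\<^bsub>G\<^esub>"] by simp
qed

lemma ft_power:
  assumes "g \<in> carrier G"
  shows "\<phi> ((g [^]\<^bsub>G\<^esub> (k::nat)) [^]\<^bsub>G\<^esub> (p ^ l)) = add_pow K k (\<phi> (g [^]\<^bsub>G\<^esub> (p ^ l)))"
proof (induction k)
  case 0
  then show ?case using ft_one by simp
next
  case (Suc k)
  then show ?case using ft_add[of "g [^]\<^bsub>G\<^esub> k" g] assms by simp
qed

lemma ft_derived:
  assumes c: "c \<in> derived G (carrier G)" and y: "y \<in> carrier G"
  shows "\<phi> (c \<otimes>\<^bsub>G\<^esub> y) = \<phi> y"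
proof -
  define L where "L = {c \<in> carrier G. \<forall>y\<in>carrier G. \<phi> (c \<otimes>\<^bsub>G\<^esub> y) = \<phi> y}"
  have "subgroup L G"
    by (rule G.finite_submonoid_subgroup[OF finite_G]) (auto simp: L_def G.m_assoc)
  moreover have "derived_set G (carrier G) \<subseteq> L"
  proof
    fix h assume "h \<in> derived_set G (carrier G)"
    then obtain a b where ab: "a \<in> carrier G" "b \<in> carrier G"
      and h: "h = a \<otimes>\<^bsub>G\<^esub> b \<otimes>\<^bsub>G\<^esub> inv\<^bsub>G\<^esub> a \<otimes>\<^bsub>G\<^esub> inv\<^bsub>G\<^esub> b" by blast
    have "\<phi> (h \<otimes>\<^bsub>G\<^esub> y) = \<phi> y" if y: "y \<in> carrier G" for y
    proof -
      have "\<phi> (h \<otimes>\<^bsub>G\<^esub> y) = \<phi> (a \<otimes>\<^bsub>G\<^esub> b \<otimes>\<^bsub>G\<^esub> (inv\<^bsub>G\<^esub> a \<otimes>\<^bsub>G\<^esub> (inv\<^bsub>G\<^esub> b \<otimes>\<^bsub>G\<^esub> y)))"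
        using h ab y by (simp add: G.m_assoc)
      also have "\<dots> = \<phi> (b \<otimes>\<^bsub>G\<^esub> a \<otimes>\<^bsub>G\<^esub> (inv\<^bsub>G\<^esub> a \<otimes>\<^bsub>G\<^esub> (inv\<^bsub>G\<^esub> b \<otimes>\<^bsub>G\<^esub> y)))"
        using ab y by (intro ft_swap) auto
      also have "a \<otimes>\<^bsub>G\<^esub> (inv\<^bsub>G\<^esub> a \<otimes>\<^bsub>G\<^esub> (inv\<^bsub>G\<^esub> b \<otimes>\<^bsub>G\<^esub> y)) = inv\<^bsub>G\<^esub> b \<otimes>\<^bsub>G\<^esub> y"
        using ab y by (simp add: G.m_assoc[symmetric])
      then have "b \<otimes>\<^bsub>G\<^esub> a \<otimes>\<^bsub>G\<^esub> (inv\<^bsub>G\<^esub> a \<otimes>\<^bsub>G\<^esub> (inv\<^bsub>G\<^esub> b \<otimes>\<^bsub>G\<^esub> y)) = b \<otimes>\<^bsub>G\<^esub> (inv\<^bsub>G\<^esub> b \<otimes>\<^bsub>G\<^esub> y)"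
        using ab y by (simp add: G.m_assoc)
      also have "\<dots> = y" using ab y by (simp add: G.m_assoc[symmetric])
      finally show ?thesis .
    qed
    then show "h \<in> L" using h ab by (simp add: L_def)
  qed
  ultimately have "derived G (carrier G) \<subseteq> L" unfolding derived_def by (rule G.generate_subgroup_incl[rotated])
  then show ?thesis using c y by (auto simp: L_def)
qed

text \<open>
  The derived subgroup does not affect the value, and the homomorphism
  \<open>g \<mapsto> \<phi> (g [^] (p ^ l))\<close> kills \<open>p\<close>-th powers in characteristic \<open>p\<close>.
\<close>

lemma ft_derived_powers:
  assumes "g \<in> G.derived_powers (p ^ Suc l)"
  shows "\<phi> g = \<zero>"
proof -
  obtain c v where cv: "g = c \<otimes>\<^bsub>G\<^esub> v [^]\<^bsub>G\<^esub> (p ^ Suc l)" "c \<in> derived G (carrier G)" "v \<in> carrier G"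
    using assms by (auto simp: G.derived_powers_def)
  have "\<phi> g = \<phi> (v [^]\<^bsub>G\<^esub> (p ^ Suc l))" using cv ft_derived by simp
  also have "\<dots> = \<phi> ((v [^]\<^bsub>G\<^esub> p) [^]\<^bsub>G\<^esub> (p ^ l))" using cv(3) by (simp add: G.nat_pow_pow)
  also have "\<dots> = \<zero>"
    using ft_power[OF cv(3), of p] add_pow_p_multiple[of "\<phi> (v [^]\<^bsub>G\<^esub> (p ^ l))" p] cv(3) ft_closed by simp
  finally show ?thesis .
qed

lemma ft_pair_power:
  assumes "x \<in> carrier A"
  shows "pair (x [^]\<^bsub>A\<^esub> (p ^ l)) \<phi> = (\<Oplus>g\<in>carrier G. x g [^] (p ^ l) \<otimes> \<phi> (g [^]\<^bsub>G\<^esub> (p ^ l)))"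
  using ft_closed ft_trace by (intro trace_frobenius[OF assms]) auto

lemma ft_pair_swap:
  assumes "x \<in> carrier A" "y \<in> carrier A" "z \<in> carrier A"
  shows "pair (x \<otimes>\<^bsub>A\<^esub> y \<otimes>\<^bsub>A\<^esub> z) \<phi> = pair (y \<otimes>\<^bsub>A\<^esub> x \<otimes>\<^bsub>A\<^esub> z) \<phi>"
proof -
  have expand: "pair (x \<otimes>\<^bsub>A\<^esub> y \<otimes>\<^bsub>A\<^esub> z) \<phi> =
      pair x (\<lambda>a. pair y (\<lambda>b. pair z (\<lambda>w. \<phi> (a \<otimes>\<^bsub>G\<^esub> b \<otimes>\<^bsub>G\<^esub> w))))"
    if "x \<in> carrier A" "y \<in> carrier A" for x y
    using that assms(3) ft_closed by (simp add: pair_mult Pi_iff)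
  have "pair (x \<otimes>\<^bsub>A\<^esub> y \<otimes>\<^bsub>A\<^esub> z) \<phi> = pair y (\<lambda>b. pair x (\<lambda>a. pair z (\<lambda>w. \<phi> (a \<otimes>\<^bsub>G\<^esub> b \<otimes>\<^bsub>G\<^esub> w))))"
    unfolding expand[OF assms(1,2)] using assms ft_closed by (intro pair_swap) auto
  also have "\<dots> = pair y (\<lambda>b. pair x (\<lambda>a. pair z (\<lambda>w. \<phi> (b \<otimes>\<^bsub>G\<^esub> a \<otimes>\<^bsub>G\<^esub> w))))"
    using assms ft_closed by (intro pair_cong) (auto simp: ft_swap)
  also have "\<dots> = pair (y \<otimes>\<^bsub>A\<^esub> x \<otimes>\<^bsub>A\<^esub> z) \<phi>" using expand[OF assms(2,1)] by simp
  finally show ?thesis .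
qed

text \<open>
  By \<open>trace_frobenius\<close> the value at \<open>x [^] (p ^ l)\<close> is the pairing of the homomorphism \<open>d\<close> with
  the element \<open>fr x\<close>, whose coefficients are the powers of those of \<open>x\<close>. The map \<open>fr\<close> is
  multiplicative, and additivity of \<open>d\<close> gives the usual product rule, in which each factor is weighted by the
  augmentation of the other one. The augmentation of a unit of \<open>p\<close>-power order is \<open>\<one>\<close>.
\<close>

lemma ft_pair_add:
  assumes x: "x \<in> carrier A" "x [^]\<^bsub>A\<^esub> (p ^ N) = \<one>\<^bsub>A\<^esub>"
    and y: "y \<in> carrier A" "y [^]\<^bsub>A\<^esub> (p ^ N) = \<one>\<^bsub>A\<^esub>"
  shows "pair ((x \<otimes>\<^bsub>A\<^esub> y) [^]\<^bsub>A\<^esub> (p ^ l)) \<phi> =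
    pair (x [^]\<^bsub>A\<^esub> (p ^ l)) \<phi> \<oplus> pair (y [^]\<^bsub>A\<^esub> (p ^ l)) \<phi>"
proof -
  define d where "d g = \<phi> (g [^]\<^bsub>G\<^esub> (p ^ l))" for g
  define fr where "fr x = (\<lambda>g\<in>carrier G. x g [^] (p ^ l))" for x :: "'g \<Rightarrow> 'k"
  have fr: "fr x \<in> carrier A" if "x \<in> carrier A" for x using that by (auto simp: fr_def carrier_A)
  have d: "d g \<in> carrier K" if "g \<in> carrier G" for g using that ft_closed by (simp add: d_def)
  have pw: "pair (x [^]\<^bsub>A\<^esub> (p ^ l)) \<phi> = pair (fr x) d" if "x \<in> carrier A" for x
    unfolding ft_pair_power[OF that] pair_def[of "fr x" d]
    using that d by (intro finsum_cong') (auto simp: fr_def d_def)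
  have fr_mult: "fr (x \<otimes>\<^bsub>A\<^esub> y) = fr x \<otimes>\<^bsub>A\<^esub> fr y"
  proof (rule PiE_ext[of _ "carrier G" "\<lambda>_. carrier K"])
    show "fr (x \<otimes>\<^bsub>A\<^esub> y) \<in> carrier G \<rightarrow>\<^sub>E carrier K" "fr x \<otimes>\<^bsub>A\<^esub> fr y \<in> carrier G \<rightarrow>\<^sub>E carrier K"
      using fr x(1) y(1) by (simp_all flip: carrier_A)
    fix g assume g: "g \<in> carrier G"
    have "fr (x \<otimes>\<^bsub>A\<^esub> y) g = (\<Oplus>a\<in>carrier G. x a \<otimes> y (inv\<^bsub>G\<^esub> a \<otimes>\<^bsub>G\<^esub> g)) [^] (p ^ l)"
      using g mult_A_apply[OF x(1) y(1) g] by (simp add: fr_def)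
    also have "\<dots> = (\<Oplus>a\<in>carrier G. (x a \<otimes> y (inv\<^bsub>G\<^esub> a \<otimes>\<^bsub>G\<^esub> g)) [^] (p ^ l))"
      using finite_G g x(1) y(1) by (intro finsum_frobenius) auto
    also have "\<dots> = (fr x \<otimes>\<^bsub>A\<^esub> fr y) g"
      unfolding mult_A_apply[OF fr[OF x(1)] fr[OF y(1)] g]
      using g x(1) y(1) by (intro finsum_cong') (auto simp: fr_def nat_pow_distrib)
    finally show "fr (x \<otimes>\<^bsub>A\<^esub> y) g = (fr x \<otimes>\<^bsub>A\<^esub> fr y) g" .
  qed
  have aug: "(\<Oplus>g\<in>carrier G. fr x g) = \<one>" if x: "x \<in> carrier A" "x [^]\<^bsub>A\<^esub> (p ^ N) = \<one>\<^bsub>A\<^esub>" for x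
  proof -
    have one: "pair (x [^]\<^bsub>A\<^esub> (p ^ N)) (\<lambda>_. \<one>) = \<one>"
      unfolding x(2) one_A by (rule pair_delta) auto
    have "pair (x [^]\<^bsub>A\<^esub> (p ^ N)) (\<lambda>_. \<one>) = (\<Oplus>g\<in>carrier G. x g [^] (p ^ N) \<otimes> \<one>)"
      by (rule trace_frobenius[OF x(1)]) auto
    also have "\<dots> = (\<Oplus>g\<in>carrier G. x g [^] (p ^ N))" using x(1) by (intro finsum_cong') auto
    also have "\<dots> = (\<Oplus>g\<in>carrier G. x g) [^] (p ^ N)" using x(1) finite_G by (intro finsum_frobenius[symmetric]) auto
    finally have calc: "pair (x [^]\<^bsub>A\<^esub> (p ^ N)) (\<lambda>_. \<one>) = (\<Oplus>g\<in>carrier G. x g) [^] (p ^ N)" .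
    have "(\<Oplus>g\<in>carrier G. x g) [^] (p ^ N) = \<one>"
      unfolding calc[symmetric] one ..
    moreover have "(\<Oplus>g\<in>carrier G. x g) \<in> carrier K" using x(1) by (auto intro!: finsum_closed)
    ultimately have "(\<Oplus>g\<in>carrier G. x g) = \<one>" by (rule frobenius_one[rotated])
    moreover have "(\<Oplus>g\<in>carrier G. fr x g) = (\<Oplus>g\<in>carrier G. x g [^] (p ^ l))"
      using x(1) by (intro finsum_cong') (auto simp: fr_def)
    ultimately show ?thesis using finsum_frobenius[of "carrier G" x l] x(1) finite_G by simp
  qed
  have const: "pair (fr x) (\<lambda>_. k) = k" if "k \<in> carrier K" "x \<in> carrier A" "x [^]\<^bsub>A\<^esub> (p ^ N) = \<one>\<^bsub>A\<^esub>" for k x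
  proof -
    have "pair (fr x) (\<lambda>_. k) = (\<Oplus>g\<in>carrier G. fr x g) \<otimes> k"
      unfolding pair_def using that fr finite_G by (intro finsum_ldistr[symmetric]) auto
    then show ?thesis using aug[OF that(2,3)] that(1) by simp
  qed
  have sum: "pair (fr x) (\<lambda>g. F g \<oplus> F' g) = pair (fr x) F \<oplus> pair (fr x) F'"
    if "x \<in> carrier A" "\<And>g. g \<in> carrier G \<Longrightarrow> F g \<in> carrier K" "\<And>g. g \<in> carrier G \<Longrightarrow> F' g \<in> carrier K" for x F F'
  proof -
    have "pair (fr x) (\<lambda>g. F g \<oplus> F' g) = (\<Oplus>g\<in>carrier G. fr x g \<otimes> F g \<oplus> fr x g \<otimes> F' g)"
      unfolding pair_def using that fr by (intro finsum_cong') (auto simp: r_distr)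
    then show ?thesis unfolding pair_def using that fr by (simp add: finsum_addf Pi_iff)
  qed
  have dP: "d \<in> carrier G \<rightarrow> carrier K" using d by auto
  have "pair ((x \<otimes>\<^bsub>A\<^esub> y) [^]\<^bsub>A\<^esub> (p ^ l)) \<phi> = pair (fr x \<otimes>\<^bsub>A\<^esub> fr y) d"
    using pw[of "x \<otimes>\<^bsub>A\<^esub> y"] x y fr_mult by simp
  also have "\<dots> = pair (fr x) (\<lambda>a. pair (fr y) (\<lambda>b. d (a \<otimes>\<^bsub>G\<^esub> b)))"
    using fr x y dP by (intro pair_mult) auto
  also have "\<dots> = pair (fr x) (\<lambda>a. d a \<oplus> pair (fr y) d)"
  proof (rule pair_cong)
    fix a assume a: "a \<in> carrier G"
    have "pair (fr y) (\<lambda>b. d (a \<otimes>\<^bsub>G\<^esub> b)) = pair (fr y) (\<lambda>b. d a \<oplus> d b)"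
      using fr y d a by (intro pair_cong) (auto simp: d_def ft_add)
    then show "pair (fr y) (\<lambda>b. d (a \<otimes>\<^bsub>G\<^esub> b)) = d a \<oplus> pair (fr y) d"
      using sum[of y "\<lambda>_. d a" d] const[of "d a" y] y d a by simp
  qed (use fr x y dP d in auto)
  also have "\<dots> = pair (fr x) d \<oplus> pair (fr y) d"
    using sum[of x d "\<lambda>_. pair (fr y) d"] const[of "pair (fr y) d" x] x y fr d dP by simp
  finally show ?thesis using pw x y by simp
qed

end

end

section \<open>Central units of exponent \<open>p^(l+1)\<close>\<close>

context modular_group_algebra
begin

text \<open>
  Expand \<open>b\<close> in coordinates. A generator of order less than \<open>p ^ Suc l\<close> has trivial
  \<open>p ^ l\<close>-th power, one of order \<open>p ^ Suc l\<close> is covered by \<open>vanish\<close>, and a generator of greater order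
  enters with an exponent divisible by \<open>p\<close>.
\<close>

lemma frobenius_trace_abelian_factor:
  assumes \<phi>: "frobenius_trace l \<phi>"
    and B: "subgroup B G" and coords: "coordinates (G\<lparr>carrier := B\<rparr>) p t a e c"
    and vanish: "\<And>j. j < t \<Longrightarrow> e j = l \<Longrightarrow> \<phi> (a j [^]\<^bsub>G\<^esub> (p ^ l)) = \<zero>"
    and b: "b \<in> B" "b [^]\<^bsub>G\<^esub> (p ^ Suc l) = \<one>\<^bsub>G\<^esub>"
  shows "\<phi> (b [^]\<^bsub>G\<^esub> (p ^ l)) = \<zero>"
proof -
  let ?B = "G\<lparr>carrier := B\<rparr>"
  interpret C: coordinates ?B p t a e c by fact
  interpret B: subgroup B G by fact
  define d where "d x = \<phi> (x [^]\<^bsub>G\<^esub> (p ^ l))" for x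
  have pow: "x [^]\<^bsub>?B\<^esub> (k::nat) = x [^]\<^bsub>G\<^esub> k" for x k by (simp add: G.nat_pow_consistent[symmetric])
  have d_closed: "d x \<in> carrier K" if "x \<in> B" for x using that ft_closed[OF \<phi>] by (simp add: d_def)
  have d_gen: "d (a j [^]\<^bsub>?B\<^esub> c j b) = \<zero>" if j: "j < t" for j
  proof -
    have aj: "a j \<in> B" using C.gen_closed[OF j] by simp
    have eq: "d (a j [^]\<^bsub>?B\<^esub> c j b) = add_pow K (c j b) (d (a j))"
      using ft_power[OF \<phi>, of "a j" "c j b"] aj by (simp add: d_def pow)
    consider "e j = l" | "e j < l" | "l < e j" by linarith
    then show ?thesis
    proof cases
      case 1
      then have "d (a j) = \<zero>" using vanish[OF j] by (simp add: d_def)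
      then show ?thesis using eq by simp
    next
      case 2
      have one: "a j [^]\<^bsub>G\<^esub> (p ^ Suc (e j)) = \<one>\<^bsub>G\<^esub>" using C.gen_order[OF j] by (simp only: pow) simp
      obtain k where k: "l = Suc (e j) + k" using 2 by (metis Suc_leI le_Suc_ex)
      then have "a j [^]\<^bsub>G\<^esub> (p ^ l) = a j [^]\<^bsub>G\<^esub> (p ^ Suc (e j) * p ^ k)" by (simp only: power_add)
      then have "a j [^]\<^bsub>G\<^esub> (p ^ l) = (a j [^]\<^bsub>G\<^esub> (p ^ Suc (e j))) [^]\<^bsub>G\<^esub> (p ^ k)"
        using aj by (simp only: G.nat_pow_pow B.mem_carrier)
      then have "d (a j) = \<zero>" using ft_one[OF \<phi>] unfolding d_def one by simp
      then show ?thesis using eq by simp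
    next
      case 3
      have "[p ^ Suc l * c j b = c j (b [^]\<^bsub>?B\<^esub> (p ^ Suc l))] (mod p ^ Suc (e j))"
        using C.coord_pow[OF j, of b "p ^ Suc l"] b(1) by (simp add: cong_sym)
      also have "b [^]\<^bsub>?B\<^esub> (p ^ Suc l) = \<one>\<^bsub>?B\<^esub>" using b(2) by (simp only: pow) simp
      also have "[c j \<one>\<^bsub>?B\<^esub> = 0] (mod p ^ Suc (e j))" by (rule C.coord_one[OF j])
      finally have dv: "p ^ Suc (e j) dvd p ^ Suc l * c j b" by (simp only: cong_0_iff)
      obtain k where k: "e j = Suc l + k" using 3 by (metis Suc_leI le_Suc_ex)
      then have eq': "p ^ Suc (e j) = p ^ Suc l * (p * p ^ k)" by (simp add: power_add mult_ac)
      have "p ^ Suc l * (p * p ^ k) dvd p ^ Suc l * c j b" using dv unfolding eq' .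
      moreover have "p ^ Suc l \<noteq> 0" using prime_gt_0_nat[OF prime_p] by simp
      ultimately have "p * p ^ k dvd c j b" using nat_mult_dvd_cancel_disj[of "p ^ Suc l" "p * p ^ k" "c j b"] by metis
      then have "p dvd c j b" by (rule dvd_mult_left)
      then show ?thesis using eq add_pow_p_multiple[OF d_closed[OF aj]] by simp
    qed
  qed
  have prod: "d (finprod ?B f J) = \<zero>" if "finite J" "\<And>j. j \<in> J \<Longrightarrow> f j \<in> B" "\<And>j. j \<in> J \<Longrightarrow> d (f j) = \<zero>"
    for J and f :: "nat \<Rightarrow> 'g"
    using that
  proof (induction J rule: finite_induct)
    case empty
    then show ?case using ft_one[OF \<phi>] by (simp add: d_def)
  next
    case (insert j J)
    have "finprod ?B f J \<in> carrier ?B" by (intro C.finprod_closed) (use insert in auto)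
    then have cl: "finprod ?B f J \<in> B" by simp
    have "finprod ?B f (insert j J) = f j \<otimes>\<^bsub>?B\<^esub> finprod ?B f J"
      by (rule C.finprod_insert) (use insert in auto)
    then have "d (finprod ?B f (insert j J)) = d (f j) \<oplus> d (finprod ?B f J)"
      using ft_add[OF \<phi>, of "f j" "finprod ?B f J"] cl insert by (simp add: d_def)
    then show ?case using insert by simp
  qed
  have "d (finprod ?B (\<lambda>j. a j [^]\<^bsub>?B\<^esub> c j b) {..<t}) = \<zero>"
    by (rule prod) (use d_gen C.gen_closed C.nat_pow_closed in auto)
  then have "d b = \<zero>" using C.coord_expansion[of b] b(1) by simp
  then show ?thesis by (simp add: d_def)
qed

text \<open>
  Both components of \<open>z\<close> are central of exponent dividing \<open>p ^ Suc l\<close>. The one in \<open>B\<close> is handled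
  by coordinates, the one in \<open>N\<close> by maximality of \<open>B\<close>.
\<close>

lemma frobenius_trace_central:
  assumes \<phi>: "frobenius_trace l \<phi>"
    and max: "is_Ab_NAb G B N" and coords: "coordinates (G\<lparr>carrier := B\<rparr>) p t a e c"
    and vanish: "\<And>j. j < t \<Longrightarrow> e j = l \<Longrightarrow> \<phi> (a j [^]\<^bsub>G\<^esub> (p ^ l)) = \<zero>"
    and z: "z \<in> G.centre" "z [^]\<^bsub>G\<^esub> (p ^ Suc l) = \<one>\<^bsub>G\<^esub>"
  shows "\<phi> (z [^]\<^bsub>G\<^esub> (p ^ l)) = \<zero>"
proof -
  have dec: "abelian_decomposition G B N" using max by (simp add: is_Ab_NAb_def)
  then have idp: "internal_direct_product G B N" by (simp add: abelian_decomposition_def)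
  then have "B \<lhd> G" by (simp add: internal_direct_product_def)
  then interpret B: normal B G .
  have "N \<lhd> G" using idp by (simp add: internal_direct_product_def)
  then interpret N: normal N G .
  obtain \<pi> \<nu> where \<pi>: "\<pi> \<in> hom G (G\<lparr>carrier := B\<rparr>)" "\<nu> \<in> carrier G \<rightarrow> N"
    "\<And>x. x \<in> carrier G \<Longrightarrow> x = \<pi> x \<otimes>\<^bsub>G\<^esub> \<nu> x" "\<And>a. a \<in> B \<Longrightarrow> \<pi> a = a"
    by (rule G.internal_direct_product_projections[OF idp]) blast
  have zc: "z \<in> carrier G" and zz: "\<And>g. g \<in> carrier G \<Longrightarrow> g \<otimes>\<^bsub>G\<^esub> z = z \<otimes>\<^bsub>G\<^esub> g"
    using z by (auto simp: G.centre_def)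
  define b n where "b = \<pi> z" and "n = \<nu> z"
  have zbn: "z = b \<otimes>\<^bsub>G\<^esub> n" using \<pi>(3)[OF zc] by (simp add: b_def n_def)
  have bB: "b \<in> B" using \<pi>(1) zc by (auto simp: b_def hom_def)
  have nN: "n \<in> N" using \<pi>(2) zc by (auto simp: n_def)
  have c: "b \<in> carrier G" "n \<in> carrier G" using bB nN by auto
  have bb: "\<And>g. g \<in> carrier G \<Longrightarrow> g \<otimes>\<^bsub>G\<^esub> b = b \<otimes>\<^bsub>G\<^esub> g"
    using G.abelian_factor_central[OF dec] bB by (auto simp: G.centre_def)
  have n_central: "n \<in> G.centre"
  proof -
    have "g \<otimes>\<^bsub>G\<^esub> n = n \<otimes>\<^bsub>G\<^esub> g" if g: "g \<in> carrier G" for g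
    proof -
      have "b \<otimes>\<^bsub>G\<^esub> (g \<otimes>\<^bsub>G\<^esub> n) = (g \<otimes>\<^bsub>G\<^esub> b) \<otimes>\<^bsub>G\<^esub> n" using bb[OF g] c g by (simp add: G.m_assoc)
      also have "\<dots> = z \<otimes>\<^bsub>G\<^esub> g" using zz[OF g] c g by (simp add: zbn G.m_assoc)
      also have "\<dots> = b \<otimes>\<^bsub>G\<^esub> (n \<otimes>\<^bsub>G\<^esub> g)" using c g by (simp add: zbn G.m_assoc)
      finally show ?thesis using c g by simp
    qed
    then show ?thesis using c by (simp add: G.centre_def)
  qed
  have pow: "z [^]\<^bsub>G\<^esub> (k::nat) = b [^]\<^bsub>G\<^esub> k \<otimes>\<^bsub>G\<^esub> n [^]\<^bsub>G\<^esub> k" for k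
    unfolding zbn using c bb[of n] by (intro G.pow_mult_distrib) auto
  have b_ord: "b [^]\<^bsub>G\<^esub> (p ^ Suc l) = \<one>\<^bsub>G\<^esub>"
  proof -
    interpret hom: group_hom G "G\<lparr>carrier := B\<rparr>" \<pi>
      using \<pi>(1) B.subgroup_is_group[OF G.is_group] by (simp add: group_hom_def group_hom_axioms_def G.is_group)
    have "b [^]\<^bsub>G\<^esub> (p ^ Suc l) = \<pi> (z [^]\<^bsub>G\<^esub> (p ^ Suc l))"
      using hom.hom_nat_pow[OF zc, of "p ^ Suc l"] G.nat_pow_consistent[of b "p ^ Suc l" B] by (simp add: b_def)
    also have "\<dots> = \<one>\<^bsub>G\<^esub>" unfolding z(2) using hom.hom_one by simp
    finally show ?thesis .
  qed
  have "n [^]\<^bsub>G\<^esub> (p ^ Suc l) = \<one>\<^bsub>G\<^esub>" using pow[of "p ^ Suc l"] unfolding z(2) b_ord using c by simp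
  then have "n [^]\<^bsub>G\<^esub> (p ^ l) \<in> G.derived_powers (p ^ Suc l)"
    by (rule G.maximal_abelian_factor_no_split[OF finite_G prime_p max nN n_central])
  then have "\<phi> (n [^]\<^bsub>G\<^esub> (p ^ l)) = \<zero>" by (rule ft_derived_powers[OF \<phi>])
  moreover have "\<phi> (b [^]\<^bsub>G\<^esub> (p ^ l)) = \<zero>"
    by (rule frobenius_trace_abelian_factor[OF \<phi> B.subgroup_axioms coords vanish bB b_ord])
  ultimately show ?thesis using ft_add[OF \<phi> c] by (simp add: zbn)
qed

text \<open>
  The value is the sum of \<open>x z [^] (p ^ l) \<otimes> \<phi> (z [^] (p ^ l))\<close> over the centre. The second factor
  depends only on \<open>z [^] (p ^ Suc l)\<close> and is zero if this power is trivial. Over every other fibre of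
  \<open>z \<mapsto> z [^] (p ^ Suc l)\<close> the coefficients of \<open>x\<close> add up to zero.
\<close>

theorem frobenius_trace_vanishes:
  assumes \<phi>: "frobenius_trace l \<phi>"
    and max: "is_Ab_NAb G B N" and coords: "coordinates (G\<lparr>carrier := B\<rparr>) p t a e c"
    and vanish: "\<And>j. j < t \<Longrightarrow> e j = l \<Longrightarrow> \<phi> (a j [^]\<^bsub>G\<^esub> (p ^ l)) = \<zero>"
    and x: "x \<in> carrier A" and central: "\<And>h. h \<in> carrier G \<Longrightarrow> \<delta> h \<otimes>\<^bsub>A\<^esub> x = x \<otimes>\<^bsub>A\<^esub> \<delta> h"
    and x_ord: "x [^]\<^bsub>A\<^esub> (p ^ Suc l) = \<one>\<^bsub>A\<^esub>"
  shows "pair (x [^]\<^bsub>A\<^esub> (p ^ l)) \<phi> = \<zero>"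
proof -
  let ?Z = "G.centre" and ?q = "p ^ l" and ?P = "p ^ Suc l"
  have Z: "?Z \<subseteq> carrier G" by (auto simp: G.centre_def)
  then have finZ: "finite ?Z" using finite_G finite_subset by blast
  have conj: "x (h \<otimes>\<^bsub>G\<^esub> g \<otimes>\<^bsub>G\<^esub> inv\<^bsub>G\<^esub> h) = x g" if "h \<in> carrier G" "g \<in> carrier G" for h g
    by (rule central_coeff_conj[OF x central that])
  have conj_pow: "(h \<otimes>\<^bsub>G\<^esub> g \<otimes>\<^bsub>G\<^esub> inv\<^bsub>G\<^esub> h) [^]\<^bsub>G\<^esub> (k::nat) = h \<otimes>\<^bsub>G\<^esub> g [^]\<^bsub>G\<^esub> k \<otimes>\<^bsub>G\<^esub> inv\<^bsub>G\<^esub> h"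
    if "h \<in> carrier G" "g \<in> carrier G" for h g k
  proof (induction k)
    case (Suc k)
    have "inv\<^bsub>G\<^esub> h \<otimes>\<^bsub>G\<^esub> (h \<otimes>\<^bsub>G\<^esub> (g \<otimes>\<^bsub>G\<^esub> inv\<^bsub>G\<^esub> h)) = g \<otimes>\<^bsub>G\<^esub> inv\<^bsub>G\<^esub> h"
      using that by (simp add: G.m_assoc[symmetric])
    then show ?case using Suc that by (simp add: G.m_assoc)
  qed (use that in simp)
  have tr_conj: "\<psi> (h \<otimes>\<^bsub>G\<^esub> g \<otimes>\<^bsub>G\<^esub> inv\<^bsub>G\<^esub> h) = \<psi> g"
    if tr: "\<And>a b. a \<in> carrier G \<Longrightarrow> b \<in> carrier G \<Longrightarrow> \<psi> (a \<otimes>\<^bsub>G\<^esub> b) = \<psi> (b \<otimes>\<^bsub>G\<^esub> a)"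
      and hg: "h \<in> carrier G" "g \<in> carrier G" for \<psi> :: "'g \<Rightarrow> 'k" and h g
    using tr[of "h \<otimes>\<^bsub>G\<^esub> g" "inv\<^bsub>G\<^esub> h"] hg by (simp add: G.m_assoc[symmetric])
  have centre_sum: "pair (x [^]\<^bsub>A\<^esub> (p ^ m)) \<psi> = (\<Oplus>z\<in>?Z. x z [^] (p ^ m) \<otimes> \<psi> (z [^]\<^bsub>G\<^esub> (p ^ m)))"
    if \<psi>: "\<psi> \<in> carrier G \<rightarrow> carrier K"
      and tr: "\<And>a b. a \<in> carrier G \<Longrightarrow> b \<in> carrier G \<Longrightarrow> \<psi> (a \<otimes>\<^bsub>G\<^esub> b) = \<psi> (b \<otimes>\<^bsub>G\<^esub> a)" for m \<psi>
  proof -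
    have "pair (x [^]\<^bsub>A\<^esub> (p ^ m)) \<psi> = (\<Oplus>g\<in>carrier G. x g [^] (p ^ m) \<otimes> \<psi> (g [^]\<^bsub>G\<^esub> (p ^ m)))"
      by (rule trace_frobenius[OF x \<psi> tr])
    also have "\<dots> = (\<Oplus>z\<in>?Z. x z [^] (p ^ m) \<otimes> \<psi> (z [^]\<^bsub>G\<^esub> (p ^ m)))"
      using \<psi> x by (intro finsum_class_function) (auto simp: conj conj_pow tr_conj[of \<psi>, OF tr] Pi_iff)
    finally show ?thesis .
  qed
  \<comment> \<open>The coefficient at a central element \<open>w\<close> is a trace, so \<open>centre_sum\<close> applies to it: the
    \<open>p ^ Suc l\<close>-th power of the sum is the coefficient of \<open>\<one>\<close> at \<open>w\<close>.\<close>
  have fibre: "(\<Oplus>z\<in>{z \<in> ?Z. z [^]\<^bsub>G\<^esub> ?P = w}. x z) = \<zero>" if w: "w \<in> ?Z" "w \<noteq> \<one>\<^bsub>G\<^esub>" for w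
  proof -
    let ?F = "{z \<in> ?Z. z [^]\<^bsub>G\<^esub> ?P = w}"
    have wc: "w \<in> carrier G" and ww: "\<And>g. g \<in> carrier G \<Longrightarrow> g \<otimes>\<^bsub>G\<^esub> w = w \<otimes>\<^bsub>G\<^esub> g"
      using w by (auto simp: G.centre_def)
    have \<delta>w: "\<delta> w \<in> carrier G \<rightarrow> carrier K" by (auto simp: \<delta>_def)
    have swap: "b \<otimes>\<^bsub>G\<^esub> a = w" if "a \<otimes>\<^bsub>G\<^esub> b = w" "a \<in> carrier G" "b \<in> carrier G" for a b
    proof -
      have "a \<otimes>\<^bsub>G\<^esub> (b \<otimes>\<^bsub>G\<^esub> a) = a \<otimes>\<^bsub>G\<^esub> w" using that ww[OF that(2)] by (simp add: G.m_assoc[symmetric])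
      then show ?thesis using that wc by simp
    qed
    have tr: "\<delta> w (a \<otimes>\<^bsub>G\<^esub> b) = \<delta> w (b \<otimes>\<^bsub>G\<^esub> a)" if "a \<in> carrier G" "b \<in> carrier G" for a b
      using swap[of a b] swap[of b a] that by (auto simp: \<delta>_def)
    have zero: "pair (x [^]\<^bsub>A\<^esub> ?P) (\<delta> w) = \<zero>"
      unfolding x_ord one_A using w wc \<delta>w by (subst pair_delta) (auto simp: \<delta>_def)
    have xz: "x z \<in> carrier K" if "z \<in> ?Z" for z using that Z x by auto
    have "(\<Oplus>z\<in>?Z. x z [^] ?P \<otimes> \<delta> w (z [^]\<^bsub>G\<^esub> ?P)) = (\<Oplus>z\<in>?F. x z [^] ?P \<otimes> \<delta> w (z [^]\<^bsub>G\<^esub> ?P))"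
      using finZ xz Z \<delta>w by (intro add.finprod_mono_neutral_cong_right) (auto simp: \<delta>_def simp del: power_Suc)
    also have "\<dots> = (\<Oplus>z\<in>?F. x z [^] ?P)"
      using xz wc by (intro finsum_cong') (auto simp: \<delta>_def simp del: power_Suc)
    also have "\<dots> = (\<Oplus>z\<in>?F. x z) [^] ?P"
      using xz finZ by (intro finsum_frobenius[symmetric]) auto
    finally have "(\<Oplus>z\<in>?F. x z) [^] ?P = \<zero>" using zero centre_sum[OF \<delta>w tr, of "Suc l"] by simp
    moreover have "(\<Oplus>z\<in>?F. x z) \<in> carrier K" using xz by (auto intro!: finsum_closed)
    ultimately show ?thesis by (rule nat_pow_eq_zero_imp[rotated])
  qed
  define d where "d g = \<phi> (g [^]\<^bsub>G\<^esub> ?q)" for g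
  have d: "d g \<in> carrier K" if "g \<in> carrier G" for g using that ft_closed[OF \<phi>] by (simp add: d_def)
  have d_central: "d z = \<zero>" if "z \<in> ?Z" "z [^]\<^bsub>G\<^esub> ?P = \<one>\<^bsub>G\<^esub>" for z
    unfolding d_def by (rule frobenius_trace_central[OF \<phi> max coords vanish that])
  have d_fibre: "d z = d r" if zr: "z \<in> ?Z" "r \<in> ?Z" "z [^]\<^bsub>G\<^esub> ?P = r [^]\<^bsub>G\<^esub> ?P" for z r
  proof -
    have c: "z \<in> carrier G" "r \<in> carrier G" and rr: "\<And>g. g \<in> carrier G \<Longrightarrow> g \<otimes>\<^bsub>G\<^esub> r = r \<otimes>\<^bsub>G\<^esub> g"
      and zz: "\<And>g. g \<in> carrier G \<Longrightarrow> g \<otimes>\<^bsub>G\<^esub> z = z \<otimes>\<^bsub>G\<^esub> g"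
      using zr by (auto simp: G.centre_def)
    define u where "u = z \<otimes>\<^bsub>G\<^esub> inv\<^bsub>G\<^esub> r"
    have u: "u \<in> carrier G" "z = u \<otimes>\<^bsub>G\<^esub> r" using c by (simp_all add: u_def G.m_assoc)
    have "u [^]\<^bsub>G\<^esub> ?P \<otimes>\<^bsub>G\<^esub> r [^]\<^bsub>G\<^esub> ?P = z [^]\<^bsub>G\<^esub> ?P"
      unfolding u(2) using u c rr[of u] by (intro G.pow_mult_distrib[symmetric]) auto
    then have "u [^]\<^bsub>G\<^esub> ?P \<otimes>\<^bsub>G\<^esub> r [^]\<^bsub>G\<^esub> ?P = \<one>\<^bsub>G\<^esub> \<otimes>\<^bsub>G\<^esub> r [^]\<^bsub>G\<^esub> ?P"
      unfolding zr(3) using c(2) by (simp only: G.l_one G.nat_pow_closed)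
    then have u_ord: "u [^]\<^bsub>G\<^esub> ?P = \<one>\<^bsub>G\<^esub>"
      using u(1) c(2) by (simp only: G.right_cancel G.nat_pow_closed G.one_closed)
    have u_central: "u \<in> ?Z"
    proof -
      have "g \<otimes>\<^bsub>G\<^esub> u = u \<otimes>\<^bsub>G\<^esub> g" if g: "g \<in> carrier G" for g
      proof -
        have "(g \<otimes>\<^bsub>G\<^esub> u) \<otimes>\<^bsub>G\<^esub> r = g \<otimes>\<^bsub>G\<^esub> z" using g u c by (simp add: G.m_assoc)
        also have "\<dots> = z \<otimes>\<^bsub>G\<^esub> g" by (rule zz[OF g])
        also have "\<dots> = u \<otimes>\<^bsub>G\<^esub> (r \<otimes>\<^bsub>G\<^esub> g)" using g u c by (simp add: G.m_assoc)
        also have "\<dots> = (u \<otimes>\<^bsub>G\<^esub> g) \<otimes>\<^bsub>G\<^esub> r" unfolding rr[OF g, symmetric] using g u c by (simp add: G.m_assoc)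
        finally show ?thesis using g u(1) c by simp
      qed
      then show ?thesis using u(1) by (simp add: G.centre_def)
    qed
    have "d z = d u \<oplus> d r" unfolding u(2) d_def using ft_add[OF \<phi> u(1) c(2)] .
    then show ?thesis using d_central[OF u_central u_ord] d[OF c(2)] by simp
  qed
  have xz: "x z \<in> carrier K" if "z \<in> ?Z" for z using that Z x by auto
  have dz: "d z \<in> carrier K" if "z \<in> ?Z" for z using that Z d by auto
  let ?h = "\<lambda>z. z [^]\<^bsub>G\<^esub> ?P"
  have "pair (x [^]\<^bsub>A\<^esub> ?q) \<phi> = (\<Oplus>z\<in>?Z. x z [^] ?q \<otimes> d z)"
    unfolding d_def using ft_closed[OF \<phi>] ft_trace[OF \<phi>] by (intro centre_sum) auto
  also have "\<dots> = (\<Oplus>w\<in>?h ` ?Z. \<Oplus>z\<in>{z \<in> ?Z. ?h z = w}. x z [^] ?q \<otimes> d z)"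
    using finZ xz dz by (intro finsum_fibres) auto
  also have "\<dots> = (\<Oplus>w\<in>?h ` ?Z. \<zero>)"
  proof (rule finsum_cong')
    fix w assume "w \<in> ?h ` ?Z"
    then obtain r where r: "r \<in> ?Z" "w = ?h r" by blast
    let ?F = "{z \<in> ?Z. ?h z = w}"
    show "(\<Oplus>z\<in>?F. x z [^] ?q \<otimes> d z) = \<zero>"
    proof (cases "w = \<one>\<^bsub>G\<^esub>")
      case True
      have "(\<Oplus>z\<in>?F. x z [^] ?q \<otimes> d z) = (\<Oplus>z\<in>?F. \<zero>)"
        using xz d_central True by (intro finsum_cong') auto
      then show ?thesis by (simp add: finsum_zero)
    next
      case False
      have "w \<in> ?Z"
      proof -
        have "g \<otimes>\<^bsub>G\<^esub> w = w \<otimes>\<^bsub>G\<^esub> g" if "g \<in> carrier G" for g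
          unfolding r(2) by (rule G.centre_pow_commute[OF r(1) that])
        moreover have "w \<in> carrier G" unfolding r(2) using r(1) Z by (intro G.nat_pow_closed) blast
        ultimately show ?thesis by (simp add: G.centre_def)
      qed
      have "(\<Oplus>z\<in>?F. x z [^] ?q \<otimes> d z) = (\<Oplus>z\<in>?F. x z [^] ?q \<otimes> d r)"
      proof (rule finsum_cong')
        fix z assume "z \<in> ?F"
        then have "d z = d r" using r by (intro d_fibre) auto
        then show "x z [^] ?q \<otimes> d z = x z [^] ?q \<otimes> d r" by simp
      qed (use xz dz[OF r(1)] in auto)
      also have "\<dots> = (\<Oplus>z\<in>?F. x z [^] ?q) \<otimes> d r"
        using xz dz[OF r(1)] finZ by (intro finsum_ldistr[symmetric]) auto
      also have "(\<Oplus>z\<in>?F. x z [^] ?q) = (\<Oplus>z\<in>?F. x z) [^] ?q"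
        using xz finZ by (intro finsum_frobenius[symmetric]) auto
      also have "\<dots> = \<zero>"
        unfolding fibre[OF \<open>w \<in> ?Z\<close> False] using prime_gt_0_nat[OF prime_p] by (intro nat_pow_zero) simp
      finally show ?thesis using dz[OF r(1)] by simp
    qed
  qed auto
  finally show ?thesis by (simp add: finsum_zero)
qed

end

section \<open>Functionals dual to the generators of the abelian factor\<close>

lemma div_prime_power_cong:
  fixes a b :: nat
  assumes "[a = b] (mod p ^ Suc l)"
  shows "[a div p ^ l = b div p ^ l] (mod p)"
proof (cases "p = 0")
  case False
  then have pos: "p ^ l > 0" by simp
  have "a div p ^ l mod p = (a mod (p ^ l * p)) div p ^ l" for a
    using pos by (simp add: mod_mult2_eq)
  then show ?thesis using assms by (simp add: cong_def mult.commute)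
qed (use assms in \<open>cases l; simp add: cong_def\<close>)

context modular_group_algebra
begin

text \<open>
  On \<open>p ^ l\<close>-th powers, the coordinate \<open>c i\<close> is a multiple of \<open>p ^ l\<close> modulo \<open>p ^ Suc l\<close>, and the
  quotient is a well-defined residue modulo \<open>p\<close>. Rounding down extends the quotient to a function of the
  coordinate on the whole group.
\<close>

lemma coordinate_frobenius_trace:
  assumes \<pi>: "\<pi> \<in> hom G (G\<lparr>carrier := B\<rparr>)" and coords: "coordinates (G\<lparr>carrier := B\<rparr>) p t a e c"
    and i: "i < t" "e i = l"
  defines "\<chi> \<equiv> \<lambda>g. add_pow K (c i (\<pi> g) div p ^ l) \<one>"
  shows "frobenius_trace l \<chi>"
    and "g \<in> carrier G \<Longrightarrow> \<chi> (g [^]\<^bsub>G\<^esub> (p ^ l)) = add_pow K (c i (\<pi> g)) \<one>"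
proof -
  let ?B = "G\<lparr>carrier := B\<rparr>"
  interpret C: coordinates ?B p t a e c by fact
  interpret hom: group_hom G ?B \<pi>
    using \<pi> by (simp add: group_hom_def group_hom_axioms_def G.is_group C.is_group)
  show pw: "\<chi> (g [^]\<^bsub>G\<^esub> (p ^ l)) = add_pow K (c i (\<pi> g)) \<one>" if g: "g \<in> carrier G" for g
  proof -
    have "\<pi> g \<in> B" using hom.hom_closed[OF g] by simp
    then have "[c i (\<pi> (g [^]\<^bsub>G\<^esub> (p ^ l))) = p ^ l * c i (\<pi> g)] (mod p ^ Suc l)"
      using C.coord_pow[OF i(1), of "\<pi> g" "p ^ l"] g i(2) by (simp add: hom.hom_nat_pow)
    then have "[c i (\<pi> (g [^]\<^bsub>G\<^esub> (p ^ l))) div p ^ l = p ^ l * c i (\<pi> g) div p ^ l] (mod p)"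
      by (rule div_prime_power_cong)
    then have "[c i (\<pi> (g [^]\<^bsub>G\<^esub> (p ^ l))) div p ^ l = c i (\<pi> g)] (mod p)"
      using prime_gt_0_nat[OF prime_p] by simp
    then show ?thesis unfolding \<chi>_def by (rule add_pow_one_cong)
  qed
  show "frobenius_trace l \<chi>"
    unfolding frobenius_trace_def
  proof (intro conjI ballI)
    show "\<chi> \<in> carrier G \<rightarrow> carrier K" by (simp add: \<chi>_def)
    fix a b assume ab: "a \<in> carrier G" "b \<in> carrier G"
    show "\<chi> (a \<otimes>\<^bsub>G\<^esub> b \<otimes>\<^bsub>G\<^esub> w) = \<chi> (b \<otimes>\<^bsub>G\<^esub> a \<otimes>\<^bsub>G\<^esub> w)" if w: "w \<in> carrier G" for w
    proof -
      have "\<pi> (a \<otimes>\<^bsub>G\<^esub> b) = \<pi> (b \<otimes>\<^bsub>G\<^esub> a)"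
        using ab C.m_comm[of "\<pi> a" "\<pi> b"] hom.hom_closed by (simp only: hom.hom_mult)
      then have "\<pi> (a \<otimes>\<^bsub>G\<^esub> b \<otimes>\<^bsub>G\<^esub> w) = \<pi> (b \<otimes>\<^bsub>G\<^esub> a \<otimes>\<^bsub>G\<^esub> w)"
        using ab w by (simp only: hom.hom_mult G.m_closed)
      then show ?thesis by (simp add: \<chi>_def)
    qed
    have "[c i (\<pi> (a \<otimes>\<^bsub>G\<^esub> b)) = c i (\<pi> a) + c i (\<pi> b)] (mod p ^ Suc l)"
      using C.coord_mult[OF i(1), of "\<pi> a" "\<pi> b"] ab i(2) hom.hom_closed by (simp only: hom.hom_mult)
    then have "[c i (\<pi> (a \<otimes>\<^bsub>G\<^esub> b)) = c i (\<pi> a) + c i (\<pi> b)] (mod p)"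
      by (rule cong_dvd_modulus_nat) simp
    then have "add_pow K (c i (\<pi> (a \<otimes>\<^bsub>G\<^esub> b))) \<one> = add_pow K (c i (\<pi> a)) \<one> \<oplus> add_pow K (c i (\<pi> b)) \<one>"
      using add_pow_one_cong add.nat_pow_mult[of \<one>] by simp
    then show "\<chi> ((a \<otimes>\<^bsub>G\<^esub> b) [^]\<^bsub>G\<^esub> (p ^ l)) = \<chi> (a [^]\<^bsub>G\<^esub> (p ^ l)) \<oplus> \<chi> (b [^]\<^bsub>G\<^esub> (p ^ l))"
      using pw ab by simp
  qed
qed

lemma frobenius_trace_lincomb:
  assumes I: "finite I" and v: "v \<in> I \<rightarrow> carrier K"
    and \<Phi>: "\<And>i. i \<in> I \<Longrightarrow> frobenius_trace l (\<Phi> i)"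
  shows "frobenius_trace l (\<lambda>g. \<Oplus>i\<in>I. v i \<otimes> \<Phi> i g)"
    and "f \<in> carrier A \<Longrightarrow> pair f (\<lambda>g. \<Oplus>i\<in>I. v i \<otimes> \<Phi> i g) = (\<Oplus>i\<in>I. pair f (\<Phi> i) \<otimes> v i)"
proof -
  have vc: "v i \<in> carrier K" if "i \<in> I" for i using v that by auto
  have \<Phi>c: "\<Phi> i g \<in> carrier K" if "i \<in> I" "g \<in> carrier G" for i g using ft_closed[OF \<Phi>] that .
  show "frobenius_trace l (\<lambda>g. \<Oplus>i\<in>I. v i \<otimes> \<Phi> i g)"
    unfolding frobenius_trace_def
  proof (intro conjI ballI)
    show "(\<lambda>g. \<Oplus>i\<in>I. v i \<otimes> \<Phi> i g) \<in> carrier G \<rightarrow> carrier K" using vc \<Phi>c by (auto intro!: finsum_closed)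
    fix a b assume ab: "a \<in> carrier G" "b \<in> carrier G"
    show "(\<Oplus>i\<in>I. v i \<otimes> \<Phi> i (a \<otimes>\<^bsub>G\<^esub> b \<otimes>\<^bsub>G\<^esub> w)) = (\<Oplus>i\<in>I. v i \<otimes> \<Phi> i (b \<otimes>\<^bsub>G\<^esub> a \<otimes>\<^bsub>G\<^esub> w))"
      if "w \<in> carrier G" for w
      using ab that vc \<Phi>c by (intro finsum_cong') (auto simp: ft_swap[OF \<Phi>])
    have "(\<Oplus>i\<in>I. v i \<otimes> \<Phi> i ((a \<otimes>\<^bsub>G\<^esub> b) [^]\<^bsub>G\<^esub> (p ^ l))) =
        (\<Oplus>i\<in>I. v i \<otimes> \<Phi> i (a [^]\<^bsub>G\<^esub> (p ^ l)) \<oplus> v i \<otimes> \<Phi> i (b [^]\<^bsub>G\<^esub> (p ^ l)))"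
      using ab vc \<Phi>c by (intro finsum_cong') (auto simp: ft_add[OF \<Phi>] r_distr)
    then show "(\<Oplus>i\<in>I. v i \<otimes> \<Phi> i ((a \<otimes>\<^bsub>G\<^esub> b) [^]\<^bsub>G\<^esub> (p ^ l))) =
        (\<Oplus>i\<in>I. v i \<otimes> \<Phi> i (a [^]\<^bsub>G\<^esub> (p ^ l))) \<oplus> (\<Oplus>i\<in>I. v i \<otimes> \<Phi> i (b [^]\<^bsub>G\<^esub> (p ^ l)))"
      using ab vc \<Phi>c by (simp add: finsum_addf Pi_iff)
  qed
  show "pair f (\<lambda>g. \<Oplus>i\<in>I. v i \<otimes> \<Phi> i g) = (\<Oplus>i\<in>I. pair f (\<Phi> i) \<otimes> v i)" if f: "f \<in> carrier A"
  proof -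
    have "pair f (\<lambda>g. \<Oplus>i\<in>I. v i \<otimes> \<Phi> i g) = (\<Oplus>g\<in>carrier G. \<Oplus>i\<in>I. f g \<otimes> (v i \<otimes> \<Phi> i g))"
      unfolding pair_def using f vc \<Phi>c I by (intro finsum_cong' finsum_rdistr) (auto intro!: finsum_closed)
    also have "\<dots> = (\<Oplus>i\<in>I. \<Oplus>g\<in>carrier G. f g \<otimes> (v i \<otimes> \<Phi> i g))"
      using f vc \<Phi>c I finite_G by (intro finsum_swap) auto
    also have "\<dots> = (\<Oplus>i\<in>I. pair f (\<Phi> i) \<otimes> v i)"
    proof (rule finsum_cong')
      fix i assume i: "i \<in> I"
      have "(\<Oplus>g\<in>carrier G. f g \<otimes> (v i \<otimes> \<Phi> i g)) = (\<Oplus>g\<in>carrier G. f g \<otimes> \<Phi> i g \<otimes> v i)"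
        using f vc[OF i] \<Phi>c[OF i] by (intro finsum_cong') (auto simp: m_ac)
      then show "(\<Oplus>g\<in>carrier G. f g \<otimes> (v i \<otimes> \<Phi> i g)) = pair f (\<Phi> i) \<otimes> v i"
        unfolding pair_def using f vc[OF i] \<Phi>c[OF i] finite_G by (simp add: finsum_ldistr Pi_iff)
    qed (use f vc \<Phi>c in auto)
    finally show ?thesis .
  qed
qed

lemma delta_central:
  assumes z: "z \<in> G.centre" and f: "f \<in> carrier A"
  shows "\<delta> z \<otimes>\<^bsub>A\<^esub> f = f \<otimes>\<^bsub>A\<^esub> \<delta> z"
proof (rule algebra_eqI)
  have zc: "z \<in> carrier G" using z by (simp add: G.centre_def)
  fix \<psi> assume \<psi>: "\<psi> \<in> carrier G \<rightarrow> carrier K"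
  have \<psi>': "\<psi> g \<in> carrier K" if "g \<in> carrier G" for g using \<psi> that by auto
  have "pair (\<delta> z \<otimes>\<^bsub>A\<^esub> f) \<psi> = pair f (\<lambda>b. \<psi> (z \<otimes>\<^bsub>G\<^esub> b))"
    using zc f \<psi> by (simp add: pair_mult pair_delta Pi_iff)
  also have "\<dots> = pair f (\<lambda>a. pair (\<delta> z) (\<lambda>b. \<psi> (a \<otimes>\<^bsub>G\<^esub> b)))"
  proof (rule pair_cong)
    fix g assume g: "g \<in> carrier G"
    have "pair (\<delta> z) (\<lambda>b. \<psi> (g \<otimes>\<^bsub>G\<^esub> b)) = \<psi> (g \<otimes>\<^bsub>G\<^esub> z)"
      using zc g \<psi>' by (intro pair_delta) auto
    then show "\<psi> (z \<otimes>\<^bsub>G\<^esub> g) = pair (\<delta> z) (\<lambda>b. \<psi> (g \<otimes>\<^bsub>G\<^esub> b))"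
      using z g by (simp add: G.centre_def)
  qed (use f \<psi>' zc in auto)
  also have "\<dots> = pair (f \<otimes>\<^bsub>A\<^esub> \<delta> z) \<psi>" using f \<psi> by (simp add: pair_mult)
  finally show "pair (\<delta> z \<otimes>\<^bsub>A\<^esub> f) \<psi> = pair (f \<otimes>\<^bsub>A\<^esub> \<delta> z) \<psi>" .
qed (use f in auto)

end

section \<open>Comparing two groups with isomorphic group algebras\<close>

text \<open>
  Gaussian elimination, one equation at a time.
\<close>

lemma (in field) underdetermined_system:
  assumes "finite J" "finite I" "card J < card I"
    and "\<And>j i. j \<in> J \<Longrightarrow> i \<in> I \<Longrightarrow> M j i \<in> carrier R"
  shows "\<exists>v\<in>I \<rightarrow> carrier R. (\<exists>i\<in>I. v i \<noteq> \<zero>) \<and> (\<forall>j\<in>J. (\<Oplus>i\<in>I. M j i \<otimes> v i) = \<zero>)"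
  using assms
proof (induction J arbitrary: I M rule: finite_induct)
  case empty
  then obtain i where "i \<in> I" by fastforce
  then show ?case by (intro bexI[of _ "\<lambda>_. \<one>"]) auto
next
  case (insert j\<^sub>0 J)
  have Mc: "M j i \<in> carrier R" if "j \<in> insert j\<^sub>0 J" "i \<in> I" for j i using insert.prems(3) that by blast
  show ?case
  proof (cases "\<forall>i\<in>I. M j\<^sub>0 i = \<zero>")
    case True
    have "card J < card I" using insert by simp
    then obtain v where v: "v \<in> I \<rightarrow> carrier R" "\<exists>i\<in>I. v i \<noteq> \<zero>" "\<forall>j\<in>J. (\<Oplus>i\<in>I. M j i \<otimes> v i) = \<zero>"
      using insert.IH[of I M] insert.prems(1) Mc by blast
    have "(\<Oplus>i\<in>I. M j\<^sub>0 i \<otimes> v i) = (\<Oplus>i\<in>I. \<zero>)"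
      using True v(1) by (intro finsum_cong') (auto simp: Pi_iff)
    then show ?thesis using v by (auto simp: finsum_zero)
  next
    case False
    then obtain i\<^sub>0 where i\<^sub>0: "i\<^sub>0 \<in> I" "M j\<^sub>0 i\<^sub>0 \<noteq> \<zero>" by blast
    define I' where "I' = I - {i\<^sub>0}"
    have I: "I = insert i\<^sub>0 I'" "i\<^sub>0 \<notin> I'" "finite I'" using i\<^sub>0 insert.prems(1) by (auto simp: I'_def)
    define u where "u = inv (M j\<^sub>0 i\<^sub>0)"
    have u: "u \<in> carrier R" "M j\<^sub>0 i\<^sub>0 \<otimes> u = \<one>"
      using i\<^sub>0 Mc[of j\<^sub>0 i\<^sub>0] field_Units by (auto simp: u_def)
    define M' where "M' j i = M j i \<ominus> (M j i\<^sub>0 \<otimes> u) \<otimes> M j\<^sub>0 i" for j i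
    have "card J < card I'" using insert I by simp
    moreover have "M' j i \<in> carrier R" if "j \<in> J" "i \<in> I'" for j i
      using that Mc u i\<^sub>0 I by (auto simp: M'_def)
    ultimately obtain v where v: "v \<in> I' \<rightarrow> carrier R" "\<exists>i\<in>I'. v i \<noteq> \<zero>"
      and sol: "\<forall>j\<in>J. (\<Oplus>i\<in>I'. M' j i \<otimes> v i) = \<zero>"
      using insert.IH[of I' M'] I(3) by blast
    have vc: "v i \<in> carrier R" if "i \<in> I'" for i using v(1) that by blast
    have Mc': "M j i \<in> carrier R" if "j \<in> insert j\<^sub>0 J" "i \<in> I'" for j i using Mc that I(1) by blast
    define s where "s = (\<Oplus>i\<in>I'. M j\<^sub>0 i \<otimes> v i)"
    have s: "s \<in> carrier R" unfolding s_def using Mc' vc by (auto intro!: finsum_closed)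
    define w where "w = v(i\<^sub>0 := \<ominus> (u \<otimes> s))"
    have wsum: "(\<Oplus>i\<in>I. M j i \<otimes> w i) = M j i\<^sub>0 \<otimes> (\<ominus> (u \<otimes> s)) \<oplus> (\<Oplus>i\<in>I'. M j i \<otimes> v i)"
      if j: "j \<in> insert j\<^sub>0 J" for j
    proof -
      have "(\<Oplus>i\<in>I. M j i \<otimes> w i) = M j i\<^sub>0 \<otimes> w i\<^sub>0 \<oplus> (\<Oplus>i\<in>I'. M j i \<otimes> w i)"
        unfolding I(1) using I(2,3) Mc'[OF j] Mc[OF j i\<^sub>0(1)] vc u(1) s
        by (intro finsum_insert) (auto simp: w_def)
      also have "(\<Oplus>i\<in>I'. M j i \<otimes> w i) = (\<Oplus>i\<in>I'. M j i \<otimes> v i)"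
        using I(2) Mc'[OF j] vc by (intro finsum_cong') (auto simp: w_def)
      finally show ?thesis by (simp add: w_def)
    qed
    have "(\<Oplus>i\<in>I. M j i \<otimes> w i) = \<zero>" if j: "j \<in> insert j\<^sub>0 J" for j
    proof (cases "j = j\<^sub>0")
      case True
      have "M j\<^sub>0 i\<^sub>0 \<otimes> (\<ominus> (u \<otimes> s)) = \<ominus> ((M j\<^sub>0 i\<^sub>0 \<otimes> u) \<otimes> s)"
        using Mc[of j\<^sub>0 i\<^sub>0] i\<^sub>0 u(1) s by (simp add: r_minus m_assoc)
      then show ?thesis using wsum[OF j] True s u(2) by (simp add: s_def[symmetric] l_neg)
    next
      case False
      then have jJ: "j \<in> J" using j by simp
      define k where "k = M j i\<^sub>0 \<otimes> u"
      have k: "k \<in> carrier R" using Mc[OF j i\<^sub>0(1)] u(1) by (simp add: k_def)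
      have "\<zero> = (\<Oplus>i\<in>I'. M' j i \<otimes> v i)" using sol jJ by simp
      also have "\<dots> = (\<Oplus>i\<in>I'. M j i \<otimes> v i \<oplus> \<ominus> k \<otimes> (M j\<^sub>0 i \<otimes> v i))"
        using Mc' j vc k by (intro finsum_cong') (auto simp: M'_def k_def[symmetric] a_minus_def l_distr l_minus m_assoc)
      also have "\<dots> = (\<Oplus>i\<in>I'. M j i \<otimes> v i) \<oplus> \<ominus> k \<otimes> s"
        unfolding s_def using Mc' j vc k I(3) by (simp add: finsum_addf finsum_rdistr Pi_iff)
      finally have "(\<Oplus>i\<in>I'. M j i \<otimes> v i) \<oplus> \<ominus> k \<otimes> s = \<zero>" by simp
      moreover have "M j i\<^sub>0 \<otimes> (\<ominus> (u \<otimes> s)) = \<ominus> k \<otimes> s"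
        using Mc[OF j i\<^sub>0(1)] u(1) s by (simp add: k_def r_minus l_minus m_assoc)
      moreover have "(\<Oplus>i\<in>I'. M j i \<otimes> v i) \<in> carrier R" using Mc' j vc by (auto intro!: finsum_closed)
      ultimately show ?thesis using wsum[OF j] k s by (simp add: a_comm)
    qed
    moreover have "w \<in> I \<rightarrow> carrier R" using vc u(1) s I(1) by (auto simp: w_def)
    moreover have "\<exists>i\<in>I. w i \<noteq> \<zero>" using v(2) I(1,2) by (auto simp: w_def)
    ultimately show ?thesis by blast
  qed
qed

text \<open>
  The multiples of \<open>\<one>\<close> that vanish are those divisible by its additive order, so their gcd is
  this order and vanishes itself.
\<close>

lemma char_p_field_if_characteristic:
  fixes K :: "('k, 'r) ring_scheme"
  assumes p: "Factorial_Ring.prime p" and K: "field K" and char: "characteristic K = p"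
  shows "char_p_field K p"
proof -
  interpret K: field K by fact
  let ?o = "group.ord (add_monoid K) \<one>\<^bsub>K\<^esub>"
  have ord: "add_pow K n \<one>\<^bsub>K\<^esub> = \<zero>\<^bsub>K\<^esub> \<longleftrightarrow> ?o dvd n" for n :: nat
    using group.pow_eq_id[OF K.a_group, of "\<one>\<^bsub>K\<^esub>" n] by (simp add: add_pow_def)
  have "Gcd {n. ?o dvd n} = ?o" by (rule dvd_antisym) (auto intro!: Gcd_greatest Gcd_dvd)
  then have "p = ?o" using char by (simp add: characteristic_def ord)
  then have "add_pow K p \<one>\<^bsub>K\<^esub> = \<zero>\<^bsub>K\<^esub>" using ord[of p] by simp
  then show ?thesis using p by unfold_locales
qed

lemma modular_group_algebra_if_p_group:
  assumes "char_p_field K p" and "finite_p_group p G"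
  shows "modular_group_algebra K p G"
  using assms by (simp add: finite_p_group_def modular_group_algebra_def modular_group_algebra_axioms_def)

context modular_group_algebra
begin

lemma abelian_factor_finite:
  assumes "is_Ab_NAb G B N"
  shows "finite B"
proof -
  have "B \<lhd> G" using assms by (simp add: is_Ab_NAb_def abelian_decomposition_def internal_direct_product_def)
  then have "B \<subseteq> carrier G" by (intro subgroup.subset normal_imp_subgroup)
  then show ?thesis using finite_G finite_subset by blast
qed

lemma abelian_factor_coordinates:
  assumes "is_Ab_NAb G B N"
  shows "\<exists>t a e c. coordinates (G\<lparr>carrier := B\<rparr>) p t a e c"
proof -
  have "B \<lhd> G" and ab: "comm_group (G\<lparr>carrier := B\<rparr>)"
    using assms by (simp_all add: is_Ab_NAb_def abelian_decomposition_def internal_direct_product_def)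
  then have "subgroup B G" by (intro normal_imp_subgroup)
  then have "card B dvd order G" using G.lagrange by (metis dvd_triv_right)
  then obtain m where "card B = p ^ m"
    using order_G divides_primepow_nat[OF prime_p] by auto
  then show ?thesis
    using finite_abelian_p_group_coordinates[OF prime_p ab] abelian_factor_finite[OF assms]
    by (simp add: order_def)
qed

end

locale modular_group_algebra_iso =
  G: modular_group_algebra K p G + H: modular_group_algebra K p H
  for K :: "('k, 'r) ring_scheme" (structure) and p
    and G :: "('g, 'm) monoid_scheme" and H :: "('h, 'n) monoid_scheme" +
  fixes F :: "('g \<Rightarrow> 'k) \<Rightarrow> 'h \<Rightarrow> 'k"
  assumes F: "F \<in> algebra_iso K (group_algebra K G) (group_algebra K H)"
begin

definition F' :: "('h \<Rightarrow> 'k) \<Rightarrow> 'g \<Rightarrow> 'k"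
  where "F' = inv_into (carrier G.A) F"

lemma F_closed: "x \<in> carrier G.A \<Longrightarrow> F x \<in> carrier H.A"
  and F_mult: "x \<in> carrier G.A \<Longrightarrow> y \<in> carrier G.A \<Longrightarrow> F (x \<otimes>\<^bsub>G.A\<^esub> y) = F x \<otimes>\<^bsub>H.A\<^esub> F y"
  and F_add: "x \<in> carrier G.A \<Longrightarrow> y \<in> carrier G.A \<Longrightarrow> F (x \<oplus>\<^bsub>G.A\<^esub> y) = F x \<oplus>\<^bsub>H.A\<^esub> F y"
  and F_one: "F \<one>\<^bsub>G.A\<^esub> = \<one>\<^bsub>H.A\<^esub>"
  and F_smult: "k \<in> carrier K \<Longrightarrow> x \<in> carrier G.A \<Longrightarrow> F (k \<odot>\<^bsub>G.A\<^esub> x) = k \<odot>\<^bsub>H.A\<^esub> F x"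
  and F_bij: "bij_betw F (carrier G.A) (carrier H.A)"
  using F by (auto simp: algebra_iso_def ring_iso_def ring_hom_def)

lemma F'_closed: "y \<in> carrier H.A \<Longrightarrow> F' y \<in> carrier G.A"
  and F_F': "y \<in> carrier H.A \<Longrightarrow> F (F' y) = y"
  using F_bij by (auto simp: F'_def bij_betw_def inv_into_into f_inv_into_f)

lemma F'_eqI: "x \<in> carrier G.A \<Longrightarrow> F x = y \<Longrightarrow> F' y = x"
  using F_bij by (auto simp: F'_def bij_betw_def)

lemma A_add_closed:
  "x \<in> carrier G.A \<Longrightarrow> y \<in> carrier G.A \<Longrightarrow> x \<oplus>\<^bsub>G.A\<^esub> y \<in> carrier G.A"
  "k \<in> carrier K \<Longrightarrow> x \<in> carrier G.A \<Longrightarrow> k \<odot>\<^bsub>G.A\<^esub> x \<in> carrier G.A"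
  by (auto simp: G.carrier_A) (auto simp: group_algebra_def)

lemma F'_mult: "x \<in> carrier H.A \<Longrightarrow> y \<in> carrier H.A \<Longrightarrow> F' (x \<otimes>\<^bsub>H.A\<^esub> y) = F' x \<otimes>\<^bsub>G.A\<^esub> F' y"
  by (rule F'_eqI) (simp_all add: F'_closed F_mult F_F')

lemma F'_add: "x \<in> carrier H.A \<Longrightarrow> y \<in> carrier H.A \<Longrightarrow> F' (x \<oplus>\<^bsub>H.A\<^esub> y) = F' x \<oplus>\<^bsub>G.A\<^esub> F' y"
  by (rule F'_eqI) (simp_all add: F'_closed F_add F_F' A_add_closed)

lemma F'_smult: "k \<in> carrier K \<Longrightarrow> x \<in> carrier H.A \<Longrightarrow> F' (k \<odot>\<^bsub>H.A\<^esub> x) = k \<odot>\<^bsub>G.A\<^esub> F' x"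
  by (rule F'_eqI) (simp_all add: F'_closed F_smult F_F' A_add_closed)

lemma F_pow: "x \<in> carrier G.A \<Longrightarrow> F (x [^]\<^bsub>G.A\<^esub> (n::nat)) = F x [^]\<^bsub>H.A\<^esub> n"
  by (induction n) (simp_all add: pow_record_simps F_one F_mult)

lemma F'_pow: "x \<in> carrier H.A \<Longrightarrow> F' (x [^]\<^bsub>H.A\<^esub> (n::nat)) = F' x [^]\<^bsub>G.A\<^esub> n"
  by (rule F'_eqI) (simp_all add: F'_closed F_pow F_F')

lemma pair_transport:
  assumes \<phi>: "\<phi> \<in> carrier G \<rightarrow> carrier K" and y: "y \<in> carrier H.A"
  shows "G.pair (F' y) \<phi> = H.pair y (\<lambda>h. G.pair (F' (H.\<delta> h)) \<phi>)"
  using \<phi> y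
  by (intro H.linear_functional_eq_pair)
    (auto simp: F'_closed F'_add F'_smult G.pair_add G.pair_smult)

text \<open>
  Both defining conditions at group elements of \<open>H\<close> are instances of the corresponding rules for the units
  \<open>F' (\<delta> h)\<close> of the group algebra of \<open>G\<close>, which have \<open>p\<close>-power order.
\<close>

lemma frobenius_trace_transport:
  assumes \<phi>: "G.frobenius_trace l \<phi>"
  shows "H.frobenius_trace l (\<lambda>h. G.pair (F' (H.\<delta> h)) \<phi>)"
proof -
  have \<phi>c: "\<phi> \<in> carrier G \<rightarrow> carrier K" using G.ft_closed[OF \<phi>] by auto
  obtain N where N: "order H = p ^ N" using H.order_G by blast
  have F'\<delta>_pow: "F' (H.\<delta> h) [^]\<^bsub>G.A\<^esub> (k::nat) = F' (H.\<delta> (h [^]\<^bsub>H\<^esub> k))" if "h \<in> carrier H" for h k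
    using that by (simp add: F'_pow[symmetric] H.delta_pow)
  have F'\<delta>_mult: "F' (H.\<delta> a) \<otimes>\<^bsub>G.A\<^esub> F' (H.\<delta> b) = F' (H.\<delta> (a \<otimes>\<^bsub>H\<^esub> b))"
    if "a \<in> carrier H" "b \<in> carrier H" for a b
    using that by (simp add: F'_mult[symmetric] H.delta_mult)
  have F'_one: "F' (H.\<delta> \<one>\<^bsub>H\<^esub>) = \<one>\<^bsub>G.A\<^esub>"
    by (rule F'_eqI) (simp_all add: F_one H.one_A)
  have ord: "F' (H.\<delta> h) [^]\<^bsub>G.A\<^esub> (p ^ N) = \<one>\<^bsub>G.A\<^esub>" if "h \<in> carrier H" for h
    using H.G.pow_order_eq_1[OF that] N F'\<delta>_pow[OF that] F'_one by simp
  show ?thesis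
    unfolding H.frobenius_trace_def
  proof (intro conjI ballI)
    show "(\<lambda>h. G.pair (F' (H.\<delta> h)) \<phi>) \<in> carrier H \<rightarrow> carrier K"
      using \<phi>c by (auto simp: F'_closed)
    fix a b assume ab: "a \<in> carrier H" "b \<in> carrier H"
    show "G.pair (F' (H.\<delta> (a \<otimes>\<^bsub>H\<^esub> b \<otimes>\<^bsub>H\<^esub> w))) \<phi> = G.pair (F' (H.\<delta> (b \<otimes>\<^bsub>H\<^esub> a \<otimes>\<^bsub>H\<^esub> w))) \<phi>"
      if w: "w \<in> carrier H" for w
      using G.ft_pair_swap[OF \<phi>, of "F' (H.\<delta> a)" "F' (H.\<delta> b)" "F' (H.\<delta> w)"] ab w
      by (simp add: F'_closed F'\<delta>_mult)
    show "G.pair (F' (H.\<delta> ((a \<otimes>\<^bsub>H\<^esub> b) [^]\<^bsub>H\<^esub> (p ^ l)))) \<phi> =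
        G.pair (F' (H.\<delta> (a [^]\<^bsub>H\<^esub> (p ^ l)))) \<phi> \<oplus> G.pair (F' (H.\<delta> (b [^]\<^bsub>H\<^esub> (p ^ l)))) \<phi>"
      using G.ft_pair_add[OF \<phi> _ ord[OF ab(1)] _ ord[OF ab(2)]] ab
      by (simp add: F'_closed F'\<delta>_mult F'\<delta>_pow)
  qed
qed

lemma F'_iso: "F' \<in> algebra_iso K H.A G.A"
proof -
  have "bij_betw F' (carrier H.A) (carrier G.A)" unfolding F'_def by (rule bij_betw_inv_into[OF F_bij])
  moreover have "F' \<one>\<^bsub>H.A\<^esub> = \<one>\<^bsub>G.A\<^esub>" by (rule F'_eqI) (simp_all add: F_one)
  ultimately show ?thesis
    by (simp add: algebra_iso_def ring_iso_def ring_hom_def F'_closed F'_mult F'_add F'_smult)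
qed

text \<open>
  If there were fewer generators \<open>b j\<close> than generators \<open>a i\<close> of order \<open>p ^ Suc l\<close>, some nontrivial
  combination \<open>\<phi>\<close> of the functionals dual to the \<open>a i\<close>, transported to \<open>H\<close>, would kill all elements
  \<open>b j [^] (p ^ l)\<close>. It would then kill \<open>x [^] (p ^ l)\<close> for the image \<open>x\<close> of every \<open>a k\<close>, but its
  value there is the coefficient \<open>v k\<close>.
\<close>

theorem card_coordinates_le:
  assumes maxG: "is_Ab_NAb G B N" and coordsG: "coordinates (G\<lparr>carrier := B\<rparr>) p t a e c"
    and maxH: "is_Ab_NAb H B' N'" and coordsH: "coordinates (H\<lparr>carrier := B'\<rparr>) p u b f d"
  shows "card {i. i < t \<and> e i = l} \<le> card {j. j < u \<and> f j = l}"
proof (rule ccontr)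
  let ?I = "{i. i < t \<and> e i = l}" and ?J = "{j. j < u \<and> f j = l}"
  assume "\<not> card ?I \<le> card ?J"
  then have less: "card ?J < card ?I" by simp
  let ?B = "G\<lparr>carrier := B\<rparr>"
  interpret C: coordinates ?B p t a e c by fact
  interpret D: coordinates "H\<lparr>carrier := B'\<rparr>" p u b f d by fact
  have decG: "abelian_decomposition G B N" using maxG by (simp add: is_Ab_NAb_def)
  then have idpG: "internal_direct_product G B N" by (simp add: abelian_decomposition_def)
  then have "B \<lhd> G" by (simp add: internal_direct_product_def)
  then interpret B: normal B G .
  have "B' \<lhd> H" using maxH by (simp add: is_Ab_NAb_def abelian_decomposition_def internal_direct_product_def)
  then interpret B': normal B' H .
  obtain \<pi> where \<pi>: "\<pi> \<in> hom G ?B" "\<And>x. x \<in> B \<Longrightarrow> \<pi> x = x"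
    by (rule G.G.internal_direct_product_projections[OF idpG]) blast
  define \<chi> where "\<chi> i = (\<lambda>g. add_pow K (c i (\<pi> g) div p ^ l) \<one>)" for i
  have \<chi>: "G.frobenius_trace l (\<chi> i)" if "i \<in> ?I" for i
    using G.coordinate_frobenius_trace(1)[OF \<pi>(1) coordsG, of i l] that by (simp add: \<chi>_def)
  have aB: "a k \<in> B" if "k < t" for k using C.gen_closed[OF that] by simp
  have \<chi>_gen: "\<chi> i (a k [^]\<^bsub>G\<^esub> (p ^ l)) = (if i = k then \<one> else \<zero>)" if "i \<in> ?I" "k \<in> ?I" for i k
  proof -
    have ik: "i < t" "e i = l" "k < t" using that by auto
    have "\<chi> i (a k [^]\<^bsub>G\<^esub> (p ^ l)) = add_pow K (c i (a k)) \<one>"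
      using G.coordinate_frobenius_trace(2)[OF \<pi>(1) coordsG ik(1,2), of "a k"] aB[OF ik(3)] \<pi>(2)
      by (simp add: \<chi>_def)
    also have "\<dots> = add_pow K (if i = k then 1 else 0 :: nat) \<one>"
    proof (rule G.add_pow_one_cong)
      show "[c i (a k) = (if i = k then 1 else 0)] (mod p)"
        using C.coord_gen[OF ik(1,3)] by (rule cong_dvd_modulus_nat) simp
    qed
    finally show ?thesis by simp
  qed
  have bH: "b j [^]\<^bsub>H\<^esub> (p ^ l) \<in> carrier H" if "j < u" for j
    using D.gen_closed[OF that] by simp
  let ?M = "\<lambda>j i. G.pair (F' (H.\<delta> (b j [^]\<^bsub>H\<^esub> (p ^ l)))) (\<chi> i)"
  have "\<exists>v\<in>?I \<rightarrow> carrier K. (\<exists>i\<in>?I. v i \<noteq> \<zero>) \<and> (\<forall>j\<in>?J. (\<Oplus>i\<in>?I. ?M j i \<otimes> v i) = \<zero>)"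
  proof (rule G.underdetermined_system)
    fix j i assume "j \<in> ?J" "i \<in> ?I"
    then show "?M j i \<in> carrier K" using G.ft_closed[OF \<chi>] by (intro G.pair_closed) (auto simp: F'_closed)
  qed (use less in auto)
  then obtain v k where v: "v \<in> ?I \<rightarrow> carrier K" and k: "k \<in> ?I" "v k \<noteq> \<zero>"
    and sol: "\<And>j. j \<in> ?J \<Longrightarrow> (\<Oplus>i\<in>?I. ?M j i \<otimes> v i) = \<zero>" by blast
  define \<phi> where "\<phi> g = (\<Oplus>i\<in>?I. v i \<otimes> \<chi> i g)" for g
  have finI: "finite ?I" by simp
  have \<phi>: "G.frobenius_trace l \<phi>"
    unfolding \<phi>_def by (rule G.frobenius_trace_lincomb(1)[OF finI v \<chi>])
  have \<phi>_pair: "G.pair x \<phi> = (\<Oplus>i\<in>?I. G.pair x (\<chi> i) \<otimes> v i)" if "x \<in> carrier G.A" for x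
    unfolding \<phi>_def by (rule G.frobenius_trace_lincomb(2)[OF finI v \<chi> that])
  define x where "x = F (G.\<delta> (a k))"
  have kt: "k < t" "e k = l" using k by auto
  have ak: "a k \<in> carrier G" using aB[OF kt(1)] by simp
  have ak_central: "a k \<in> G.G.centre" using G.G.abelian_factor_central[OF decG] aB[OF kt(1)] by blast
  have x: "x \<in> carrier H.A" by (simp add: x_def F_closed)
  have x_central: "H.\<delta> h \<otimes>\<^bsub>H.A\<^esub> x = x \<otimes>\<^bsub>H.A\<^esub> H.\<delta> h" if "h \<in> carrier H" for h
  proof -
    have "H.\<delta> h \<otimes>\<^bsub>H.A\<^esub> x = F (F' (H.\<delta> h) \<otimes>\<^bsub>G.A\<^esub> G.\<delta> (a k))"
      by (simp add: x_def F_mult F'_closed F_F')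
    also have "\<dots> = F (G.\<delta> (a k) \<otimes>\<^bsub>G.A\<^esub> F' (H.\<delta> h))"
      using G.delta_central[OF ak_central, of "F' (H.\<delta> h)"] by (simp add: F'_closed)
    also have "\<dots> = x \<otimes>\<^bsub>H.A\<^esub> H.\<delta> h"
      by (simp add: x_def F_mult F'_closed F_F')
    finally show ?thesis .
  qed
  have x_ord: "x [^]\<^bsub>H.A\<^esub> (p ^ Suc l) = \<one>\<^bsub>H.A\<^esub>"
  proof -
    have "a k [^]\<^bsub>G\<^esub> (p ^ Suc l) = \<one>\<^bsub>G\<^esub>"
      using C.gen_order[OF kt(1)] kt(2) G.G.nat_pow_consistent[of "a k" "p ^ Suc l" B] by simp
    then have "G.\<delta> (a k) [^]\<^bsub>G.A\<^esub> (p ^ Suc l) = \<one>\<^bsub>G.A\<^esub>"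
      unfolding G.delta_pow[OF ak] G.one_A by (simp only:)
    then show ?thesis unfolding x_def by (simp only: F_pow[symmetric] G.delta_closed F_one)
  qed
  let ?\<phi>' = "\<lambda>h. G.pair (F' (H.\<delta> h)) \<phi>"
  have "H.pair (x [^]\<^bsub>H.A\<^esub> (p ^ l)) ?\<phi>' = \<zero>"
  proof (rule H.frobenius_trace_vanishes[OF frobenius_trace_transport[OF \<phi>] maxH coordsH _ x x_central x_ord])
    fix j assume "j < u" "f j = l"
    then show "G.pair (F' (H.\<delta> (b j [^]\<^bsub>H\<^esub> (p ^ l)))) \<phi> = \<zero>"
      using \<phi>_pair sol[of j] by (simp add: F'_closed)
  qed
  moreover have "H.pair (x [^]\<^bsub>H.A\<^esub> (p ^ l)) ?\<phi>' = G.pair (F' (x [^]\<^bsub>H.A\<^esub> (p ^ l))) \<phi>"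
    using x G.ft_closed[OF \<phi>] by (intro pair_transport[symmetric]) auto
  moreover have "F' (x [^]\<^bsub>H.A\<^esub> (p ^ l)) = G.\<delta> (a k [^]\<^bsub>G\<^esub> (p ^ l))"
    using ak by (intro F'_eqI) (simp_all add: x_def F_pow[symmetric] G.delta_pow)
  moreover have "G.pair (G.\<delta> (a k [^]\<^bsub>G\<^esub> (p ^ l))) \<phi> = \<phi> (a k [^]\<^bsub>G\<^esub> (p ^ l))"
    using ak G.ft_closed[OF \<phi>] by (intro G.pair_delta) auto
  moreover have "\<phi> (a k [^]\<^bsub>G\<^esub> (p ^ l)) = (\<Oplus>i\<in>?I. if k = i then v i else \<zero>)"
    unfolding \<phi>_def using v k(1) by (intro G.finsum_cong') (auto simp: \<chi>_gen Pi_iff)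
  moreover have "\<dots> = v k"
    using v k(1) by (intro G.finsum_singleton) auto
  ultimately show False using k(2) by simp
qed

end

theorem proposition3:
  fixes p :: nat
    and G :: "('g, 'm) monoid_scheme" and H :: "('h, 'n) monoid_scheme"
    and K :: "('k, 'r) ring_scheme"
  assumes "Factorial_Ring.prime p"
    and "finite_p_group p G" and "finite_p_group p H"
    and "field K" and "characteristic K = p"
    and "algebra_isomorphic K (group_algebra K G) (group_algebra K H)"
    and "is_Ab_NAb G AbG NAbG" and "is_Ab_NAb H AbH NAbH"
  shows "G\<lparr>carrier := AbG\<rparr> \<cong> H\<lparr>carrier := AbH\<rparr>"
proof -
  have char: "char_p_field K p" using assms(1,4,5) by (rule char_p_field_if_characteristic)
  interpret G: modular_group_algebra K p G using char assms(2) by (rule modular_group_algebra_if_p_group)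
  interpret H: modular_group_algebra K p H using char assms(3) by (rule modular_group_algebra_if_p_group)
  obtain F where "F \<in> algebra_iso K (group_algebra K G) (group_algebra K H)"
    using assms(6) by (auto simp: algebra_isomorphic_def)
  then interpret GH: modular_group_algebra_iso K p G H F by unfold_locales
  interpret HG: modular_group_algebra_iso K p H G GH.F' by unfold_locales (rule GH.F'_iso)
  obtain t a e c where cG: "coordinates (G\<lparr>carrier := AbG\<rparr>) p t a e c"
    using G.abelian_factor_coordinates[OF assms(7)] by blast
  obtain u b f d where cH: "coordinates (H\<lparr>carrier := AbH\<rparr>) p u b f d"
    using H.abelian_factor_coordinates[OF assms(8)] by blast
  have "mon (G\<lparr>carrier := AbG\<rparr>) (H\<lparr>carrier := AbH\<rparr>) \<noteq> {}"
    by (rule coordinates_embedding[OF cG cH GH.card_coordinates_le[OF assms(7) cG assms(8) cH]])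
  moreover have "mon (H\<lparr>carrier := AbH\<rparr>) (G\<lparr>carrier := AbG\<rparr>) \<noteq> {}"
    by (rule coordinates_embedding[OF cH cG HG.card_coordinates_le[OF assms(8) cH assms(7) cG]])
  moreover have "finite (carrier (G\<lparr>carrier := AbG\<rparr>))" "finite (carrier (H\<lparr>carrier := AbH\<rparr>))"
    using G.abelian_factor_finite[OF assms(7)] H.abelian_factor_finite[OF assms(8)] by simp_all
  ultimately show ?thesis by (rule iso_if_mutual_embeddings)
qed

end
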